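(* Let $\alpha\in(0,1)$, let $F=\mathrm{Id}_{2\times2}$, and for $v:\mathbb{R}^2\to\mathbb{R}^2$ with symmetrized gradient $e(v)=\frac12(\nabla v+(\nabla v)^t)$ and $\chi\in BV([0,1]^2;\{0,1\})$ let $$\mathcal{E}_\epsilon(v,\chi)=\int_{[0,1]^2}\left|e(v)-\begin{pmatrix}1&0\\0&1+\alpha(1-2\chi)\end{pmatrix}\right|^2dx+\epsilon\int_{[0,1]^2}|\nabla\chi|.$$ Then there exists $\epsilon_0=\epsilon_0(\alpha)>0$ such that for $\epsilon\in(0,\epsilon_0)$ $$\inf_{\chi\in BV([0,1]^2;\{0,1\})}\ \inf_{e(v)\in\mathcal{D}^{\mathcal{A}}_F}\ \mathcal{E}_\epsilon(v,\chi)\ \sim\ \epsilon^{4/5}.$$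
   Context: Here $\mathcal{A}(D)=\operatorname{curl}\operatorname{curl}$ is the second order operator annihilating symmetrized gradients in two dimensions, and $\mathcal{D}^{\mathcal{A}}_F$ is the set of $w\in L^2_{loc}(\mathbb{R}^2;\mathbb{R}^{2\times2}_{sym})$ with $\mathcal{A}(D)w=0$ in $\mathbb{R}^2$ (distributionally) and $w=F$ in $\mathbb{R}^2\setminus[0,1]^2$; thus the inner infimum runs over all $v$ with $e(v)\in L^2_{loc}$ and $e(v)=F$ outside $[0,1]^2$. The notation $f\sim g$ means that there are constants $c,C>0$, independent of $\epsilon$, with $cf\le g\le Cf$. $\int|\nabla\chi|$ is the total variation. *)

theory Defs
  imports "HOL-Analysis.Analysis"
begin

definition partial :: "'n::finite \<Rightarrow> (real^'n \<Rightarrow> real) \<Rightarrow> real^'n \<Rightarrow> real" where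
  "partial i f x = frechet_derivative f (at x) (axis i 1)"

primrec C_diff :: "nat \<Rightarrow> (real^'n::finite \<Rightarrow> real) \<Rightarrow> bool" where
  "C_diff 0 f \<longleftrightarrow> continuous_on UNIV f"
| "C_diff (Suc k) f \<longleftrightarrow> (\<forall>x. f differentiable (at x)) \<and> (\<forall>i. C_diff k (partial i f))"

definition compactly_supported_in :: "'a::topological_space set \<Rightarrow> ('a \<Rightarrow> 'b::zero) \<Rightarrow> bool" where
  "compactly_supported_in \<Omega> f \<longleftrightarrow>
     compact (closure {x. f x \<noteq> 0}) \<and> closure {x. f x \<noteq> 0} \<subseteq> \<Omega>"

definition test_functions :: "(real^'n::finite \<Rightarrow> real) set" where
  "test_functions = {\<phi>. (\<forall>k. C_diff k \<phi>) \<and> compactly_supported_in UNIV \<phi>}"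

definition L1_loc :: "('a::euclidean_space \<Rightarrow> 'b::euclidean_space) set" where
  "L1_loc = {f. \<forall>K. compact K \<longrightarrow> f absolutely_integrable_on K}"

definition L2_loc :: "('a::euclidean_space \<Rightarrow> 'b::euclidean_space) set" where
  "L2_loc = {f. f \<in> borel_measurable lebesgue \<and>
     (\<forall>K. compact K \<longrightarrow> (\<lambda>x. (norm (f x))\<^sup>2) absolutely_integrable_on K)}"

text \<open>\<open>w\<close> represents the distributional symmetrized gradient
  \<open>e(v) = (\<nabla>v + (\<nabla>v)\<^sup>t) / 2\<close>.\<close>

definition has_sym_grad :: "(real^'n::finite \<Rightarrow> real^'n) \<Rightarrow> (real^'n \<Rightarrow> real^'n^'n) \<Rightarrow> bool" where
  "has_sym_grad v w \<longleftrightarrow> v \<in> L1_loc \<and> w \<in> L1_loc \<and>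
     (\<forall>\<phi>\<in>test_functions. \<forall>i j.
        (LINT x|lebesgue. w x $ i $ j * \<phi> x) =
        - (LINT x|lebesgue. (v x $ i * partial j \<phi> x + v x $ j * partial i \<phi> x) / 2))"

text \<open>With the row-wise curl \<open>(curl w)\<^sub>i = \<partial>\<^sub>1 w\<^sub>i\<^sub>2 - \<partial>\<^sub>2 w\<^sub>i\<^sub>1\<close>, one has
  \<open>curl curl w = \<partial>\<^sub>1\<partial>\<^sub>1 w\<^sub>2\<^sub>2 - \<partial>\<^sub>1\<partial>\<^sub>2 w\<^sub>2\<^sub>1 - \<partial>\<^sub>2\<partial>\<^sub>1 w\<^sub>1\<^sub>2 + \<partial>\<^sub>2\<partial>\<^sub>2 w\<^sub>1\<^sub>1\<close>;
  both derivatives are moved onto the test function.\<close>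

definition curl_curl_free :: "(real^2 \<Rightarrow> real^2^2) \<Rightarrow> bool" where
  "curl_curl_free w \<longleftrightarrow> (\<forall>\<phi>\<in>test_functions.
     (LINT x|lebesgue.
          w x $ 2 $ 2 * partial 1 (partial 1 \<phi>) x
        - w x $ 2 $ 1 * partial 1 (partial 2 \<phi>) x
        - w x $ 1 $ 2 * partial 2 (partial 1 \<phi>) x
        + w x $ 1 $ 1 * partial 2 (partial 2 \<phi>) x) = 0)"

abbreviation unit_square :: "(real^2) set" where
  "unit_square \<equiv> cbox 0 1"

definition D_curl_curl :: "real^2^2 \<Rightarrow> (real^2 \<Rightarrow> real^2^2) set" where
  "D_curl_curl F = {w. w \<in> L2_loc \<and> (\<forall>x. transpose (w x) = w x) \<and> curl_curl_free w \<and>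
     (AE x in lebesgue. x \<notin> unit_square \<longrightarrow> w x = F)}"

definition divergence :: "(real^'n::finite \<Rightarrow> real^'n) \<Rightarrow> real^'n \<Rightarrow> real" where
  "divergence \<phi> x = (\<Sum>i\<in>UNIV. partial i (\<lambda>y. \<phi> y $ i) x)"

text \<open>The truncation of negative values by \<^term>\<open>ennreal\<close> is harmless: \<open>\<phi> = 0\<close> is a competitor.\<close>

definition total_variation :: "(real^'n::finite) set \<Rightarrow> (real^'n \<Rightarrow> real) \<Rightarrow> ennreal" where
  "total_variation \<Omega> u =
     (SUP \<phi>\<in>{\<phi>. (\<forall>i. C_diff 1 (\<lambda>x. \<phi> x $ i)) \<and> compactly_supported_in \<Omega> \<phi> \<and>
                 (\<forall>x. norm (\<phi> x) \<le> 1)}.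
        ennreal (LINT x:\<Omega>|lebesgue. u x * divergence \<phi> x))"

text \<open>\<open>BV\<close> on the closed square is understood as \<open>BV\<close> of its interior: jumps across the boundary
  of the square are not counted.\<close>

definition BV_phase :: "(real^2 \<Rightarrow> real) set" where
  "BV_phase = {u. u absolutely_integrable_on unit_square \<and>
     (\<forall>x\<in>unit_square. u x \<in> {0, 1}) \<and>
     total_variation (interior unit_square) u < \<infinity>}"

text \<open>\<open>u\<close> is the phase indicator (the letter chi is reserved for vector syntax). The energy depends on \<open>v\<close> only through \<open>e(v)\<close>; its argument \<open>w\<close> is a representative
  of \<open>e(v)\<close>. The norm of \<^typ>\<open>real^2^2\<close> is the Frobenius norm.\<close>

definition energy :: "real \<Rightarrow> real \<Rightarrow> (real^2 \<Rightarrow> real^2^2) \<Rightarrow> (real^2 \<Rightarrow> real) \<Rightarrow> ennreal" where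
  "energy \<alpha> \<epsilon> w u =
     (\<integral>\<^sup>+x\<in>unit_square. ennreal ((norm (w x -
         vector [vector [1, 0], vector [0, 1 + \<alpha> * (1 - 2 * u x)]]))\<^sup>2) \<partial>lebesgue)
     + ennreal \<epsilon> * total_variation (interior unit_square) u"

end

theory Submission
  imports Defs
begin

text \<open>Write \<open>w = Id + \<omega>\<close> and \<open>f = \<alpha> (1 - 2 \<chi>)\<close>, so that the elastic energy is
  \<open>\<omega>\<^sub>1\<^sub>1\<^sup>2 + 2 \<omega>\<^sub>1\<^sub>2\<^sup>2 + (\<omega>\<^sub>2\<^sub>2 - f)\<^sup>2\<close> and \<open>\<omega>\<close> vanishes outside the square.

  Lower bound. Let \<open>k'' = \<rho>\<close> be a mollifier at scale \<open>h\<close>. Testing \<open>curl curl \<omega> = 0\<close> with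
  \<open>k(x\<^sub>1 - y\<^sub>1) \<rho>(x\<^sub>2 - y\<^sub>2)\<close> expresses the mollified \<open>\<omega>\<^sub>2\<^sub>2\<close> by \<open>\<omega>\<^sub>1\<^sub>2\<close> and \<open>\<omega>\<^sub>1\<^sub>1\<close>, hence its \<open>L\<^sup>1\<close> norm is at
  most \<open>C h\<^sup>-\<^sup>2\<close> times the square root of the elastic energy. On the other hand mollification changes \<open>f\<close>
  only by \<open>h\<close> times its total variation. Since \<open>\<bar>f\<bar> = \<alpha>\<close>, both quantities cannot be small, and
  \<open>h = \<epsilon>\<^sup>1\<^sup>/\<^sup>5\<close> gives the exponent.

  Upper bound. The displacement \<open>(x\<^sub>1 - \<partial>\<^sub>1\<psi>, x\<^sub>2 + \<partial>\<^sub>2\<psi>)\<close> of a potential \<open>\<psi>\<close> has no shear and costs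
  \<open>\<integral> (\<partial>\<^sub>1\<^sub>1\<psi>)\<^sup>2 + (\<partial>\<^sub>2\<^sub>2\<psi> - f)\<^sup>2\<close>. A laminate in \<open>x\<^sub>2\<close> with \<open>N \<approx> \<epsilon>\<^sup>-\<^sup>1\<^sup>/\<^sup>5\<close> periods, which doubles the number of
  periods at the distances \<open>(2/5)\<^sup>j / 2\<close> from the vertical sides, has bending energy \<open>O(N\<^sup>-\<^sup>4)\<close> and
  interfaces of length \<open>O(N)\<close>.\<close>

section \<open>Smooth functions of one variable\<close>

text \<open>The wells differ by a multiple of the matrix unit (2,2), on which the symbol of curl
  curl is xi_1^2. This double zero produces 4/5: compatibility controls that entry only through two
  derivatives in x_1, so the kernel must be a second antiderivative of the mollifier and costs h^-2,
  and a branching zone of width l with n periods pays n^-4 l^-3 for bending. When h times the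
  variation and h^-2 times the root of the elastic energy are both of order one, \<epsilon> times
  the variation balances the elastic energy h^4 at h^5 = \<epsilon>. If zones shrink by a factor q
  while the number of periods doubles, interface length is summable for 2 q < 1 and bending for 16
  q^3 > 1; q = 2/5 lies in this narrow window. The variation is known only by duality and inside the
  square. Therefore mollification and translation act on a C^1 test function supported away from the
  boundary, never on the phase. The potential of the construction is piecewise quadratic, so its
  second derivatives are weak and are computed line by line. This needs finitely many kinks on each
  line, apart from points where a kink curve is horizontal.\<close>

primrec Ck :: "nat \<Rightarrow> (real \<Rightarrow> real) \<Rightarrow> bool" where
  "Ck 0 f \<longleftrightarrow> continuous_on UNIV f"
| "Ck (Suc k) f \<longleftrightarrow> (\<exists>f'. (\<forall>x. (f has_real_derivative f' x) (at x)) \<and> Ck k f')"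

definition smooth1 :: "(real \<Rightarrow> real) \<Rightarrow> bool" where
  "smooth1 f \<longleftrightarrow> (\<forall>k. Ck k f)"

lemma Ck_SucD: "Ck (Suc k) f \<Longrightarrow> Ck k f"
proof (induction k arbitrary: f)
  case 0
  then show ?case
    by (auto intro!: continuous_at_imp_continuous_on) (metis DERIV_isCont)
next
  case (Suc k)
  then obtain f' where "\<And>x. (f has_real_derivative f' x) (at x)" "Ck (Suc k) f'"
    by (auto simp del: Ck.simps(2) simp: Ck.simps(2)[of "Suc k"])
  with Suc.IH[of f'] show ?case by auto
qed

lemma Ck_SucI: "(\<And>x. (f has_real_derivative f' x) (at x)) \<Longrightarrow> Ck k f' \<Longrightarrow> Ck (Suc k) f"
  by auto

lemma Ck_const: "Ck k (\<lambda>x. c)"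
  by (induction k arbitrary: c) (auto intro!: exI[of _ "\<lambda>x. 0"])

lemma Ck_affine_self: "Ck k (\<lambda>x. c * x + d)"
proof (cases k)
  case (Suc m)
  then show ?thesis
    by (auto intro!: exI[of _ "\<lambda>x. c"] derivative_eq_intros Ck_const)
qed (auto intro!: continuous_intros)

lemma Ck_add: "Ck k f \<Longrightarrow> Ck k g \<Longrightarrow> Ck k (\<lambda>x. f x + g x)"
proof (induction k arbitrary: f g)
  case 0
  then show ?case by (auto intro!: continuous_intros)
next
  case (Suc k)
  then obtain f' g' where "\<And>x. (f has_real_derivative f' x) (at x)" "Ck k f'"
     "\<And>x. (g has_real_derivative g' x) (at x)" "Ck k g'" by auto
  then show ?case using Suc.IH[of f' g']
    by (auto intro!: exI[of _ "\<lambda>x. f' x + g' x"] derivative_eq_intros)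
qed

lemma Ck_mult: "Ck k f \<Longrightarrow> Ck k g \<Longrightarrow> Ck k (\<lambda>x. f x * g x)"
proof (induction k arbitrary: f g)
  case 0
  then show ?case by (auto intro!: continuous_intros)
next
  case (Suc k)
  then obtain f' g' where "\<And>x. (f has_real_derivative f' x) (at x)" "Ck k f'"
     "\<And>x. (g has_real_derivative g' x) (at x)" "Ck k g'" by auto
  moreover have "Ck k (\<lambda>x. f' x * g x + f x * g' x)"
    using Suc.IH Ck_add Ck_SucD Suc.prems calculation by metis
  ultimately show ?case
    by (auto intro!: exI[of _ "\<lambda>x. f' x * g x + f x * g' x"] derivative_eq_intros)
qed

lemma Ck_affine: "Ck k f \<Longrightarrow> Ck k (\<lambda>x. f (c * x + d))"
proof (induction k arbitrary: f)
  case 0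
  then show ?case by (auto intro!: continuous_intros continuous_on_compose2[of UNIV f])
next
  case (Suc k)
  then obtain f' where f': "\<And>x. (f has_real_derivative f' x) (at x)" "Ck k f'" by auto
  have "((\<lambda>x. f (c * x + d)) has_real_derivative c * f' (c * x + d)) (at x)" for x
  proof -
    have "((\<lambda>x. c * x + d) has_real_derivative c) (at x)"
      by (auto intro!: derivative_eq_intros)
    then show ?thesis
      using DERIV_chain'[of "\<lambda>x. c * x + d" c x UNIV f "f' (c*x+d)"] f' by (simp add: mult.commute)
  qed
  moreover have "Ck k (\<lambda>x. c * f' (c * x + d))"
    using Suc.IH f'(2) Ck_mult Ck_const by blast
  ultimately show ?case by (auto intro!: exI[of _ "\<lambda>x. c * f' (c * x + d)"])
qed

lemma Ck_inverse: "Ck k g \<Longrightarrow> (\<And>x. g x \<noteq> 0) \<Longrightarrow> Ck k (\<lambda>x. inverse (g x))"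
proof (induction k)
  case 0
  then show ?case by (auto intro!: continuous_intros)
next
  case (Suc k)
  then obtain g' where g': "\<And>x. (g has_real_derivative g' x) (at x)" "Ck k g'" by auto
  have "((\<lambda>x. inverse (g x)) has_real_derivative (-1) * (g' x * (inverse (g x) * inverse (g x)))) (at x)" for x
    using g'(1)[of x] Suc.prems(2)[of x] by (auto intro!: derivative_eq_intros)
  moreover have "Ck k (\<lambda>x. (-1) * (g' x * (inverse (g x) * inverse (g x))))"
    using Suc Ck_SucD g' by (intro Ck_mult Ck_const Suc.IH) blast+
  ultimately show ?case by (rule Ck_SucI)
qed

text \<open>Allowing the divisor \<open>x ^ n\<close> closes the family under differentiation, so
  smoothness of exp(-1/x) follows from one induction over all \<open>n\<close> at once.\<close>

definition flat_exp :: "nat \<Rightarrow> real \<Rightarrow> real" where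
  "flat_exp n x = (if x \<le> 0 then 0 else exp (- (1/x)) / x ^ n)"

lemma flat_exp_tendsto_0: "(flat_exp n \<longlongrightarrow> 0) (at 0)"
proof -
  have "((\<lambda>x::real. (inverse x) ^ n / exp (inverse x)) \<longlongrightarrow> 0) (at_right 0)"
    by (rule filterlim_compose[OF tendsto_power_div_exp_0 filterlim_inverse_at_top_right])
  then have "(flat_exp n \<longlongrightarrow> 0) (at_right 0)"
    by (rule Lim_transform_eventually)
       (auto simp: flat_exp_def eventually_at_filter exp_minus field_simps)
  moreover have "(flat_exp n \<longlongrightarrow> 0) (at_left 0)"
    by (rule tendsto_eventually) (auto simp: flat_exp_def eventually_at_filter)
  ultimately show ?thesis by (rule filterlim_split_at_real[rotated])
qed

lemma flat_exp_deriv: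
  "(flat_exp n has_real_derivative (- real n) * flat_exp (Suc n) x + flat_exp (Suc (Suc n)) x) (at x)"
proof -
  consider "x < 0" | "x = 0" | "x > 0" by linarith
  then show ?thesis
  proof cases
    case 1
    have "((\<lambda>x. 0) has_real_derivative 0) (at x)" by simp
    then have "(flat_exp n has_real_derivative 0) (at x)"
      by (rule has_field_derivative_transform_within_open[of _ _ _ "{..<0}"])
         (use 1 in \<open>auto simp: flat_exp_def\<close>)
    then show ?thesis using 1 by (simp add: flat_exp_def)
  next
    case 2
    \<comment> \<open>The difference quotient at 0 is \<open>flat_exp (Suc n)\<close>, which tends
      to 0.\<close>
    have "((\<lambda>h. flat_exp n (0 + h) / h) \<longlongrightarrow> 0) (at 0)"
      by (rule Lim_transform_eventually[OF flat_exp_tendsto_0[of "Suc n"]])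
         (auto simp: flat_exp_def eventually_at_filter)
    then have "(flat_exp n has_real_derivative 0) (at 0)"
      unfolding DERIV_def by (simp add: flat_exp_def)
    then show ?thesis using 2 by (simp add: flat_exp_def)
  next
    case 3
    have "((\<lambda>x. exp (- (1/x)) / x ^ n) has_real_derivative
       ((- real n) * (exp (- (1/x)) / x ^ Suc n) + exp (- (1/x)) / x ^ Suc (Suc n))) (at x)"
    proof -
      have "((\<lambda>x. exp (- (1/x))) has_real_derivative exp (- (1/x)) / x\<^sup>2) (at x)"
        using 3 by (auto intro!: derivative_eq_intros simp: power2_eq_square field_simps)
      from DERIV_divide[OF this DERIV_pow[of n x UNIV]] 3 show ?thesis
        by (rule_tac DERIV_cong, simp) (cases n, auto simp: field_simps power2_eq_square)
    qed
    then have "(flat_exp n has_real_derivative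
       ((- real n) * (exp (- (1/x)) / x ^ Suc n) + exp (- (1/x)) / x ^ Suc (Suc n))) (at x)"
      by (rule has_field_derivative_transform_within_open[of _ _ _ "{0<..}"])
         (use 3 in \<open>auto simp: flat_exp_def\<close>)
    then show ?thesis using 3 by (simp add: flat_exp_def)
  qed
qed

lemma Ck_flat_exp: "Ck k (flat_exp n)"
proof (induction k arbitrary: n)
  case 0
  then show ?case
    using flat_exp_deriv DERIV_isCont by (auto intro!: continuous_at_imp_continuous_on) blast
next
  case (Suc k)
  have "Ck k (\<lambda>x. (- real n) * flat_exp (Suc n) x + flat_exp (Suc (Suc n)) x)"
    by (intro Ck_add Ck_mult Ck_const Suc.IH)
  with flat_exp_deriv show ?case by (rule Ck_SucI)
qed

lemma smooth1_deriv:
  assumes "smooth1 f"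
  shows "(f has_real_derivative deriv f x) (at x)" "smooth1 (deriv f)"
proof -
  have *: "(\<forall>x. (f has_real_derivative deriv f x) (at x)) \<and> Ck k (deriv f)" for k
  proof -
    obtain f' where f': "\<And>x. (f has_real_derivative f' x) (at x)" "Ck k f'"
      using assms unfolding smooth1_def by (metis Ck.simps(2))
    then have "deriv f = f'" by (auto intro: DERIV_imp_deriv)
    then show ?thesis using f' by auto
  qed
  then show "(f has_real_derivative deriv f x) (at x)" "smooth1 (deriv f)"
    by (auto simp: smooth1_def)
qed

lemma smooth1_continuous: "smooth1 f \<Longrightarrow> continuous_on A f"
  using continuous_on_subset[of UNIV f A] by (metis Ck.simps(1) smooth1_def subset_UNIV)

lemma smooth1_mult: "smooth1 f \<Longrightarrow> smooth1 g \<Longrightarrow> smooth1 (\<lambda>x. f x * g x)"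
  and smooth1_add: "smooth1 f \<Longrightarrow> smooth1 g \<Longrightarrow> smooth1 (\<lambda>x. f x + g x)"
  and smooth1_const: "smooth1 (\<lambda>x. c)"
  and smooth1_affine_self: "smooth1 (\<lambda>x. c * x + d)"
  and smooth1_affine: "smooth1 f \<Longrightarrow> smooth1 (\<lambda>x. f (c * x + d))"
  by (auto simp: smooth1_def Ck_mult Ck_add Ck_const Ck_affine Ck_affine_self)

text \<open>One-sided constancy suffices because a two-sided derivative equals its one-sided limit;
  the point \<open>a\<close> itself is therefore included.\<close>

lemma deriv_eq_0_left:
  fixes f :: "real \<Rightarrow> real"
  assumes "\<And>y. y \<le> a \<Longrightarrow> f y = c" "(f has_real_derivative d) (at x)" "x \<le> a"
  shows "d = 0"
proof -
  have "((\<lambda>y. (f y - f x) / (y - x)) \<longlongrightarrow> d) (at_left x)"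
    using assms(2) unfolding has_field_derivative_iff by (rule filterlim_mono) (auto simp: at_le)
  moreover have "((\<lambda>y. (f y - f x) / (y - x)) \<longlongrightarrow> 0) (at_left x)"
    by (rule tendsto_eventually) (use assms in \<open>auto simp: eventually_at_filter\<close>)
  ultimately show ?thesis by (rule tendsto_unique[rotated]) simp
qed

lemma deriv_eq_0_right:
  fixes f :: "real \<Rightarrow> real"
  assumes "\<And>y. y \<ge> a \<Longrightarrow> f y = c" "(f has_real_derivative d) (at x)" "x \<ge> a"
  shows "d = 0"
proof -
  have "((\<lambda>y. (f y - f x) / (y - x)) \<longlongrightarrow> d) (at_right x)"
    using assms(2) unfolding has_field_derivative_iff by (rule filterlim_mono) (auto simp: at_le)
  moreover have "((\<lambda>y. (f y - f x) / (y - x)) \<longlongrightarrow> 0) (at_right x)"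
    by (rule tendsto_eventually) (use assms in \<open>auto simp: eventually_at_filter\<close>)
  ultimately show ?thesis by (rule tendsto_unique[rotated]) simp
qed

section \<open>A smooth step function\<close>

definition sstep :: "real \<Rightarrow> real" where
  "sstep s = flat_exp 0 s / (flat_exp 0 s + flat_exp 0 (1 - s))"

lemma flat_exp_0_nonneg: "flat_exp 0 s \<ge> 0" and flat_exp_0_pos: "s > 0 \<Longrightarrow> flat_exp 0 s > 0"
  and flat_exp_0_nonpos: "s \<le> 0 \<Longrightarrow> flat_exp 0 s = 0"
  by (auto simp: flat_exp_def)

lemma flat_exp_0_mono: "s \<le> t \<Longrightarrow> flat_exp 0 s \<le> flat_exp 0 t"
  by (auto simp: flat_exp_def frac_le)

lemma flat_exp_0_strict_mono: "s < t \<Longrightarrow> 0 < t \<Longrightarrow> flat_exp 0 s < flat_exp 0 t"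
  by (auto simp: flat_exp_def frac_less2)

lemma sstep_denom: "flat_exp 0 s + flat_exp 0 (1 - s) > 0"
  using flat_exp_0_pos[of s] flat_exp_0_pos[of "1-s"] flat_exp_0_nonneg[of s] flat_exp_0_nonneg[of "1-s"]
  by (cases "s > 0") (auto simp: add_pos_nonneg add_nonneg_pos)

lemma smooth1_sstep: "smooth1 sstep"
proof -
  have "Ck k (\<lambda>s. flat_exp 0 s * inverse (flat_exp 0 s + flat_exp 0 ((-1) * s + 1)))" for k
    using sstep_denom by (intro Ck_mult Ck_inverse Ck_add Ck_flat_exp Ck_affine) (smt (verit))
  then show ?thesis unfolding smooth1_def sstep_def[abs_def] by (simp add: divide_inverse algebra_simps)
qed

lemma sstep_0: "s \<le> 0 \<Longrightarrow> sstep s = 0" and sstep_1: "s \<ge> 1 \<Longrightarrow> sstep s = 1"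
  using flat_exp_0_pos[of s] by (auto simp: sstep_def flat_exp_0_nonpos)

lemma sstep_bounds: "0 \<le> sstep s" "sstep s \<le> 1"
  using sstep_denom[of s] flat_exp_0_nonneg[of s] flat_exp_0_nonneg[of "1-s"]
  by (auto simp: sstep_def)

lemma frac_le_eq':
  fixes a b c d :: real
  assumes "b > 0" "d > 0" shows "a / b \<le> c / d \<longleftrightarrow> a * d \<le> c * b"
  using assms by (simp add: field_simps)

lemma sstep_mono: assumes "s \<le> t" shows "sstep s \<le> sstep t"
proof -
  have "flat_exp 0 s * flat_exp 0 (1 - t) \<le> flat_exp 0 t * flat_exp 0 (1 - s)"
    using assms by (intro mult_mono flat_exp_0_mono flat_exp_0_nonneg) auto
  then show ?thesis
    unfolding sstep_def using sstep_denom[of s] sstep_denom[of t]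
    by (simp add: frac_le_eq' algebra_simps)
qed

text \<open>Strictness matters later: every intermediate value of the step is taken only once, which
  makes the profile \<open>bump\<close> transversal.\<close>

lemma sstep_inj: assumes "0 < s" "s < 1" "0 < t" "t < 1" "sstep s = sstep t" shows "s = t"
proof -
  have eq: "flat_exp 0 s * flat_exp 0 (1 - t) = flat_exp 0 t * flat_exp 0 (1 - s)"
    using assms(5) sstep_denom[of s] sstep_denom[of t]
    unfolding sstep_def by (simp add: frac_eq_eq algebra_simps)
  have "flat_exp 0 x * flat_exp 0 (1 - y) < flat_exp 0 y * flat_exp 0 (1 - x)"
    if "0 < x" "x < y" "y < 1" for x y
    using that by (intro mult_strict_mono flat_exp_0_strict_mono flat_exp_0_nonneg flat_exp_0_pos) auto
  then show ?thesis using eq assms by (metis linorder_neqE_linordered_idom order_less_irrefl)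
qed

abbreviation "sstep' \<equiv> deriv sstep"
abbreviation "sstep'' \<equiv> deriv (deriv sstep)"

lemmas sstep_deriv = smooth1_deriv(1)[OF smooth1_sstep]
  and sstep_deriv2 = smooth1_deriv(1)[OF smooth1_deriv(2)[OF smooth1_sstep]]

lemma sstep'_eq_0: "s \<le> 0 \<or> s \<ge> 1 \<Longrightarrow> sstep' s = 0"
  using deriv_eq_0_left[OF sstep_0 sstep_deriv] deriv_eq_0_right[OF sstep_1 sstep_deriv] by auto

lemma sstep''_eq_0: "s \<le> 0 \<or> s \<ge> 1 \<Longrightarrow> sstep'' s = 0"
  using deriv_eq_0_left[OF _ sstep_deriv2, of 0 0] deriv_eq_0_right[OF _ sstep_deriv2, of 1 0]
    sstep'_eq_0 by auto

lemma sstep_deriv_bound: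
  obtains M where "M > 0" "\<And>s. \<bar>sstep' s\<bar> \<le> M" "\<And>s. \<bar>sstep'' s\<bar> \<le> M"
proof -
  have "bounded (sstep' ` {0..1})" "bounded (sstep'' ` {0..1})"
    by (auto intro!: compact_imp_bounded compact_continuous_image smooth1_continuous smooth1_deriv smooth1_sstep)
  then obtain A B where A: "\<And>s. s \<in> {0..1} \<Longrightarrow> \<bar>sstep' s\<bar> \<le> A" and B: "\<And>s. s \<in> {0..1} \<Longrightarrow> \<bar>sstep'' s\<bar> \<le> B"
    unfolding bounded_iff by (metis imageI real_norm_def)
  show ?thesis
  proof (rule that[of "\<bar>A\<bar> + \<bar>B\<bar> + 1"])
    fix s
    show "\<bar>sstep' s\<bar> \<le> \<bar>A\<bar> + \<bar>B\<bar> + 1"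
      using A[of s] sstep'_eq_0[of s] by (cases "s \<in> {0..1}") auto
    show "\<bar>sstep'' s\<bar> \<le> \<bar>A\<bar> + \<bar>B\<bar> + 1"
      using B[of s] sstep''_eq_0[of s] by (cases "s \<in> {0..1}") auto
  qed auto
qed

section \<open>Test functions and weak derivatives in the plane\<close>

definition pt :: "real \<Rightarrow> real \<Rightarrow> real^2" where
  "pt a b = (\<chi> i. if i = 1 then a else b)"

lemma pt_nth [simp]: "pt a b $ 1 = a" "pt a b $ 2 = b"
  by (auto simp: pt_def)

lemma pt_eta [simp]: "pt (x $ 1) (x $ 2) = x"
  by (simp add: vec_eq_iff forall_2)

lemma continuous_pt [continuous_intros]:
  "continuous_on S f \<Longrightarrow> continuous_on S g \<Longrightarrow> continuous_on S (\<lambda>x. pt (f x) (g x))"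
  unfolding pt_def by (rule continuous_on_vec_lambda, rename_tac i, case_tac "i = 1") auto

lemma measurable_pt [measurable]:
  "f \<in> borel_measurable M \<Longrightarrow> g \<in> borel_measurable M \<Longrightarrow> (\<lambda>x. pt (f x) (g x)) \<in> borel_measurable M"
proof -
  have "(\<lambda>p. pt (fst p) (snd p)) \<in> borel_measurable (borel :: (real \<times> real) measure)"
    by (intro borel_measurable_continuous_onI continuous_intros)
  moreover assume "f \<in> borel_measurable M" "g \<in> borel_measurable M"
  ultimately show ?thesis
    using measurable_compose[of "\<lambda>x. (f x, g x)" M borel "\<lambda>p. pt (fst p) (snd p)" borel]
    by (simp add: borel_prod[symmetric])
qed

lemma measurable_nth2 [measurable]: "(\<lambda>x::real^2. x $ i) \<in> borel_measurable borel"
  by (intro borel_measurable_continuous_onI continuous_intros)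

lemma Basis_real2: "Basis = {axis 1 1, axis 2 1 :: real^2}"
  by (auto simp: Basis_vec_def exhaust_2) (metis exhaust_2)

lemma axis_1_neq_2: "axis 1 1 \<noteq> (axis 2 1 :: real^2)"
  by (simp add: axis_eq_axis)

lemma prod_Basis_real2: "(\<Prod>b\<in>Basis. f b) = f (axis 1 1) * (f (axis 2 1 :: real^2) :: 'c::comm_monoid_mult)"
  by (simp add: Basis_real2 axis_1_neq_2)

lemma box_real2: "x \<in> box l u \<longleftrightarrow> x$1 \<in> {l$1<..<u$1} \<and> x$2 \<in> {l$2<..<(u::real^2)$2}"
  and cbox_real2: "x \<in> cbox l u \<longleftrightarrow> x$1 \<in> {l$1..u$1} \<and> x$2 \<in> {l$2..u$2}"
  by (auto simp: mem_box_cart forall_2)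

text \<open>Lebesgue measure is determined by its values on boxes. The image of the product measure
  has the same values, so Fubini becomes available on \<open>real^2\<close>.\<close>

lemma lborel_real2: "lborel = distr (lborel \<Otimes>\<^sub>M lborel) borel (\<lambda>p. pt (fst p) (snd p))"
proof (rule lborel_eqI)
  fix l u :: "real^2"
  assume le: "\<And>b. b \<in> Basis \<Longrightarrow> l \<bullet> b \<le> u \<bullet> b"
  have le': "l $ 1 \<le> u $ 1" "l $ 2 \<le> u $ 2"
    using le[of "axis 1 1"] le[of "axis 2 1"] by (auto simp: Basis_real2 inner_axis)
  have "emeasure (distr (lborel \<Otimes>\<^sub>M lborel) borel (\<lambda>p. pt (fst p) (snd p))) (box l u) =
     emeasure (lborel \<Otimes>\<^sub>M lborel) ((\<lambda>p. pt (fst p) (snd p)) -` box l u \<inter> space (lborel \<Otimes>\<^sub>M lborel))"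
    by (rule emeasure_distr) auto
  also have "(\<lambda>p. pt (fst p) (snd p)) -` box l u \<inter> space (lborel \<Otimes>\<^sub>M lborel)
      = {l$1<..<u$1} \<times> {l$2<..<u$2}"
    by (auto simp: box_real2 space_pair_measure)
  also have "emeasure (lborel \<Otimes>\<^sub>M lborel) \<dots> = ennreal (u$1 - l$1) * ennreal (u$2 - l$2)"
    using le' by (subst lborel.emeasure_pair_measure_Times) auto
  also have "\<dots> = (\<Prod>b\<in>Basis. (u - l) \<bullet> b)"
    using le' by (simp add: prod_Basis_real2 inner_axis ennreal_mult)
  finally show "emeasure (distr (lborel \<Otimes>\<^sub>M lborel) borel (\<lambda>p. pt (fst p) (snd p))) (box l u)
      = (\<Prod>b\<in>Basis. (u - l) \<bullet> b)" .
qed auto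

lemma integrable_real2:
  fixes f :: "real^2 \<Rightarrow> real"
  assumes "integrable lborel f"
  shows "integrable (lborel \<Otimes>\<^sub>M lborel) (\<lambda>(a, b). f (pt a b))"
  using assms by (subst (asm) lborel_real2, subst (asm) integrable_distr_eq) (auto simp: case_prod_beta')

lemma integral_real2:
  fixes f :: "real^2 \<Rightarrow> real"
  assumes "integrable lborel f"
  shows "(LINT x|lborel. f x) = (LINT b|lborel. LINT a|lborel. f (pt a b))"
    and "(LINT x|lborel. f x) = (LINT a|lborel. LINT b|lborel. f (pt a b))"
proof -
  note i = integrable_real2[OF assms]
  have "(LINT x|lborel. f x) = (LINT p|(lborel \<Otimes>\<^sub>M lborel). f (pt (fst p) (snd p)))"
    using assms by (subst lborel_real2, subst integral_distr) auto
  then have eq: "(LINT x|lborel. f x) = (LINT p|(lborel \<Otimes>\<^sub>M lborel). (\<lambda>(a, b). f (pt a b)) p)"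
    by (simp add: case_prod_beta)
  show "(LINT x|lborel. f x) = (LINT a|lborel. LINT b|lborel. f (pt a b))"
    unfolding eq using lborel_pair.integral_fst'[OF i] by simp
  show "(LINT x|lborel. f x) = (LINT b|lborel. LINT a|lborel. f (pt a b))"
    unfolding eq using lborel_pair.integral_snd[OF i] by simp
qed

lemma pt_derivative: 
  "((\<lambda>t. pt t b) has_derivative (\<lambda>h. h *\<^sub>R axis 1 1)) (at a)"
  "((\<lambda>t. pt a t) has_derivative (\<lambda>h. h *\<^sub>R axis 2 1)) (at b)"
proof -
  have *: "(\<lambda>t. pt t b) = (\<lambda>t. t *\<^sub>R axis 1 1 + pt 0 b)" "(\<lambda>t. pt a t) = (\<lambda>t. t *\<^sub>R axis 2 1 + pt a 0)"
    by (auto simp: vec_eq_iff forall_2 axis_def fun_eq_iff)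
  show "((\<lambda>t. pt t b) has_derivative (\<lambda>h. h *\<^sub>R axis 1 1)) (at a)"
    by (subst *(1)) (auto intro!: derivative_eq_intros)
  show "((\<lambda>t. pt a t) has_derivative (\<lambda>h. h *\<^sub>R axis 2 1)) (at b)"
    by (subst *(2)) (auto intro!: derivative_eq_intros)
qed

lemma DERIV_line:
  fixes f :: "real^2 \<Rightarrow> real"
  assumes "\<And>x. f differentiable (at x)"
  shows "((\<lambda>t. f (pt t b)) has_real_derivative partial 1 f (pt a b)) (at a)"
    and "((\<lambda>t. f (pt a t)) has_real_derivative partial 2 f (pt a b)) (at b)"
proof -
  have f: "(f has_derivative frechet_derivative f (at (pt a b))) (at (pt a b))"
    using assms frechet_derivative_works by blast
  have lin: "linear (frechet_derivative f (at (pt a b)))"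
    using f has_derivative_linear by blast
  have "frechet_derivative f (at (pt a b)) \<circ> (\<lambda>h. h *\<^sub>R axis 1 1) = (*) (partial 1 f (pt a b))"
    by (simp add: fun_eq_iff partial_def linear_scale[OF lin])
  with diff_chain_at[OF pt_derivative(1) f]
  show "((\<lambda>t. f (pt t b)) has_real_derivative partial 1 f (pt a b)) (at a)"
    by (simp add: has_field_derivative_def o_def)
  have "frechet_derivative f (at (pt a b)) \<circ> (\<lambda>h. h *\<^sub>R axis 2 1) = (*) (partial 2 f (pt a b))"
    by (simp add: fun_eq_iff partial_def linear_scale[OF lin])
  with diff_chain_at[OF pt_derivative(2) f]
  show "((\<lambda>t. f (pt a t)) has_real_derivative partial 2 f (pt a b)) (at b)"
    by (simp add: has_field_derivative_def o_def)
qed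

lemma partial_eqI: "(f has_derivative D) (at x) \<Longrightarrow> partial i f x = D (axis i 1)"
  unfolding partial_def using frechet_derivative_at by metis

lemma partial_zero_outside:
  fixes f :: "real^'n::finite \<Rightarrow> real"
  assumes "x \<notin> closure {x. f x \<noteq> 0}"
  shows "partial i f x = 0"
proof -
  have "(f has_derivative (\<lambda>_. 0)) (at x)"
    by (rule has_derivative_transform_within_open[where f="\<lambda>_. 0" and s="- closure {x. f x \<noteq> 0}"])
       (use assms closure_subset[of "{x. f x \<noteq> 0}"] in auto)
  from partial_eqI[OF this] show ?thesis by simp
qed

lemma has_derivative_product:
  assumes "(f has_real_derivative f') (at (x$1))" "(g has_real_derivative g') (at (x$2))"
  shows "((\<lambda>x::real^2. f (x$1) * g (x$2)) has_derivative 
    (\<lambda>h. f' * h$1 * g (x$2) + f (x$1) * (g' * h$2))) (at x)"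
proof -
  have 1: "((\<lambda>x::real^2. f (x$1)) has_derivative (\<lambda>h. f' * h$1)) (at x)"
    using has_derivative_compose[OF bounded_linear_imp_has_derivative[OF bounded_linear_vec_nth[of 1]] 
       assms(1)[unfolded has_field_derivative_def]] by simp
  have 2: "((\<lambda>x::real^2. g (x$2)) has_derivative (\<lambda>h. g' * h$2)) (at x)"
    using has_derivative_compose[OF bounded_linear_imp_has_derivative[OF bounded_linear_vec_nth[of 2]] 
       assms(2)[unfolded has_field_derivative_def]] by simp
  show ?thesis using has_derivative_mult[OF 1 2] by (simp add: add.commute)
qed

lemma product_partial:
  assumes "\<And>t. (f has_real_derivative f' t) (at t)" "\<And>t. (g has_real_derivative g' t) (at t)"
  shows "(\<lambda>x::real^2. f (x$1) * g (x$2)) differentiable (at x)"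
    and "partial 1 (\<lambda>x::real^2. f (x$1) * g (x$2)) = (\<lambda>x. f' (x$1) * g (x$2))"
    and "partial 2 (\<lambda>x::real^2. f (x$1) * g (x$2)) = (\<lambda>x. f (x$1) * g' (x$2))"
  using has_derivative_product[OF assms(1) assms(2)]
  by (auto simp: differentiable_def fun_eq_iff partial_eqI[OF has_derivative_product[OF assms(1) assms(2)]] axis_def)

lemma C_diff_product: "Ck k f \<Longrightarrow> Ck k g \<Longrightarrow> C_diff k (\<lambda>x::real^2. f (x$1) * g (x$2))"
proof (induction k arbitrary: f g)
  case 0
  then show ?case by (auto intro!: continuous_intros continuous_on_compose2[of UNIV f] continuous_on_compose2[of UNIV g])
next
  case (Suc k)
  obtain f' where f': "\<And>x. (f has_real_derivative f' x) (at x)" "Ck k f'"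
    using Suc.prems by auto
  obtain g' where g': "\<And>x. (g has_real_derivative g' x) (at x)" "Ck k g'"
    using Suc.prems by auto
  have "Ck k f" "Ck k g" using Suc.prems Ck_SucD by blast+
  then have "C_diff k (\<lambda>x::real^2. f' (x$1) * g (x$2))" "C_diff k (\<lambda>x::real^2. f (x$1) * g' (x$2))"
    using Suc.IH f' g' by blast+
  then show ?case using product_partial[of f f' g g', OF f'(1) g'(1)]
    by (auto simp: forall_2)
qed

lemma test_functions_product:
  assumes "smooth1 f" "smooth1 g" "\<And>t. \<bar>t\<bar> > R \<Longrightarrow> f t = 0" "\<And>t. \<bar>t\<bar> > R \<Longrightarrow> g t = 0"
  shows "(\<lambda>x::real^2. f (x$1) * g (x$2)) \<in> test_functions"
proof -
  let ?S = "{x::real^2. f (x$1) * g (x$2) \<noteq> 0}"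
  have "?S \<subseteq> cbox (pt (-R) (-R)) (pt R R)"
    using assms(3,4) by (auto simp: cbox_real2 abs_le_iff) (smt (verit))+
  then have "bounded ?S" using bounded_cbox bounded_subset by blast
  then have "compact (closure ?S)" unfolding compact_closure .
  then show ?thesis
    using assms(1,2) C_diff_product unfolding test_functions_def compactly_supported_in_def smooth1_def
    by auto
qed

lemma test_functionsD:
  fixes \<phi> :: "real^2 \<Rightarrow> real"
  assumes "\<phi> \<in> test_functions"
  shows "\<phi> differentiable (at x)" "continuous_on A \<phi>" "partial i \<phi> \<in> test_functions"
proof -
  have C: "C_diff k \<phi>" for k using assms by (auto simp: test_functions_def)
  show d: "\<phi> differentiable (at x)" for x using C[of 1] by simp
  show "continuous_on A \<phi>" using C[of 0] continuous_on_subset by auto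
  have "{x. partial i \<phi> x \<noteq> 0} \<subseteq> closure {x. \<phi> x \<noteq> 0}"
    using partial_zero_outside by blast
  moreover have "bounded (closure {x. \<phi> x \<noteq> 0})"
    using assms by (auto simp: test_functions_def compactly_supported_in_def compact_imp_bounded)
  ultimately have "compact (closure {x. partial i \<phi> x \<noteq> 0})"
    unfolding compact_closure by (rule bounded_subset[rotated])
  then show "partial i \<phi> \<in> test_functions"
    using C[of "Suc _"] by (auto simp: test_functions_def compactly_supported_in_def)
qed

lemma test_functions_support:
  fixes \<phi> :: "real^2 \<Rightarrow> real"
  assumes "\<phi> \<in> test_functions"
  obtains R where "R > 0" "\<And>x. \<phi> x \<noteq> 0 \<Longrightarrow> norm x < R"
proof -
  have "bounded (closure {x. \<phi> x \<noteq> 0})"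
    using assms by (auto simp: test_functions_def compactly_supported_in_def compact_imp_bounded)
  then obtain R where R: "R > 0" "\<forall>x \<in> closure {x. \<phi> x \<noteq> 0}. norm x < R"
    unfolding bounded_pos_less by blast
  show ?thesis
  proof (rule that[OF R(1)])
    fix x assume "\<phi> x \<noteq> 0"
    then have "x \<in> closure {x. \<phi> x \<noteq> 0}"
      using closure_subset[of "{x. \<phi> x \<noteq> 0}"] by auto
    then show "norm x < R" using R(2) by blast
  qed
qed

section \<open>Locally bounded functions and weak derivatives\<close>

lemma norm_pt_ge: "\<bar>a\<bar> \<le> norm (pt a b)" "\<bar>b\<bar> \<le> norm (pt a b)"
  using component_le_norm_cart[of "pt a b" 1] component_le_norm_cart[of "pt a b" 2] by auto

text \<open>This class holds continuous functions and discontinuous Heaviside factors alike, is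
  closed under sums and products, and becomes integrable after multiplication by a test
  function.\<close>

definition loc_bdd :: "(real^2 \<Rightarrow> real) \<Rightarrow> bool" where
  "loc_bdd g \<longleftrightarrow> g \<in> borel_measurable borel \<and> (\<forall>R. \<exists>B. \<forall>x\<in>cball 0 R. \<bar>g x\<bar> \<le> B)"

lemma loc_bdd_measurable: "loc_bdd g \<Longrightarrow> g \<in> borel_measurable borel"
  by (simp add: loc_bdd_def)

lemma loc_bdd_add: assumes "loc_bdd f" "loc_bdd g" shows "loc_bdd (\<lambda>x. f x + g x)"
  unfolding loc_bdd_def
proof safe
  show "(\<lambda>x. f x + g x) \<in> borel_measurable borel" using assms by (auto simp: loc_bdd_def)
  fix R
  obtain A B where "\<And>x. x \<in> cball 0 R \<Longrightarrow> \<bar>f x\<bar> \<le> A" "\<And>x. x \<in> cball 0 R \<Longrightarrow> \<bar>g x\<bar> \<le> B"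
    using assms unfolding loc_bdd_def by metis
  then have "\<forall>x\<in>cball 0 R. \<bar>f x + g x\<bar> \<le> A + B"
    by (smt (verit))
  then show "\<exists>B. \<forall>x\<in>cball 0 R. \<bar>f x + g x\<bar> \<le> B" by blast
qed

lemma loc_bdd_mult: assumes "loc_bdd f" "loc_bdd g" shows "loc_bdd (\<lambda>x. f x * g x)"
  unfolding loc_bdd_def
proof safe
  show "(\<lambda>x. f x * g x) \<in> borel_measurable borel" using assms by (auto simp: loc_bdd_def)
  fix R
  obtain A B where *: "\<And>x. x \<in> cball 0 R \<Longrightarrow> \<bar>f x\<bar> \<le> A" "\<And>x. x \<in> cball 0 R \<Longrightarrow> \<bar>g x\<bar> \<le> B"
    using assms unfolding loc_bdd_def by metis
  have "\<bar>f x * g x\<bar> \<le> \<bar>A\<bar> * \<bar>B\<bar>" if "x \<in> cball 0 R" for x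
    unfolding abs_mult using *[OF that] by (intro mult_mono) auto
  then show "\<exists>B. \<forall>x\<in>cball 0 R. \<bar>f x * g x\<bar> \<le> B" by blast
qed

lemma loc_bdd_continuous: assumes "continuous_on UNIV f" shows "loc_bdd f"
  unfolding loc_bdd_def
proof safe
  show "f \<in> borel_measurable borel" using assms by (rule borel_measurable_continuous_onI)
  fix R :: real
  have "bounded (f ` cball 0 R)"
    using assms by (intro compact_imp_bounded compact_continuous_image) (auto intro: continuous_on_subset)
  then show "\<exists>B. \<forall>x\<in>cball 0 R. \<bar>f x\<bar> \<le> B" by (auto simp: bounded_iff)
qed

lemma loc_bdd_bounded: "f \<in> borel_measurable borel \<Longrightarrow> (\<And>x. \<bar>f x\<bar> \<le> B) \<Longrightarrow> loc_bdd f"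
  by (auto simp: loc_bdd_def)

lemma loc_bdd_const: "loc_bdd (\<lambda>x. c)" by (intro loc_bdd_continuous continuous_intros)

lemma loc_bdd_scale: "loc_bdd f \<Longrightarrow> loc_bdd (\<lambda>x. c * f x)"
  by (rule loc_bdd_mult[OF loc_bdd_const])

lemma loc_bdd_integrable:
  assumes "loc_bdd g" "\<And>x. g x \<noteq> 0 \<Longrightarrow> norm x < R"
  shows "integrable lborel g"
proof -
  obtain B where B: "\<And>x. x \<in> cball 0 R \<Longrightarrow> \<bar>g x\<bar> \<le> B" using assms(1) unfolding loc_bdd_def by metis
  show ?thesis
  proof (rule integrableI_bounded_set[of "cball 0 R" _ _ "B"])
    show "cball 0 R \<in> sets lborel" "g \<in> borel_measurable lborel" using assms by (auto simp: loc_bdd_def)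
    show "emeasure lborel (cball 0 R :: (real^2) set) < \<infinity>" using emeasure_bounded_finite[of "cball 0 R :: (real^2) set"] by auto
    show "AE x in lborel. x \<in> cball 0 R \<longrightarrow> norm (g x) \<le> B" using B by auto
    show "AE x in lborel. x \<notin> cball 0 R \<longrightarrow> g x = 0" using assms(2) by (force)
  qed
qed

lemma test_loc_bdd: "\<phi> \<in> test_functions \<Longrightarrow> loc_bdd \<phi>"
  by (intro loc_bdd_continuous test_functionsD)

lemma loc_bdd_test_integrable: 
  assumes "loc_bdd g" "\<phi> \<in> test_functions"
  shows "integrable lborel (\<lambda>x. g x * \<phi> x)" "integrable lebesgue (\<lambda>x. g x * \<phi> x)"
proof -
  obtain R where "R > 0" "\<And>x. \<phi> x \<noteq> 0 \<Longrightarrow> norm x < R" using test_functions_support[OF assms(2)] by blast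
  then show 1: "integrable lborel (\<lambda>x. g x * \<phi> x)"
    by (intro loc_bdd_integrable[where R=R] loc_bdd_mult assms test_loc_bdd) auto
  then show "integrable lebesgue (\<lambda>x. g x * \<phi> x)" 
    by (subst integrable_completion) auto
qed

lemma loc_bdd_absint:
  assumes "loc_bdd g" "compact K"
  shows "g absolutely_integrable_on K"
proof -
  obtain R where R: "R > 0" "\<forall>x \<in> K. norm x < R"
    using compact_imp_bounded[OF assms(2)] unfolding bounded_pos_less by blast
  have "K \<in> sets borel" using assms(2) borel_compact by blast
  then have "loc_bdd (\<lambda>x. indicator K x * g x)"
    by (intro loc_bdd_mult loc_bdd_bounded[of _ 1] assms) (auto simp: indicator_def)
  then have "integrable lborel (\<lambda>x. indicator K x * g x)"
    by (rule loc_bdd_integrable[where R=R]) (use R in \<open>auto simp: indicator_def split: if_splits\<close>)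
  then have "integrable lebesgue (\<lambda>x. indicator K x * g x)"
    by (subst integrable_completion) auto
  then show ?thesis unfolding set_integrable_def by simp
qed

text \<open>Kinks of \<open>u\<close> are allowed: continuity together with a derivative off a
  finite set is enough for the fundamental theorem.\<close>

lemma integral_line_deriv_0:
  fixes u u' :: "real \<Rightarrow> real"
  assumes "finite S" "\<And>t. t \<notin> S \<Longrightarrow> (u has_real_derivative u' t) (at t)" "continuous_on UNIV u"
    "\<And>t. \<bar>t\<bar> \<ge> R \<Longrightarrow> u t = 0" "\<And>t. \<bar>t\<bar> \<ge> R \<Longrightarrow> u' t = 0" "R > 0"
  shows "(LINT t|lborel. u' t) = 0"
proof (cases "integrable lborel u'")
  case True
  have "(u' has_integral (u R - u (-R))) {-R..R}"
    by (rule fundamental_theorem_of_calculus_interior_strong[OF \<open>finite S\<close>])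
       (use assms in \<open>auto intro: continuous_on_subset simp: has_real_derivative_iff_has_vector_derivative[symmetric]\<close>)
  then have "(u' has_integral 0) {-R..R}" using assms(4,6) by simp
  then have "(u' has_integral 0) UNIV"
    by (rule has_integral_on_superset) (use assms(5) in \<open>auto simp: abs_le_iff\<close>)
  with has_integral_integral_lborel[OF True] show ?thesis using has_integral_unique by blast
\<comment> \<open>A non-integrable \<open>u'\<close> has integral 0 by convention.\<close>
qed (rule not_integrable_integral_eq)

text \<open>Local boundedness of both functions fits the C^{1,1} potentials of the construction and
  guarantees that every integral against a test function exists.\<close>

definition weak_deriv :: "2 \<Rightarrow> (real^2 \<Rightarrow> real) \<Rightarrow> (real^2 \<Rightarrow> real) \<Rightarrow> bool" where
  "weak_deriv i g g' \<longleftrightarrow> loc_bdd g \<and> loc_bdd g' \<and>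
     (\<forall>\<phi>\<in>test_functions. (LINT x|lborel. g' x * \<phi> x) = - (LINT x|lborel. g x * partial i \<phi> x))"

lemma weak_deriv_add:
  assumes "weak_deriv i f f'" "weak_deriv i g g'"
  shows "weak_deriv i (\<lambda>x. f x + g x) (\<lambda>x. f' x + g' x)"
proof -
  have l: "loc_bdd f" "loc_bdd f'" "loc_bdd g" "loc_bdd g'" using assms by (auto simp: weak_deriv_def)
  have "(LINT x|lborel. (f' x + g' x) * \<phi> x) = - (LINT x|lborel. (f x + g x) * partial i \<phi> x)"
    if "\<phi> \<in> test_functions" for \<phi>
    using that assms loc_bdd_test_integrable(1)[OF l(1) test_functionsD(3)] loc_bdd_test_integrable(1)[OF l(2)]
      loc_bdd_test_integrable(1)[OF l(3) test_functionsD(3)] loc_bdd_test_integrable(1)[OF l(4)]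
    by (simp add: weak_deriv_def distrib_right)
  then show ?thesis using l by (auto simp: weak_deriv_def intro: loc_bdd_add)
qed

lemma weak_deriv_scale:
  assumes "weak_deriv i f f'"
  shows "weak_deriv i (\<lambda>x. c * f x) (\<lambda>x. c * f' x)"
  using assms by (auto simp: weak_deriv_def mult.assoc intro: loc_bdd_scale)

lemma weak_deriv_0: "weak_deriv i (\<lambda>x. 0) (\<lambda>x. 0)"
  by (auto simp: weak_deriv_def intro: loc_bdd_const)

text \<open>Fubini reduces the weak derivative to integration by parts on each line, so the
  exceptional set may vary with the line and has to be finite only there.\<close>

lemma weak_deriv_line_1:
  assumes l: "loc_bdd g" "loc_bdd g'"
    and fin: "\<And>b. finite (S b)" and d: "\<And>b t. t \<notin> S b \<Longrightarrow> ((\<lambda>t. g (pt t b)) has_real_derivative g' (pt t b)) (at t)"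
    and c: "\<And>b. continuous_on UNIV (\<lambda>t. g (pt t b))"
  shows "weak_deriv 1 g g'"
  unfolding weak_deriv_def
proof (intro conjI l ballI)
  fix \<phi> :: "real^2 \<Rightarrow> real" assume \<phi>: "\<phi> \<in> test_functions"
  obtain R where R: "R > 0" "\<And>x. \<phi> x \<noteq> 0 \<Longrightarrow> norm x < R" using test_functions_support[OF \<phi>] by blast
  obtain R' where R': "R' > 0" "\<And>x. partial 1 \<phi> x \<noteq> 0 \<Longrightarrow> norm x < R'" 
    using test_functions_support[OF test_functionsD(3)[OF \<phi>]] by blast
  note i1 = loc_bdd_test_integrable(1)[OF l(2) \<phi>] 
  note i2 = loc_bdd_test_integrable(1)[OF l(1) test_functionsD(3)[OF \<phi>, of 1]]
  have z: "\<phi> (pt t b) = 0" "partial 1 \<phi> (pt t b) = 0" if "\<bar>t\<bar> \<ge> max R R'" for t b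
    using R(2)[of "pt t b"] R'(2)[of "pt t b"] norm_pt_ge[of t b] that by auto
  have "(LINT x|lborel. g' x * \<phi> x + g x * partial 1 \<phi> x) = 
     (LINT b|lborel. LINT a|lborel. g' (pt a b) * \<phi> (pt a b) + g (pt a b) * partial 1 \<phi> (pt a b))"
    using i1 i2 by (intro integral_real2) auto
  also have "\<dots> = (LINT b|(lborel::real measure). 0)"
  proof (rule Bochner_Integration.integral_cong[OF refl])
    fix b :: real
    show "(LINT a|lborel. g' (pt a b) * \<phi> (pt a b) + g (pt a b) * partial 1 \<phi> (pt a b)) = 0"
    proof (rule integral_line_deriv_0[OF fin[of b], where u = "\<lambda>t. g (pt t b) * \<phi> (pt t b)" and R="max R R'"])
      fix t assume "t \<notin> S b"
      from DERIV_mult[OF d[OF this] DERIV_line(1)[OF test_functionsD(1)[OF \<phi>]]]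
      show "((\<lambda>t. g (pt t b) * \<phi> (pt t b)) has_real_derivative
         g' (pt t b) * \<phi> (pt t b) + g (pt t b) * partial 1 \<phi> (pt t b)) (at t)"
        by (simp add: algebra_simps)
    next
      show "continuous_on UNIV (\<lambda>t. g (pt t b) * \<phi> (pt t b))"
        by (intro continuous_intros c continuous_on_compose2[OF test_functionsD(2)[OF \<phi>, of UNIV]]) auto
    qed (use z R R' in auto)
  qed
  finally show "(LINT x|lborel. g' x * \<phi> x) = - (LINT x|lborel. g x * partial 1 \<phi> x)"
    using i1 i2 by simp
qed

lemma weak_deriv_line_2:
  assumes l: "loc_bdd g" "loc_bdd g'"
    and fin: "\<And>a. finite (S a)" and d: "\<And>a t. t \<notin> S a \<Longrightarrow> ((\<lambda>t. g (pt a t)) has_real_derivative g' (pt a t)) (at t)"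
    and c: "\<And>a. continuous_on UNIV (\<lambda>t. g (pt a t))"
  shows "weak_deriv 2 g g'"
  unfolding weak_deriv_def
proof (intro conjI l ballI)
  fix \<phi> :: "real^2 \<Rightarrow> real" assume \<phi>: "\<phi> \<in> test_functions"
  obtain R where R: "R > 0" "\<And>x. \<phi> x \<noteq> 0 \<Longrightarrow> norm x < R" using test_functions_support[OF \<phi>] by blast
  obtain R' where R': "R' > 0" "\<And>x. partial 2 \<phi> x \<noteq> 0 \<Longrightarrow> norm x < R'" 
    using test_functions_support[OF test_functionsD(3)[OF \<phi>]] by blast
  note i1 = loc_bdd_test_integrable(1)[OF l(2) \<phi>] 
  note i2 = loc_bdd_test_integrable(1)[OF l(1) test_functionsD(3)[OF \<phi>, of 2]]
  have z: "\<phi> (pt b t) = 0" "partial 2 \<phi> (pt b t) = 0" if "\<bar>t\<bar> \<ge> max R R'" for t b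
    using R(2)[of "pt b t"] R'(2)[of "pt b t"] norm_pt_ge[where a=b and b=t] that by auto
  have "(LINT x|lborel. g' x * \<phi> x + g x * partial 2 \<phi> x) = 
     (LINT b|lborel. LINT a|lborel. g' (pt b a) * \<phi> (pt b a) + g (pt b a) * partial 2 \<phi> (pt b a))"
    using i1 i2 by (intro integral_real2) auto
  also have "\<dots> = (LINT b|(lborel::real measure). 0)"
  proof (rule Bochner_Integration.integral_cong[OF refl])
    fix b :: real
    show "(LINT a|lborel. g' (pt b a) * \<phi> (pt b a) + g (pt b a) * partial 2 \<phi> (pt b a)) = 0"
    proof (rule integral_line_deriv_0[OF fin[of b], where u = "\<lambda>t. g (pt b t) * \<phi> (pt b t)" and R="max R R'"])
      fix t assume "t \<notin> S b"
      from DERIV_mult[OF d[OF this] DERIV_line(2)[OF test_functionsD(1)[OF \<phi>]]]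
      show "((\<lambda>t. g (pt b t) * \<phi> (pt b t)) has_real_derivative
         g' (pt b t) * \<phi> (pt b t) + g (pt b t) * partial 2 \<phi> (pt b t)) (at t)"
        by (simp add: algebra_simps)
    next
      show "continuous_on UNIV (\<lambda>t. g (pt b t) * \<phi> (pt b t))"
        by (intro continuous_intros c continuous_on_compose2[OF test_functionsD(2)[OF \<phi>, of UNIV]]) auto
    qed (use z R R' in auto)
  qed
  finally show "(LINT x|lborel. g' x * \<phi> x) = - (LINT x|lborel. g x * partial 2 \<phi> x)"
    using i1 i2 by simp
qed

text \<open>Schwarz's theorem: the second difference over a square of side \<open>h\<close> is
  \<open>h * h\<close> times either mixed derivative at some interior point, by applying the mean
  value theorem in both orders.\<close>

lemma mixed_derivs_eq:
  fixes F F1 F2 F12 F21 :: "real \<Rightarrow> real \<Rightarrow> real"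
  assumes F1: "\<And>a b. ((\<lambda>t. F t b) has_real_derivative F1 a b) (at a)"
    and F2: "\<And>a b. ((\<lambda>t. F a t) has_real_derivative F2 a b) (at b)"
    and F12: "\<And>a b. ((\<lambda>t. F1 a t) has_real_derivative F12 a b) (at b)"
    and F21: "\<And>a b. ((\<lambda>t. F2 t b) has_real_derivative F21 a b) (at a)"
    and c: "isCont (\<lambda>p. F12 (fst p) (snd p)) (a, b)" "isCont (\<lambda>p. F21 (fst p) (snd p)) (a, b)"
  shows "F12 a b = F21 a b"
proof (rule ccontr)
  assume "F12 a b \<noteq> F21 a b"
  define e where "e = \<bar>F12 a b - F21 a b\<bar> / 2"
  have e: "e > 0" using \<open>F12 a b \<noteq> F21 a b\<close> by (simp add: e_def)
  obtain d1 where d1: "d1 > 0" "\<And>p. dist p (a,b) < d1 \<Longrightarrow> \<bar>F12 (fst p) (snd p) - F12 a b\<bar> < e"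
    using c(1) e unfolding continuous_at_eps_delta dist_real_def by force
  obtain d2 where d2: "d2 > 0" "\<And>p. dist p (a,b) < d2 \<Longrightarrow> \<bar>F21 (fst p) (snd p) - F21 a b\<bar> < e"
    using c(2) e unfolding continuous_at_eps_delta dist_real_def by force
  define h where "h = min d1 d2 / 4"
  have h: "h > 0" using d1 d2 by (simp add: h_def)
  have near: "dist (s, t) (a, b) < d1" "dist (s, t) (a, b) < d2" 
    if "a < s" "s < a + h" "b < t" "t < b + h" for s t
  proof -
    have "dist (s, t) (a, b) \<le> \<bar>s - a\<bar> + \<bar>t - b\<bar>"
      unfolding dist_prod_def by (simp add: dist_real_def sqrt_sum_squares_le_sum_abs)
    also have "\<dots> < 2 * h" using that by auto
    finally show "dist (s, t) (a, b) < d1" "dist (s, t) (a, b) < d2" using d1 d2 by (auto simp: h_def)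
  qed
  obtain s where s: "a < s" "s < a + h" 
    "(F (a+h) (b+h) - F (a+h) b) - (F a (b+h) - F a b) = (a + h - a) * (F1 s (b+h) - F1 s b)"
    using MVT2[of a "a+h" "\<lambda>t. F t (b+h) - F t b" "\<lambda>t. F1 t (b+h) - F1 t b", OF _ DERIV_diff[OF F1 F1]] h
    by auto
  obtain t where t: "b < t" "t < b + h" "F1 s (b+h) - F1 s b = (b + h - b) * F12 s t"
    using MVT2[of b "b+h" "\<lambda>t. F1 s t" "\<lambda>t. F12 s t"] h F12 by auto
  obtain t' where t': "b < t'" "t' < b + h" 
    "(F (a+h) (b+h) - F a (b+h)) - (F (a+h) b - F a b) = (b + h - b) * (F2 (a+h) t' - F2 a t')"
    using MVT2[of b "b+h" "\<lambda>t. F (a+h) t - F a t" "\<lambda>t. F2 (a+h) t - F2 a t", OF _ DERIV_diff[OF F2 F2]] h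
    by auto
  obtain s' where s': "a < s'" "s' < a + h" "F2 (a+h) t' - F2 a t' = (a + h - a) * F21 s' t'"
    using MVT2[of a "a+h" "\<lambda>s. F2 s t'" "\<lambda>s. F21 s t'"] h F21 by auto
  have "(F (a+h) (b+h) - F (a+h) b) - (F a (b+h) - F a b) = h * (h * F12 s t)"
    using s(3) t(3) by simp
  moreover have "(F (a+h) (b+h) - F a (b+h)) - (F (a+h) b - F a b) = h * (h * F21 s' t')"
    using t'(3) s'(3) by simp
  ultimately have "h * (h * F12 s t) = h * (h * F21 s' t')" by linarith
  then have "F12 s t = F21 s' t'" using h by simp
  moreover have "\<bar>F12 s t - F12 a b\<bar> < e" using d1(2)[OF near(1)[OF s(1,2) t(1,2)]] by simp
  moreover have "\<bar>F21 s' t' - F21 a b\<bar> < e" using d2(2)[OF near(2)[OF s'(1,2) t'(1,2)]] by simp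
  ultimately show False unfolding e_def by (smt (verit) field_sum_of_halves)
qed

lemma test_partial_commute:
  fixes \<phi> :: "real^2 \<Rightarrow> real"
  assumes "\<phi> \<in> test_functions"
  shows "partial 1 (partial 2 \<phi>) = partial 2 (partial 1 \<phi>)"
proof
  fix x :: "real^2"
  have cont: "isCont (\<lambda>p. f (pt (fst p) (snd p))) q" if "f \<in> test_functions" for f q
  proof -
    have "continuous_on UNIV (\<lambda>p. f (pt (fst p) (snd p)))"
      by (intro continuous_on_compose2[OF test_functionsD(2)[OF that, of UNIV]] continuous_intros) auto
    then show ?thesis unfolding continuous_on_eq_continuous_at[OF open_UNIV] by blast
  qed
  note t = test_functionsD(3)
  have "partial 2 (partial 1 \<phi>) (pt (x$1) (x$2)) = partial 1 (partial 2 \<phi>) (pt (x$1) (x$2))"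
    by (rule mixed_derivs_eq[where F = "\<lambda>a b. \<phi> (pt a b)" and ?F1.0 = "\<lambda>a b. partial 1 \<phi> (pt a b)" and ?F2.0 = "\<lambda>a b. partial 2 \<phi> (pt a b)"
          and ?F12.0 = "\<lambda>a b. partial 2 (partial 1 \<phi>) (pt a b)" and ?F21.0 = "\<lambda>a b. partial 1 (partial 2 \<phi>) (pt a b)"])
      (use assms in \<open>auto intro!: DERIV_line cont t test_functionsD(1)\<close>)
  then show "partial 1 (partial 2 \<phi>) x = partial 2 (partial 1 \<phi>) x" by simp
qed

section \<open>Symmetric strains and their potentials\<close>

definition mat2 :: "real \<Rightarrow> real \<Rightarrow> real \<Rightarrow> real^2^2" where
  "mat2 p q r = vector [vector [p, q], vector [q, r]]"

lemma mat2_nth [simp]: "mat2 p q r $ 1 $ 1 = p" "mat2 p q r $ 1 $ 2 = q" "mat2 p q r $ 2 $ 1 = q" "mat2 p q r $ 2 $ 2 = r"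
  by (auto simp: mat2_def)

lemma transpose_mat2: "transpose (mat2 p q r) = mat2 p q r"
  by (simp add: vec_eq_iff forall_2 transpose_def)

lemma mat2_measurable [measurable]:
  assumes [measurable]: "p \<in> borel_measurable M" "q \<in> borel_measurable M" "r \<in> borel_measurable M"
  shows "(\<lambda>x. mat2 (p x) (q x) (r x)) \<in> borel_measurable M"
proof -
  have "(\<lambda>x. mat2 (p x) (q x) (r x)) = 
    (\<lambda>x. p x *\<^sub>R mat2 1 0 0 + q x *\<^sub>R mat2 0 1 0 + r x *\<^sub>R mat2 0 0 1)"
    by (simp add: fun_eq_iff vec_eq_iff forall_2)
  then show ?thesis by simp
qed

lemma norm_mat22: "(norm (A::real^2^2))\<^sup>2 = (A$1$1)\<^sup>2 + (A$1$2)\<^sup>2 + (A$2$1)\<^sup>2 + (A$2$2)\<^sup>2"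
  by (simp add: norm_vec_def L2_set_def sum_2)

lemma loc_bdd_coord: "loc_bdd (\<lambda>x. x $ i)"
  by (intro loc_bdd_continuous continuous_intros)

lemma weak_deriv_coord: "weak_deriv 1 (\<lambda>x. x $ 1) (\<lambda>x. 1)" "weak_deriv 2 (\<lambda>x. x $ 2) (\<lambda>x. 1)"
   "weak_deriv 2 (\<lambda>x. x $ 1) (\<lambda>x. 0)" "weak_deriv 1 (\<lambda>x. x $ 2) (\<lambda>x. 0)"
   by (rule weak_deriv_line_1[where S="\<lambda>_. {}"] weak_deriv_line_2[where S="\<lambda>_. {}"];
       auto intro!: loc_bdd_coord loc_bdd_const continuous_intros derivative_eq_intros)+

lemma weak_deriv_const: "weak_deriv i (\<lambda>x. c) (\<lambda>x. 0)"
proof -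
  have "weak_deriv 1 (\<lambda>x. c) (\<lambda>x. 0)" "weak_deriv 2 (\<lambda>x. c) (\<lambda>x. 0)"
   by (rule weak_deriv_line_1[where S="\<lambda>_. {}"] weak_deriv_line_2[where S="\<lambda>_. {}"];
       auto intro!: loc_bdd_const continuous_intros derivative_eq_intros)+
  then show ?thesis using exhaust_2[of i] by auto
qed

lemma integral_partial_test: 
  fixes \<phi> :: "real^2 \<Rightarrow> real"
  shows "\<phi> \<in> test_functions \<Longrightarrow> (LINT x|lborel. partial i \<phi> x) = 0"
  using weak_deriv_const[of i 1] by (auto simp: weak_deriv_def)

lemma integral_lebesgue_lborel:
  fixes f :: "real^2 \<Rightarrow> real"
  assumes "f \<in> borel_measurable borel"
  shows "(LINT x|lebesgue. f x) = (LINT x|lborel. f x)"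
  using assms by (intro integral_completion) auto

lemma L1_loc_vec2:
  assumes "\<And>i. loc_bdd (\<lambda>x. v x $ i)"
  shows "v \<in> (L1_loc :: (real^2 \<Rightarrow> real^2) set)"
  unfolding L1_loc_def
proof safe
  fix K :: "(real^2) set" assume "compact K"
  then have "(\<lambda>x. v x $ i) absolutely_integrable_on K" for i
    using loc_bdd_absint[OF assms] by blast
  then have "(\<lambda>x. v x \<bullet> b) absolutely_integrable_on K" if "b \<in> Basis" for b
    using that by (auto simp: Basis_real2 inner_axis)
  then show "v absolutely_integrable_on K" by (rule absolutely_integrable_componentwise)
qed

lemma L1_loc_mat22:
  assumes "\<And>i j. loc_bdd (\<lambda>x. w x $ i $ j)"
  shows "w \<in> (L1_loc :: (real^2 \<Rightarrow> real^2^2) set)"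
  unfolding L1_loc_def
proof safe
  fix K :: "(real^2) set" assume "compact K"
  then have "(\<lambda>x. w x $ i $ j) absolutely_integrable_on K" for i j
    using loc_bdd_absint[OF assms] by blast
  then have "(\<lambda>x. w x \<bullet> b) absolutely_integrable_on K" if "b \<in> Basis" for b
    using that by (auto simp: Basis_vec_def inner_axis)
  then show "w absolutely_integrable_on K" by (rule absolutely_integrable_componentwise)
qed

lemma L2_loc_mat2:
  assumes "loc_bdd p" "loc_bdd q" "loc_bdd r"
  shows "(\<lambda>x. mat2 (p x) (q x) (r x)) \<in> L2_loc"
  unfolding L2_loc_def
proof safe
  have [measurable]: "p \<in> borel_measurable borel" "q \<in> borel_measurable borel" "r \<in> borel_measurable borel"
    using assms by (auto simp: loc_bdd_def)
  show "(\<lambda>x. mat2 (p x) (q x) (r x)) \<in> borel_measurable lebesgue"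
    by (intro measurable_completion) simp
  fix K :: "(real^2) set" assume K: "compact K"
  show "(\<lambda>x. (norm (mat2 (p x) (q x) (r x)))\<^sup>2) absolutely_integrable_on K"
    unfolding norm_mat22 mat2_nth unfolding power2_eq_square
    by (intro loc_bdd_absint K loc_bdd_add loc_bdd_mult assms)
qed

text \<open>Second derivatives of a potential \<open>\<psi>\<close> produce a strain without shear: for the displacement
  \<open>(x\<^sub>1 - \<partial>\<^sub>1\<psi>, x\<^sub>2 + \<partial>\<^sub>2\<psi>)\<close> the two contributions to the off-diagonal entry cancel.\<close>

lemma potential_competitor:
  assumes 1: "weak_deriv 1 \<psi> \<psi>1" "weak_deriv 1 \<psi>1 \<psi>11"
    and 2: "weak_deriv 2 \<psi> \<psi>2" "weak_deriv 2 \<psi>2 \<psi>22"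
  defines "v \<equiv> \<lambda>x. pt (x $ 1 - \<psi>1 x) (x $ 2 + \<psi>2 x)"
  defines "w \<equiv> \<lambda>x. mat2 (1 - \<psi>11 x) 0 (1 + \<psi>22 x)"
  shows "has_sym_grad v w" "w \<in> L2_loc" "curl_curl_free w"
proof -
  have l: "loc_bdd \<psi>" "loc_bdd \<psi>1" "loc_bdd \<psi>2" "loc_bdd \<psi>11" "loc_bdd \<psi>22"
    using 1 2 by (auto simp: weak_deriv_def)
  note meas [measurable] = l[THEN loc_bdd_measurable]
  define v1 where "v1 = (\<lambda>x::real^2. x $ 1 + (-1) * \<psi>1 x)"
  define v2 where "v2 = (\<lambda>x::real^2. x $ 2 + \<psi>2 x)"
  define w1 where "w1 = (\<lambda>x. 1 + (-1) * \<psi>11 x)"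
  define w2 where "w2 = (\<lambda>x. 1 + \<psi>22 x)"
  have v_nth: "v x $ 1 = v1 x" "v x $ 2 = v2 x" for x by (auto simp: v_def v1_def v2_def)
  have w_eq: "w x = mat2 (w1 x) 0 (w2 x)" for x by (auto simp: w_def w1_def w2_def)
  have d1: "weak_deriv 1 v1 w1"
    unfolding v1_def w1_def by (intro weak_deriv_add weak_deriv_scale weak_deriv_coord 1)
  have d2: "weak_deriv 2 v2 w2"
    unfolding v2_def w2_def by (intro weak_deriv_add weak_deriv_coord 2)
  have lv: "loc_bdd v1" "loc_bdd v2" "loc_bdd w1" "loc_bdd w2"
    using d1 d2 by (auto simp: weak_deriv_def)
  note [measurable] = lv[THEN loc_bdd_measurable]
  have mt: "\<phi> \<in> borel_measurable borel" if "\<phi> \<in> test_functions" for \<phi> :: "real^2 \<Rightarrow> real"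
    using test_loc_bdd[OF that] by (rule loc_bdd_measurable)
  have sym: "(LINT x|lborel. v1 x * partial 2 \<phi> x + v2 x * partial 1 \<phi> x) = 0" if \<phi>: "\<phi> \<in> test_functions" for \<phi>
  proof -
    note p = test_functionsD(3)[OF \<phi>]
    have "(LINT x|lborel. v1 x * partial 2 \<phi> x + v2 x * partial 1 \<phi> x) = 
      (LINT x|lborel. v1 x * partial 2 \<phi> x) + (LINT x|lborel. v2 x * partial 1 \<phi> x)"
      by (intro Bochner_Integration.integral_add loc_bdd_test_integrable lv p)
    also have "(LINT x|lborel. v1 x * partial 2 \<phi> x) = 
      (LINT x|lborel. x $ 1 * partial 2 \<phi> x) - (LINT x|lborel. \<psi>1 x * partial 2 \<phi> x)"
      unfolding v1_def using loc_bdd_test_integrable(1)[OF loc_bdd_coord p] loc_bdd_test_integrable(1)[OF l(2) p]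
      by (subst Bochner_Integration.integral_diff[symmetric]) (auto simp: left_diff_distrib)
    also have "(LINT x|lborel. v2 x * partial 1 \<phi> x) = 
      (LINT x|lborel. x $ 2 * partial 1 \<phi> x) + (LINT x|lborel. \<psi>2 x * partial 1 \<phi> x)"
      unfolding v2_def using loc_bdd_test_integrable(1)[OF loc_bdd_coord p] loc_bdd_test_integrable(1)[OF l(3) p]
      by (subst Bochner_Integration.integral_add[symmetric]) (auto simp: distrib_right)
    also have "(LINT x|lborel. \<psi>1 x * partial 2 \<phi> x) = - (LINT x|lborel. \<psi> x * partial 1 (partial 2 \<phi>) x)"
      using 1(1) p by (auto simp: weak_deriv_def)
    also have "(LINT x|lborel. \<psi>2 x * partial 1 \<phi> x) = - (LINT x|lborel. \<psi> x * partial 2 (partial 1 \<phi>) x)"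
      using 2(1) p by (auto simp: weak_deriv_def)
    also have "(LINT x|lborel. x $ 1 * partial 2 \<phi> x) = 0"
      using weak_deriv_coord(3) \<phi> unfolding weak_deriv_def by auto
    also have "(LINT x|lborel. x $ 2 * partial 1 \<phi> x) = 0"
      using weak_deriv_coord(4) \<phi> unfolding weak_deriv_def by auto
    finally show ?thesis by (simp add: test_partial_commute[OF \<phi>])
  qed
  have lw: "loc_bdd (\<lambda>x. w x $ i $ j)" for i j
    using lv exhaust_2[of i] exhaust_2[of j] by (auto simp: w_eq loc_bdd_const)
  have lvv: "loc_bdd (\<lambda>x. v x $ i)" for i
    using lv exhaust_2[of i] by (auto simp: v_nth)
  have ibp1: "(LINT x|lborel. w1 x * \<phi> x) = - (LINT x|lborel. v1 x * partial 1 \<phi> x)" 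
    and ibp2: "(LINT x|lborel. w2 x * \<phi> x) = - (LINT x|lborel. v2 x * partial 2 \<phi> x)" if "\<phi> \<in> test_functions" for \<phi>
    using d1 d2 that unfolding weak_deriv_def by auto
  show "has_sym_grad v w"
    unfolding has_sym_grad_def
  proof (intro conjI ballI allI)
    show "v \<in> L1_loc" "w \<in> L1_loc" using lw lvv by (auto intro: L1_loc_vec2 L1_loc_mat22)
    fix \<phi> :: "real^2 \<Rightarrow> real" and i j :: 2
    assume \<phi>: "\<phi> \<in> test_functions"
    note [measurable] = mt[OF \<phi>] mt[OF test_functionsD(3)[OF \<phi>]]
    have s: "(LINT x|lborel. v1 x * partial 2 \<phi> x / 2 + v2 x * partial 1 \<phi> x / 2) = 0"
      "(LINT x|lborel. v2 x * partial 1 \<phi> x / 2 + v1 x * partial 2 \<phi> x / 2) = 0"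
      using sym[OF \<phi>] by (simp_all add: add_divide_distrib[symmetric] add.commute)
    show "(LINT x|lebesgue. w x $ i $ j * \<phi> x) =
      - (LINT x|lebesgue. (v x $ i * partial j \<phi> x + v x $ j * partial i \<phi> x) / 2)"
      using exhaust_2[of i] exhaust_2[of j] ibp1[OF \<phi>] ibp2[OF \<phi>] s
      by (auto simp: v_nth w_eq integral_lebesgue_lborel add_divide_distrib)
  qed
  show "w \<in> L2_loc"
    unfolding w_eq[abs_def] by (intro L2_loc_mat2 lv loc_bdd_const)
  show "curl_curl_free w"
    unfolding curl_curl_free_def
  proof
    fix \<phi> :: "real^2 \<Rightarrow> real" assume \<phi>: "\<phi> \<in> test_functions"
    note p = test_functionsD(3)
    note [measurable] = mt[OF \<phi>] mt[OF p[OF \<phi>]] mt[OF p[OF p[OF \<phi>]]]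
    have "(LINT x|lebesgue. w x $ 2 $ 2 * partial 1 (partial 1 \<phi>) x - w x $ 2 $ 1 * partial 1 (partial 2 \<phi>) x
        - w x $ 1 $ 2 * partial 2 (partial 1 \<phi>) x + w x $ 1 $ 1 * partial 2 (partial 2 \<phi>) x) =
       (LINT x|lborel. w2 x * partial 1 (partial 1 \<phi>) x + w1 x * partial 2 (partial 2 \<phi>) x)"
      by (subst integral_lebesgue_lborel) (auto simp: w_eq)
    also have "\<dots> = (LINT x|lborel. w2 x * partial 1 (partial 1 \<phi>) x) + (LINT x|lborel. w1 x * partial 2 (partial 2 \<phi>) x)"
      by (intro Bochner_Integration.integral_add loc_bdd_test_integrable lv p \<phi>)
    \<comment> \<open>One more derivative goes onto the test function. The two terms then form the
      shear of \<open>v\<close> tested with \<open>partial 1 (partial 2 \<phi>)\<close>, which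
      \<open>sym\<close> annihilates.\<close>
    also have "\<dots> = - (LINT x|lborel. v2 x * partial 2 (partial 1 (partial 1 \<phi>)) x) - (LINT x|lborel. v1 x * partial 1 (partial 2 (partial 2 \<phi>)) x)"
      using ibp1[OF p[OF p[OF \<phi>]]] ibp2[OF p[OF p[OF \<phi>]]] by simp
    also have "partial 2 (partial 1 (partial 1 \<phi>)) = partial 1 (partial 1 (partial 2 \<phi>))"
      using test_partial_commute[OF p[OF \<phi>]] test_partial_commute[OF \<phi>] by simp
    also have "partial 1 (partial 2 (partial 2 \<phi>)) = partial 2 (partial 1 (partial 2 \<phi>))"
      using test_partial_commute[OF p[OF \<phi>]] by simp
    also have "- (LINT x|lborel. v2 x * partial 1 (partial 1 (partial 2 \<phi>)) x) - (LINT x|lborel. v1 x * partial 2 (partial 1 (partial 2 \<phi>)) x)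
      = - (LINT x|lborel. v1 x * partial 2 (partial 1 (partial 2 \<phi>)) x + v2 x * partial 1 (partial 1 (partial 2 \<phi>)) x)"
      by (subst Bochner_Integration.integral_add) (auto intro!: loc_bdd_test_integrable lv p \<phi>)
    also have "\<dots> = 0" using sym[OF p[OF p[OF \<phi>]]] by simp
    finally show "(LINT x|lebesgue. w x $ 2 $ 2 * partial 1 (partial 1 \<phi>) x - w x $ 2 $ 1 * partial 1 (partial 2 \<phi>) x
        - w x $ 1 $ 2 * partial 2 (partial 1 \<phi>) x + w x $ 1 $ 1 * partial 2 (partial 2 \<phi>) x) = 0" .
  qed
qed

section \<open>Mollified compatibility\<close>

text \<open>\<open>kern\<close> is 0 left of -1 and the identity right of 1. Its slope thus goes
  from 0 to 1, so \<open>kern_d 2\<close> is a mollifier of mass one supported in [-1, 1] with an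
  explicit second antiderivative; its sign is not controlled.\<close>

definition kern :: "real \<Rightarrow> real" where
  "kern t = t * sstep ((t + 1) / 2)"

definition kern_d :: "nat \<Rightarrow> real \<Rightarrow> real" where
  "kern_d n = (deriv ^^ n) kern"

lemma smooth1_kern_d: "smooth1 (kern_d n)"
proof (induction n)
  case 0
  have "smooth1 (\<lambda>t. (1 * t + 0) * sstep ((1/2) * t + 1/2))"
    by (intro smooth1_mult smooth1_affine_self smooth1_affine smooth1_sstep)
  then show ?case by (simp add: kern_d_def kern_def[abs_def] add_divide_distrib)
next
  case (Suc n)
  then show ?case using smooth1_deriv(2) by (simp add: kern_d_def)
qed

lemma kern_d_deriv: "(kern_d n has_real_derivative kern_d (Suc n) t) (at t)"
  using smooth1_deriv(1)[OF smooth1_kern_d[of n]] by (simp add: kern_d_def)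

lemma kern_d_left: "t \<le> -1 \<Longrightarrow> kern_d n t = 0"
proof (induction n arbitrary: t)
  case 0 then show ?case by (simp add: kern_d_def kern_def sstep_0)
next
  case (Suc n)
  then show ?case using deriv_eq_0_left[OF Suc.IH kern_d_deriv] by blast
qed

lemma kern_right: "t \<ge> 1 \<Longrightarrow> kern t = t"
  by (simp add: kern_def sstep_1)

lemma kern_d_right: "t \<ge> 1 \<Longrightarrow> kern_d 1 t = 1" "t \<ge> 1 \<Longrightarrow> kern_d (Suc (Suc n)) t = 0"
proof -
  have 1: "kern_d 1 t = 1" if "t \<ge> 1" for t
  proof -
    have "((\<lambda>t. kern_d 0 t - t) has_real_derivative kern_d 1 t - 1) (at t)"
      using kern_d_deriv[of 0 t] by (auto intro!: derivative_eq_intros)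
    from deriv_eq_0_right[OF _ this, of 1 0] that show ?thesis
      by (simp add: kern_d_def kern_right)
  qed
  show "t \<ge> 1 \<Longrightarrow> kern_d 1 t = 1" using 1 .
  have "kern_d (Suc (Suc n)) t = 0" if "t \<ge> 1" for t
    using that
  proof (induction n arbitrary: t)
    case 0 show ?case using deriv_eq_0_right[OF 1 kern_d_deriv[of 1 t]] 0 by simp
  next
    case (Suc n)
    show ?case using deriv_eq_0_right[OF Suc.IH kern_d_deriv] Suc.prems by blast
  qed
  then show "t \<ge> 1 \<Longrightarrow> kern_d (Suc (Suc n)) t = 0" .
qed

lemma kern_d_0_bound: "\<bar>kern_d 0 t\<bar> \<le> \<bar>t\<bar>"
  using sstep_bounds[of "(t+1)/2"] by (simp add: kern_d_def kern_def abs_mult mult_left_le)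

text \<open>Order 0 is left out because \<open>kern\<close> grows linearly; orders 1 to 4 are the
  others that occur in \<open>rho\<close> and in \<open>mollified_curl_curl\<close>.\<close>

lemma kern_d_bound: "\<exists>M\<ge>1. \<forall>n\<in>{1..4}. \<forall>t. \<bar>kern_d n t\<bar> \<le> M"
proof -
  have b: "\<exists>B. \<forall>t\<in>{-1..1}. \<bar>kern_d n t\<bar> \<le> B" for n
  proof -
    have "bounded (kern_d n ` {-1..1})"
      by (intro compact_imp_bounded compact_continuous_image smooth1_continuous smooth1_kern_d) auto
    then show ?thesis by (auto simp: bounded_iff)
  qed
  then obtain B where B: "\<And>n t. t \<in> {-1..1} \<Longrightarrow> \<bar>kern_d n t\<bar> \<le> B n" by metis
  define M where "M = 1 + \<bar>B 1\<bar> + \<bar>B 2\<bar> + \<bar>B 3\<bar> + \<bar>B 4\<bar>"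
  have "\<bar>kern_d n t\<bar> \<le> M" if n: "n \<in> {1..4}" for n t
  proof -
    have n': "n = 1 \<or> n = 2 \<or> n = 3 \<or> n = 4" using n by auto
    consider "t \<le> -1" | "t \<in> {-1..1}" | "t \<ge> 1" by force
    then show ?thesis
    proof cases
      case 1 then show ?thesis by (simp add: kern_d_left M_def)
    next
      case 2 then show ?thesis using B[OF 2, of n] n' by (auto simp: M_def)
    next
      case 3 
      then have "\<bar>kern_d n t\<bar> \<le> 1" 
      proof (cases "n = 1")
        case False
        then obtain m where "n = Suc (Suc m)" using n by (cases n; cases "n - 1") auto
        then show ?thesis using kern_d_right(2)[OF 3, of m] by simp
      qed (use kern_d_right(1)[OF 3] in auto)
      then show ?thesis by (simp add: M_def)
    qed
  qed
  then show ?thesis by (intro exI[of _ M]) (auto simp: M_def)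
qed

lemma kern_d_2_supp: "\<bar>t\<bar> \<ge> 1 \<Longrightarrow> kern_d (Suc (Suc n)) t = 0"
  using kern_d_left[of t "Suc (Suc n)"] kern_d_right(2)[of t n] by (auto simp: abs_if split: if_splits)

lemma kern_d_measurable [measurable]: "kern_d n \<in> borel_measurable borel"
  by (intro borel_measurable_continuous_onI smooth1_continuous smooth1_kern_d)

lemma kern_d_2_integral: "(LINT t|lborel. kern_d 2 t) = 1"
proof -
  have "(kern_d 2 has_integral (kern_d 1 1 - kern_d 1 (-1))) {-1..1}"
    by (rule fundamental_theorem_of_calculus)
       (use kern_d_deriv[of 1] in \<open>auto simp: has_real_derivative_iff_has_vector_derivative[symmetric] numeral_2_eq_2 intro: has_field_derivative_at_within\<close>)
  then have "(kern_d 2 has_integral 1) {-1..1}"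
    using kern_d_right(1)[of 1] kern_d_left[of "-1" 1] by simp
  then have hi: "(kern_d 2 has_integral 1) UNIV"
    by (rule has_integral_on_superset) (auto simp: kern_d_2_supp[of _ 0, folded numeral_2_eq_2] abs_le_iff)
  obtain M where M: "M \<ge> 1" "\<forall>n\<in>{1..4}. \<forall>t. \<bar>kern_d n t\<bar> \<le> M" using kern_d_bound by blast
  have "integrable lborel (kern_d 2)"
  proof (rule integrableI_bounded_set[of "{-1..1}" _ _ M])
    show "AE t in lborel. t \<in> {-1..1} \<longrightarrow> norm (kern_d 2 t) \<le> M" using M(2) by auto
    show "AE t in lborel. t \<notin> {-1..1} \<longrightarrow> kern_d 2 t = 0"
      using kern_d_2_supp[of _ 0, folded numeral_2_eq_2] by (auto simp: abs_le_iff)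
  qed auto
  from has_integral_integral_lborel[OF this] hi show ?thesis using has_integral_unique by blast
qed

section \<open>The planar mollifier and the defect of a strain\<close>

definition rho :: "real \<Rightarrow> real^2 \<Rightarrow> real" where
  "rho h z = kern_d 2 (z $ 1 / h) / h * (kern_d 2 (z $ 2 / h) / h)"

lemma rho_measurable [measurable]: "rho h \<in> borel_measurable borel"
  unfolding rho_def by measurable

lemma integral_rho:
  assumes "h > 0" shows "integrable lborel (rho h)" "(LINT z|lborel. rho h z) = 1"
proof -
  obtain M where M: "M \<ge> 1" "\<forall>n\<in>{1..4}. \<forall>t. \<bar>kern_d n t\<bar> \<le> M" using kern_d_bound by blast
  have b: "\<bar>rho h z\<bar> \<le> M / h * (M / h)" for z
    unfolding rho_def abs_mult using assms M(1) M(2)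
    by (intro mult_mono) (auto simp: divide_right_mono)
  have s: "rho h z = 0" if "z \<notin> cbox (pt (-h) (-h)) (pt h h)" for z
  proof -
    have "\<bar>z$1\<bar> \<ge> h \<or> \<bar>z$2\<bar> \<ge> h" using that by (auto simp: cbox_real2)
    then have "\<bar>z$1/h\<bar> \<ge> 1 \<or> \<bar>z$2/h\<bar> \<ge> 1" using assms by auto
    then show ?thesis unfolding rho_def using kern_d_2_supp[of _ 0, folded numeral_2_eq_2] by auto
  qed
  show i: "integrable lborel (rho h)"
  proof (rule integrableI_bounded_set[of "cbox (pt (-h) (-h)) (pt h h)" _ _ "M / h * (M / h)"])
    show "emeasure lborel (cbox (pt (-h) (-h)) (pt h h)) < \<infinity>"
      using emeasure_lborel_cbox_finite by (simp add: less_top)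
  qed (use b s in auto)
  have one: "(LINT t|lborel. kern_d 2 (t / h) / h) = 1"
    using lborel_integral_real_affine[of h "\<lambda>t. kern_d 2 (t / h) / h" 0] assms kern_d_2_integral by simp
  have "(LINT z|lborel. rho h z) = 
     (LINT a|lborel. LINT b|lborel. kern_d 2 (a / h) / h * (kern_d 2 (b / h) / h))"
    using integral_real2(2)[OF i] by (simp add: rho_def)
  also have "\<dots> = (LINT a|lborel. kern_d 2 (a / h) / h * (LINT b|lborel. kern_d 2 (b / h) / h))"
    by (intro Bochner_Integration.integral_cong integral_mult_right_zero refl)
  also have "\<dots> = 1" by (simp only: one mult_1_right)
  finally show "(LINT z|lborel. rho h z) = 1" .
qed

text \<open>Integrable representatives of the entries of w - Id. They vanish at every point off the
  square, not only almost everywhere, so integrands can later be compared pointwise.\<close>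

definition defect_rep :: "(real^2 \<Rightarrow> real^2^2) \<Rightarrow> (real^2 \<Rightarrow> real) \<Rightarrow> (real^2 \<Rightarrow> real) \<Rightarrow> (real^2 \<Rightarrow> real) \<Rightarrow> bool" where
  "defect_rep w p q r \<longleftrightarrow> 
    integrable lborel p \<and> integrable lborel q \<and> integrable lborel r \<and>
    (\<forall>x. x \<notin> unit_square \<longrightarrow> p x = 0 \<and> q x = 0 \<and> r x = 0) \<and>
    (AE x in lborel. w x = mat2 (1 + p x) (q x) (1 + r x))"

lemma mat_1_eq: "mat 1 = mat2 1 0 1"
  by (simp add: vec_eq_iff forall_2 mat_def)

lemma measurable_lebesgue_nth: 
  fixes w :: "real^2 \<Rightarrow> real^2^2"
  assumes "w \<in> borel_measurable lebesgue" 
  shows "(\<lambda>x. w x $ i $ j) \<in> borel_measurable lebesgue"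
proof -
  have "(\<lambda>A::real^2^2. A $ i $ j) \<in> borel_measurable borel"
    by (intro borel_measurable_continuous_onI continuous_intros)
  then show ?thesis using assms by (rule measurable_compose[rotated])
qed

text \<open>Square integrability on a bounded set gives integrability: |w| <= 1 + |w|^2 and the
  entries of Id add at most 1, so each entry of the defect is dominated by 2 + |w|^2.\<close>

lemma defect_rep_exists:
  assumes "w \<in> D_curl_curl (mat 1)"
  obtains p q r where "defect_rep w p q r"
proof -
  have w: "w \<in> borel_measurable lebesgue" "(\<lambda>x. (norm (w x))\<^sup>2) absolutely_integrable_on unit_square"
    "\<And>x. transpose (w x) = w x" "AE x in lebesgue. x \<notin> unit_square \<longrightarrow> w x = mat 1"
    using assms by (auto simp: D_curl_curl_def L2_loc_def)
  have sym: "w x $ 2 $ 1 = w x $ 1 $ 2" for x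
    using arg_cong[OF w(3)[of x], of "\<lambda>A. A $ 1 $ 2"] by (simp add: transpose_def)
  have rep: "\<exists>p. integrable lborel p \<and> (\<forall>x. x \<notin> unit_square \<longrightarrow> p x = 0) \<and> 
      (AE x in lborel. w x $ i $ j = mat 1 $ i $ j + p x)" for i j
  proof -
    have "(\<lambda>x. w x $ i $ j - mat 1 $ i $ j) \<in> borel_measurable (completion lborel)"
      using measurable_lebesgue_nth[OF w(1)] by auto
    then obtain p0 where p0 [measurable]: "p0 \<in> borel_measurable lborel" 
       and ae: "AE x in lborel. w x $ i $ j - mat 1 $ i $ j = p0 x"
      using completion_ex_borel_measurable_real by blast
    define p where "p = (\<lambda>x. indicator unit_square x * p0 x)"
    have pm [measurable]: "p \<in> borel_measurable lborel" unfolding p_def by measurable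
    have ae2: "AE x in lborel. w x $ i $ j = mat 1 $ i $ j + p x"
      using ae w(4)[unfolded AE_completion_iff]
    proof eventually_elim
      case (elim x)
      then show ?case by (cases "x \<in> unit_square") (auto simp: p_def)
    qed
    have "integrable lebesgue (\<lambda>x. indicator unit_square x * 2 + indicator unit_square x * (norm (w x))\<^sup>2)"
    proof (rule Bochner_Integration.integrable_add)
      show "integrable lebesgue (\<lambda>x. indicator unit_square x * (norm (w x))\<^sup>2)"
        using w(2) by (simp add: set_integrable_def)
      have "integrable lborel (\<lambda>x::real^2. indicator unit_square x * (2::real))"
        using emeasure_lborel_cbox_finite[of "0::real^2" 1]
        by (intro integrable_mult_left integrable_real_indicator) (auto simp: less_top)
      then show "integrable lebesgue (\<lambda>x::real^2. indicator unit_square x * (2::real))"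
        by (subst integrable_completion) auto
    qed
    then have "integrable lebesgue p"
    proof (rule Bochner_Integration.integrable_bound)
      show "p \<in> borel_measurable lebesgue" using pm by (rule measurable_completion)
      show "AE x in lebesgue. norm (p x) \<le> norm (indicator unit_square x * 2 + indicator unit_square x * (norm (w x))\<^sup>2)"
        using AE_completion[OF ae2]
      proof eventually_elim
        case (elim x)
        have "\<bar>w x $ i $ j\<bar> \<le> norm (w x)"
          using component_le_norm_cart[of "w x $ i" j] Finite_Cartesian_Product.norm_nth_le[of "w x" i] by linarith
        moreover have "norm (w x) \<le> 1 + (norm (w x))\<^sup>2"
          using zero_le_power2[of "norm (w x) - 1/2"] by (simp add: power2_eq_square algebra_simps)
        moreover have "\<bar>mat 1 $ i $ j :: real\<bar> \<le> 1" by (simp add: mat_def)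
        ultimately show ?case using elim
          by (cases "x \<in> unit_square") (auto simp: p_def)
      qed
    qed
    then have "integrable lborel p" by (subst (asm) integrable_completion) auto
    with ae2 show ?thesis by (intro exI[of _ p]) (auto simp: p_def)
  qed
  obtain p where p: "integrable lborel p" "\<forall>x. x \<notin> unit_square \<longrightarrow> p x = 0" 
     "AE x in lborel. w x $ 1 $ 1 = 1 + p x" using rep[of 1 1] by (auto simp: mat_def)
  obtain q where q: "integrable lborel q" "\<forall>x. x \<notin> unit_square \<longrightarrow> q x = 0" 
     "AE x in lborel. w x $ 1 $ 2 = q x" using rep[of 1 2] by (auto simp: mat_def)
  obtain r where r: "integrable lborel r" "\<forall>x. x \<notin> unit_square \<longrightarrow> r x = 0" 
     "AE x in lborel. w x $ 2 $ 2 = 1 + r x" using rep[of 2 2] by (auto simp: mat_def)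
  from p(3) q(3) r(3) have ae: "AE x in lborel. w x = mat2 (1 + p x) (q x) (1 + r x)"
    by eventually_elim (simp add: vec_eq_iff forall_2 sym mat_def)
  show ?thesis
    by (rule that[of p q r], unfold defect_rep_def) (use p(1,2) q(1,2) r(1,2) ae in blast)
qed

lemma test_bounded:
  fixes \<phi> :: "real^2 \<Rightarrow> real"
  assumes "\<phi> \<in> test_functions" obtains B where "\<And>x. \<bar>\<phi> x\<bar> \<le> B"
proof -
  obtain R where R: "R > 0" "\<And>x. \<phi> x \<noteq> 0 \<Longrightarrow> norm x < R" using test_functions_support[OF assms] by blast
  obtain B where B: "\<And>x. x \<in> cball 0 R \<Longrightarrow> \<bar>\<phi> x\<bar> \<le> B" 
    using test_loc_bdd[OF assms] unfolding loc_bdd_def by metis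
  have "\<bar>\<phi> x\<bar> \<le> \<bar>B\<bar>" for x using R(2)[of x] B[of x] by (cases "\<phi> x = 0") auto
  then show ?thesis by (rule that)
qed

lemma integrable_mult_bounded:
  fixes g \<phi> :: "'a \<Rightarrow> real"
  assumes "integrable M g" "\<phi> \<in> borel_measurable M" "\<And>x. \<bar>\<phi> x\<bar> \<le> B"
  shows "integrable M (\<lambda>x. g x * \<phi> x)"
proof (rule Bochner_Integration.integrable_bound[of _ "\<lambda>x. B * g x"])
  have "0 \<le> B" using assms(3) abs_ge_zero order_trans by blast
  then show "AE x in M. norm (g x * \<phi> x) \<le> norm (B * g x)"
    using assms(3) by (auto simp: abs_mult mult.commute[of B] intro!: mult_left_mono)
  show "(\<lambda>x. g x * \<phi> x) \<in> borel_measurable M"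
    using assms(1,2) by measurable
qed (use assms in auto)

lemma integrable_mult_test:
  fixes g :: "real^2 \<Rightarrow> real"
  assumes "integrable lborel g" "\<phi> \<in> test_functions"
  shows "integrable lborel (\<lambda>x. g x * \<phi> x)"
proof -
  obtain B where B: "\<And>x. \<bar>\<phi> x\<bar> \<le> B" using test_bounded[OF assms(2)] by blast
  show ?thesis
    by (rule integrable_mult_bounded[OF assms(1) _ B]) 
       (use loc_bdd_measurable[OF test_loc_bdd[OF assms(2)]] in auto)
qed

text \<open>The identity contributes only integrals of derivatives of test functions, which vanish;
  symmetry of second derivatives merges the two mixed terms.\<close>

lemma defect_curl_curl:
  assumes w: "w \<in> D_curl_curl (mat 1)" and rep: "defect_rep w p q r" and \<phi>: "\<phi> \<in> test_functions"
  shows "(LINT x|lborel. r x * partial 1 (partial 1 \<phi>) x) = 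
     (LINT x|lborel. q x * (2 * partial 1 (partial 2 \<phi>) x)) - (LINT x|lborel. p x * partial 2 (partial 2 \<phi>) x)"
proof -
  note P = test_functionsD(3)
  have i: "integrable lborel p" "integrable lborel q" "integrable lborel r" 
     and ae: "AE x in lborel. w x = mat2 (1 + p x) (q x) (1 + r x)"
    using rep by (auto simp: defect_rep_def)
  let ?a = "partial 1 (partial 1 \<phi>)" and ?b = "partial 1 (partial 2 \<phi>)" and ?c = "partial 2 (partial 2 \<phi>)"
  have t: "?a \<in> test_functions" "?b \<in> test_functions" "?c \<in> test_functions" using \<phi> P by auto
  note i2 = integrable_mult_test[OF i(1) t(3)] integrable_mult_test[OF i(2) t(2)] integrable_mult_test[OF i(3) t(1)]
  have i3: "integrable lborel ?a" "integrable lborel ?c"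
    using loc_bdd_test_integrable(1)[OF loc_bdd_const[of 1] t(1)] loc_bdd_test_integrable(1)[OF loc_bdd_const[of 1] t(3)] by auto
  note [measurable] = t[THEN test_loc_bdd, THEN loc_bdd_measurable] i[THEN borel_measurable_integrable]
  have "w \<in> borel_measurable lebesgue" using w by (auto simp: D_curl_curl_def L2_loc_def)
  note [measurable] = measurable_lebesgue_nth[OF this]
  have [measurable]: "?a \<in> borel_measurable lebesgue" "?b \<in> borel_measurable lebesgue" "?c \<in> borel_measurable lebesgue"
    by (auto intro!: measurable_completion)
  let ?I = "\<lambda>x. ((?a x + ?c x) + r x * ?a x) - q x * (2 * ?b x) + p x * ?c x"
  have "0 = (LINT x|lebesgue.
          w x $ 2 $ 2 * ?a x - w x $ 2 $ 1 * ?b x - w x $ 1 $ 2 * partial 2 (partial 1 \<phi>) x + w x $ 1 $ 1 * ?c x)"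
    using w \<phi> unfolding D_curl_curl_def curl_curl_free_def by simp
  also have "\<dots> = (LINT x|lebesgue. ?I x)"
  proof (rule integral_cong_AE)
    show "AE x in lebesgue. w x $ 2 $ 2 * ?a x - w x $ 2 $ 1 * ?b x - w x $ 1 $ 2 * partial 2 (partial 1 \<phi>) x + w x $ 1 $ 1 * ?c x = ?I x"
      using AE_completion[OF ae]
      by eventually_elim (simp add: test_partial_commute[OF \<phi>, symmetric] algebra_simps)
    show "?I \<in> borel_measurable lebesgue"
      by (intro measurable_completion) measurable
    show "(\<lambda>x. w x $ 2 $ 2 * ?a x - w x $ 2 $ 1 * ?b x - w x $ 1 $ 2 * partial 2 (partial 1 \<phi>) x + w x $ 1 $ 1 * ?c x) \<in> borel_measurable lebesgue"
      unfolding test_partial_commute[OF \<phi>, symmetric] by measurable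
  qed
  also have "\<dots> = (LINT x|lborel. ?I x)"
    by (rule integral_completion) measurable
  also have "\<dots> = (LINT x|lborel. ?a x) + (LINT x|lborel. ?c x) + (LINT x|lborel. r x * ?a x) 
      - (LINT x|lborel. q x * (2 * ?b x)) + (LINT x|lborel. p x * ?c x)"
    using i2 i3 by (simp add: mult.left_commute[of _ 2])
  finally show ?thesis
    using integral_partial_test P \<phi> by simp
qed

lemma kern_scaled_deriv:
  assumes "h > 0"
  shows "((\<lambda>s. kern_d n ((s - c) / h)) has_real_derivative kern_d (Suc n) ((s - c) / h) / h) (at s)"
proof -
  have "((\<lambda>s. (s - c) / h) has_real_derivative 1 / h) (at s)"
    using assms by (auto intro!: derivative_eq_intros)
  from DERIV_chain'[OF this kern_d_deriv[of n]] show ?thesis by simp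
qed

text \<open>The test function is \<open>k(x\<^sub>1 - y\<^sub>1) \<rho>(x\<^sub>2 - y\<^sub>2)\<close>, where \<open>k'' = \<rho>\<close> at scale \<open>h\<close>. Since \<open>k\<close> grows
  linearly it is cut off far away from the square, where the defect vanishes.\<close>

lemma mollified_curl_curl:
  assumes w: "w \<in> D_curl_curl (mat 1)" and rep: "defect_rep w p q r" 
    and h: "0 < h" "h \<le> 1" and y: "y \<in> unit_square"
  shows "(LINT x|lborel. r x * rho h (x - y)) = 
     (LINT x|lborel. q x * (2 * (kern_d 1 ((x - y) $ 1 / h) * kern_d 3 ((x - y) $ 2 / h) / h\<^sup>2))) - 
     (LINT x|lborel. p x * (h * kern_d 0 ((x - y) $ 1 / h) * (kern_d 4 ((x - y) $ 2 / h) / h ^ 3)))"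
proof -
  \<comment> \<open>The cutoff is 1 on [-1, 2], which leaves an open interval around [0, 1] where
    the derivatives of \<open>a\<close> can be read off.\<close>
  define \<eta> where "\<eta> = (\<lambda>s::real. sstep (1 * s + 2) * sstep ((-1) * s + 3))"
  have \<eta>s: "smooth1 \<eta>" unfolding \<eta>_def by (intro smooth1_mult smooth1_affine smooth1_sstep)
  have \<eta>1: "\<eta> s = 1" if "s \<in> {-1..2}" for s using that by (auto simp: \<eta>_def sstep_1)
  have \<eta>0: "\<eta> s = 0" if "s \<le> -2 \<or> s \<ge> 3" for s using that by (auto simp: \<eta>_def sstep_0)
  have sc: "smooth1 (\<lambda>s. kern_d n ((s - c) / h))" for n c
    using smooth1_affine[OF smooth1_kern_d[of n], of "1/h" "- c / h"] by (simp add: diff_divide_distrib)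
  define k where "k = (\<lambda>n s. kern_d n ((s - y $ 1) / h))"
  define l where "l = (\<lambda>n s. kern_d n ((s - y $ 2) / h))"
  have ks: "smooth1 (k n)" "smooth1 (l n)" for n unfolding k_def l_def using sc by auto
  have kd: "(k n has_real_derivative k (Suc n) s / h) (at s)" "(l n has_real_derivative l (Suc n) s / h) (at s)" for n s
    unfolding k_def l_def using kern_scaled_deriv[OF h(1)] by auto
  have y': "0 \<le> y $ 1" "y $ 1 \<le> 1" "0 \<le> y $ 2" "y $ 2 \<le> 1" using y by (auto simp: cbox_real2)
  \<comment> \<open>The factors \<open>h\<close> and \<open>1 / h\<close> are chosen such that the
    second derivative of \<open>a\<close> times \<open>b\<close> is \<open>rho h (x - y)\<close> on
    the square.\<close>
  define a where "a = (\<lambda>s. (h * k 0 s) * \<eta> s)"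
  define b where "b = (\<lambda>s. (1 / h) * l 2 s)"
  define \<phi> where "\<phi> = (\<lambda>x::real^2. a (x $ 1) * b (x $ 2))"
  have as: "smooth1 a" "smooth1 b" unfolding a_def b_def
    by (intro smooth1_mult smooth1_const ks \<eta>s)+
  note as' = as[THEN smooth1_deriv(2)]
  have b0: "b s = 0" if "\<bar>s\<bar> > 3" for s
  proof -
    have "\<bar>s - y $ 2\<bar> \<ge> 1 * h" using that y' h by (auto simp: abs_if split: if_splits)
    then have "\<bar>(s - y $ 2) / h\<bar> \<ge> 1" using h by (simp add: field_simps)
    then show ?thesis using kern_d_2_supp[of _ 0, folded numeral_2_eq_2] by (simp add: b_def l_def)
  qed
  have \<phi>: "\<phi> \<in> test_functions" unfolding \<phi>_def
    by (rule test_functions_product[where R=3]) (use as b0 \<eta>0 in \<open>auto simp: a_def abs_if split: if_splits\<close>)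
  note D = smooth1_deriv(1)
  have p1: "partial 1 \<phi> = (\<lambda>x. deriv a (x $ 1) * b (x $ 2))" "partial 2 \<phi> = (\<lambda>x. a (x $ 1) * deriv b (x $ 2))"
    unfolding \<phi>_def by (rule product_partial D as)+
  have p2: "partial 1 (partial 1 \<phi>) = (\<lambda>x. deriv (deriv a) (x $ 1) * b (x $ 2))" 
    "partial 1 (partial 2 \<phi>) = (\<lambda>x. deriv a (x $ 1) * deriv b (x $ 2))"
    "partial 2 (partial 2 \<phi>) = (\<lambda>x. a (x $ 1) * deriv (deriv b) (x $ 2))"
    unfolding p1 by (rule product_partial D as as')+
  have db: "deriv b = (\<lambda>s. l 3 s / h\<^sup>2)"
  proof
    fix s
    have "(b has_real_derivative l 3 s / h\<^sup>2) (at s)"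
      unfolding b_def using DERIV_cmult[OF kd(2)[of 2 s], of "1/h"] by (simp add: power2_eq_square numeral_3_eq_3 numeral_2_eq_2)
    then show "deriv b s = l 3 s / h\<^sup>2" by (rule DERIV_imp_deriv)
  qed
  have ddb: "deriv (deriv b) = (\<lambda>s. l 4 s / h^3)"
  proof
    fix s
    have "(deriv b has_real_derivative l 4 s / h^3) (at s)"
      unfolding db using DERIV_cmult[OF kd(2)[of 3 s], of "1/h\<^sup>2"] by (simp add: power2_eq_square power3_eq_cube eval_nat_numeral mult.assoc)
    then show "deriv (deriv b) s = l 4 s / h^3" by (rule DERIV_imp_deriv)
  qed
  have ain: "a s = h * k 0 s" if "s \<in> {-1<..<2}" for s using that \<eta>1[of s] by (auto simp: a_def)
  have da: "deriv a s = k 1 s" if "s \<in> {-1<..<2}" for s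
  proof (rule DERIV_imp_deriv)
    have "((\<lambda>s. h * k 0 s) has_real_derivative k 1 s) (at s)"
      using DERIV_cmult[OF kd(1)[of 0 s], of h] h by simp
    then show "(a has_real_derivative k 1 s) (at s)"
      by (rule has_field_derivative_transform_within_open[of _ _ _ "{-1<..<2}"]) (use that ain in auto)
  qed
  have dda: "deriv (deriv a) s = k 2 s / h" if "s \<in> {-1<..<2}" for s
  proof (rule DERIV_imp_deriv)
    have "(k 1 has_real_derivative k 2 s / h) (at s)"
      using kd(1)[of 1 s] by (simp add: numeral_2_eq_2)
    then show "(deriv a has_real_derivative k 2 s / h) (at s)"
      by (rule has_field_derivative_transform_within_open[of _ _ _ "{-1<..<2}"]) (use that da in auto)
  qed
  \<comment> \<open>The defect vanishes off the square, so the effect of the cutoff is never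
    seen.\<close>
  have z: "g x * F x = g x * G x" if "\<And>x. x \<in> unit_square \<Longrightarrow> F x = G x" "\<And>x. x \<notin> unit_square \<longrightarrow> g x = 0" 
    for g F G :: "real^2 \<Rightarrow> real" and x
    using that by (cases "x \<in> unit_square") auto
  have in1: "x $ 1 \<in> {-1<..<2}" if "x \<in> unit_square" for x :: "real^2" using that by (auto simp: cbox_real2)
  have 0: "\<And>x. x \<notin> unit_square \<longrightarrow> p x = 0" "\<And>x. x \<notin> unit_square \<longrightarrow> q x = 0" "\<And>x. x \<notin> unit_square \<longrightarrow> r x = 0"
    using rep by (auto simp: defect_rep_def)
  have "(LINT x|lborel. r x * rho h (x - y)) = (LINT x|lborel. r x * partial 1 (partial 1 \<phi>) x)"
    by (rule Bochner_Integration.integral_cong[OF refl], rule z[OF _ 0(3)])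
       (use dda in1 in \<open>auto simp: p2 rho_def b_def k_def l_def\<close>)
  also have "\<dots> = (LINT x|lborel. q x * (2 * partial 1 (partial 2 \<phi>) x)) - (LINT x|lborel. p x * partial 2 (partial 2 \<phi>) x)"
    by (rule defect_curl_curl[OF w rep \<phi>])
  also have "(LINT x|lborel. q x * (2 * partial 1 (partial 2 \<phi>) x)) = 
    (LINT x|lborel. q x * (2 * (kern_d 1 ((x - y) $ 1 / h) * kern_d 3 ((x - y) $ 2 / h) / h\<^sup>2)))"
    by (rule Bochner_Integration.integral_cong[OF refl], rule z[OF _ 0(2)])
       (use da in1 in \<open>auto simp: p2 db k_def l_def\<close>)
  also have "(LINT x|lborel. p x * partial 2 (partial 2 \<phi>) x) = 
    (LINT x|lborel. p x * (h * kern_d 0 ((x - y) $ 1 / h) * (kern_d 4 ((x - y) $ 2 / h) / h ^ 3)))"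
    by (rule Bochner_Integration.integral_cong[OF refl], rule z[OF _ 0(1)])
       (use ain in1 in \<open>auto simp: p2 ddb k_def l_def\<close>)
  finally show ?thesis .
qed

text \<open>A Schur-type estimate: a kernel bounded by \<open>B\<close> and living, for fixed
  \<open>x\<close>, on a set of measure at most \<open>m\<close> acts with norm
  \<open>B * m\<close>. The bound is asked only where \<open>g x \<noteq> 0\<close>, since the
  linearly growing kernel is controlled only for \<open>x\<close> in the square.\<close>

lemma kernel_Fubini:
  fixes g :: "real^2 \<Rightarrow> real" and H :: "real^2 \<Rightarrow> real^2 \<Rightarrow> real"
  assumes g: "integrable lborel g"
    and H [measurable]: "(\<lambda>p. H (fst p) (snd p)) \<in> borel_measurable (borel \<Otimes>\<^sub>M borel)"
    and A: "\<And>x. A x \<in> sets borel" "\<And>x. emeasure lborel (A x) \<le> ennreal m" and m: "0 \<le> m" "0 \<le> B"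
    and b: "\<And>x y. g x \<noteq> 0 \<Longrightarrow> \<bar>H x y\<bar> \<le> B * indicator (A x) y"
  shows "(LINT y|lborel. LINT x|lborel. g x * H x y) = (LINT x|lborel. g x * (LINT y|lborel. H x y))"
    and "\<And>x. g x \<noteq> 0 \<Longrightarrow> \<bar>LINT y|lborel. H x y\<bar> \<le> B * m"
    and "\<bar>LINT y|lborel. LINT x|lborel. g x * H x y\<bar> \<le> B * m * (LINT x|lborel. \<bar>g x\<bar>)"
    and "integrable lborel (\<lambda>y. LINT x|lborel. g x * H x y)"
    and "integrable lborel (\<lambda>x. g x * (LINT y|lborel. H x y))"
proof -
  have [measurable]: "g \<in> borel_measurable borel" using borel_measurable_integrable[OF g] by simp
  have H': "(\<lambda>y. H x y) \<in> borel_measurable borel" for x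
    using measurable_compose[OF _ H, of "\<lambda>y. (x, y)" borel] by simp
  have fin: "emeasure lborel (A x) < \<infinity>" for x
    using le_less_trans[OF A(2) ennreal_less_top] by simp
  have mA: "measure lborel (A x) \<le> m" for x
    using A(2)[of x] fin[of x] m by (simp add: measure_def enn2real_leI)
  have iA: "integrable lborel (\<lambda>y. B * indicator (A x) y :: real)" for x
    using fin A(1) by (intro integrable_mult_right integrable_real_indicator) auto
  have iH: "integrable lborel (H x)" if "g x \<noteq> 0" for x
    by (rule Bochner_Integration.integrable_bound[OF iA[of x]]) (use b[OF that] H' in \<open>auto intro: order_trans[OF _ abs_ge_self]\<close>)
  have nH: "(LINT y|lborel. \<bar>H x y\<bar>) \<le> B * m" if "g x \<noteq> 0" for x
  proof -
    have "(LINT y|lborel. \<bar>H x y\<bar>) \<le> (LINT y|lborel. B * indicator (A x) y)"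
      using iH[OF that] iA[of x] b[OF that] by (intro integral_mono) auto
    also have "\<dots> = B * measure lborel (A x)" using A(1) by simp
    also have "\<dots> \<le> B * m" using mA m by (intro mult_left_mono) auto
    finally show ?thesis .
  qed
  have iall: "integrable (lborel \<Otimes>\<^sub>M lborel) (\<lambda>(x, y). g x * H x y)"
  proof (rule lborel_pair.Fubini_integrable)
    show "(\<lambda>(x, y). g x * H x y) \<in> borel_measurable (lborel \<Otimes>\<^sub>M lborel)" by (simp add: case_prod_beta')
    show "AE x in lborel. integrable lborel (\<lambda>y. case (x, y) of (x, y) \<Rightarrow> g x * H x y)"
    proof (rule AE_I2)
      fix x show "integrable lborel (\<lambda>y. case (x, y) of (x, y) \<Rightarrow> g x * H x y)"
        using iH[of x] by (cases "g x = 0") auto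
    qed
    show "integrable lborel (\<lambda>x. LINT y|lborel. norm (case (x, y) of (x, y) \<Rightarrow> g x * H x y))"
    proof (rule Bochner_Integration.integrable_bound[of _ "\<lambda>x. B * m * g x"])
      show "(\<lambda>x. LINT y|lborel. norm (case (x, y) of (x, y) \<Rightarrow> g x * H x y)) \<in> borel_measurable lborel"
        by (intro lborel.borel_measurable_lebesgue_integral) (simp add: case_prod_beta')
      show "AE x in lborel. norm (LINT y|lborel. norm (case (x, y) of (x, y) \<Rightarrow> g x * H x y)) \<le> norm (B * m * g x)"
      proof (rule AE_I2)
        fix x
        show "norm (LINT y|lborel. norm (case (x, y) of (x, y) \<Rightarrow> g x * H x y)) \<le> norm (B * m * g x)"
        proof (cases "g x = 0")
          case False
          have "(LINT y|lborel. \<bar>g x\<bar> * \<bar>H x y\<bar>) = \<bar>g x\<bar> * (LINT y|lborel. \<bar>H x y\<bar>)" by simp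
          also have "\<dots> \<le> \<bar>g x\<bar> * (B * m)" using nH[OF False] by (intro mult_left_mono) auto
          finally show ?thesis using m by (simp add: abs_mult mult.commute)
        qed simp
      qed
    qed (use g in auto)
  qed
  have "(LINT y|lborel. LINT x|lborel. g x * H x y) = (LINT x|lborel. LINT y|lborel. g x * H x y)"
    by (rule lborel_pair.Fubini_integral[OF iall])
  then show eq: "(LINT y|lborel. LINT x|lborel. g x * H x y) = (LINT x|lborel. g x * (LINT y|lborel. H x y))" by simp
  show lb: "\<bar>LINT y|lborel. H x y\<bar> \<le> B * m" if "g x \<noteq> 0" for x
    using integral_abs_bound[of lborel "H x"] nH[OF that] by linarith
  show iHm: "integrable lborel (\<lambda>x. g x * (LINT y|lborel. H x y))"
    using lborel_pair.integrable_fst'[OF iall] by simp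
  have "\<bar>LINT x|lborel. g x * (LINT y|lborel. H x y)\<bar> \<le> (LINT x|lborel. \<bar>g x * (LINT y|lborel. H x y)\<bar>)"
    by (rule integral_abs_bound)
  also have "\<dots> \<le> (LINT x|lborel. B * m * \<bar>g x\<bar>)"
  proof (rule integral_mono)
    fix x show "\<bar>g x * (LINT y|lborel. H x y)\<bar> \<le> B * m * \<bar>g x\<bar>"
      using lb[of x] by (cases "g x = 0") (auto simp: abs_mult mult.commute[of _ "\<bar>g x\<bar>"] intro!: mult_left_mono)
  qed (use iHm g in auto)
  finally show "\<bar>LINT y|lborel. LINT x|lborel. g x * H x y\<bar> \<le> B * m * (LINT x|lborel. \<bar>g x\<bar>)"
    unfolding eq by simp
  show "integrable lborel (\<lambda>y. LINT x|lborel. g x * H x y)"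
    using lborel_pair.integrable_snd[OF iall] by simp
qed

section \<open>Total variation and translations\<close>

lemma C_diff_1: "C_diff 1 f \<longleftrightarrow> (\<forall>x. f differentiable (at x)) \<and> (\<forall>i. continuous_on UNIV (partial i f))"
  by simp

lemma C_diff_1_cont: "C_diff 1 f \<Longrightarrow> continuous_on UNIV f"
  unfolding C_diff_1 by (meson continuous_at_imp_continuous_on differentiable_imp_continuous_within)

lemma partial_has_derivative:
  assumes "f differentiable (at x)"
  shows "(f has_derivative frechet_derivative f (at x)) (at x)"
  using assms frechet_derivative_works by blast

lemma C_diff_1_mult:
  fixes f g :: "real^'n::finite \<Rightarrow> real"
  assumes "C_diff 1 f" "C_diff 1 g" shows "C_diff 1 (\<lambda>x. f x * g x)"
proof -
  have d: "((\<lambda>x. f x * g x) has_derivative (\<lambda>h. f x * frechet_derivative g (at x) h + frechet_derivative f (at x) h * g x)) (at x)" for x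
    using assms unfolding C_diff_1 by (intro has_derivative_mult partial_has_derivative) auto
  have "partial i (\<lambda>x. f x * g x) = (\<lambda>x. f x * partial i g x + partial i f x * g x)" for i
    using partial_eqI[OF d] by (auto simp: partial_def)
  then show ?thesis
    using d assms C_diff_1_cont[OF assms(1)] C_diff_1_cont[OF assms(2)] unfolding C_diff_1 differentiable_def
    by (auto intro!: continuous_intros)
qed

lemma C_diff_1_add:
  fixes f g :: "real^'n::finite \<Rightarrow> real"
  assumes "C_diff 1 f" "C_diff 1 g" shows "C_diff 1 (\<lambda>x. f x + g x)"
proof -
  have d: "((\<lambda>x. f x + g x) has_derivative (\<lambda>h. frechet_derivative f (at x) h + frechet_derivative g (at x) h)) (at x)" for x
    using assms unfolding C_diff_1 by (intro has_derivative_add partial_has_derivative) auto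
  have "partial i (\<lambda>x. f x + g x) = (\<lambda>x. partial i f x + partial i g x)" for i
    using partial_eqI[OF d] by (auto simp: partial_def)
  then show ?thesis
    using d assms unfolding C_diff_1 differentiable_def
    by (auto intro!: continuous_intros)
qed

lemma C_diff_1_linear:
  assumes "bounded_linear f" shows "C_diff 1 f"
proof -
  have d: "(f has_derivative f) (at x)" for x using assms by (rule bounded_linear_imp_has_derivative)
  have "partial i f = (\<lambda>x. f (axis i 1))" for i using partial_eqI[OF d] by auto
  then show ?thesis using d unfolding C_diff_1 differentiable_def by auto
qed

lemma C_diff_1_const: "C_diff 1 (\<lambda>x::real^'n::finite. c)"
proof -
  have d: "((\<lambda>x::real^'n. c) has_derivative (\<lambda>h. 0)) (at x)" for x by simp
  have "partial i (\<lambda>x::real^'n. c) = (\<lambda>x. 0)" for i using partial_eqI[OF d] by auto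
  then show ?thesis unfolding C_diff_1 by auto
qed

text \<open>Polynomials enter through the Weierstrass approximation of a sign function.\<close>

lemma C_diff_1_polynomial: "real_polynomial_function f \<Longrightarrow> C_diff 1 f"
  by (induction rule: real_polynomial_function.induct)
     (auto intro: C_diff_1_mult C_diff_1_add C_diff_1_linear C_diff_1_const simp del: One_nat_def C_diff.simps)

lemma interior_unit_square: "interior unit_square = box 0 (1::real^2)"
  by (rule interior_cbox)

text \<open>The margin 1/4 is twice the largest translation 1/8, so translated test functions stay
  compactly supported in the open square.\<close>

abbreviation inner_square :: "(real^2) set" where
  "inner_square \<equiv> cbox (pt (1/4) (1/4)) (pt (3/4) (3/4))"

text \<open>Translations are generated by the field \<open>z \<integral>\<^sub>0\<^sup>1 \<sigma>(x + t z) dt\<close>, whose divergence is 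
  \<open>\<sigma>(x + z) - \<sigma>(x)\<close>.\<close>

lemma translation_upper_bound:
  fixes \<sigma> :: "real^2 \<Rightarrow> real"
  assumes \<sigma>: "C_diff 1 \<sigma>" "\<And>x. \<bar>\<sigma> x\<bar> \<le> 1" "\<And>x. \<sigma> x \<noteq> 0 \<Longrightarrow> x \<in> inner_square"
    and z: "\<bar>z $ 1\<bar> \<le> 1/8" "\<bar>z $ 2\<bar> \<le> 1/8"
    and TV: "total_variation (interior unit_square) u \<le> ennreal T" and T: "0 \<le> T"
  shows "(LINT x:box 0 1|lebesgue. u x * (\<sigma> (x + z) - \<sigma> x)) \<le> norm z * T"
proof (cases "z = 0")
  case False
  have \<sigma>d: "(\<sigma> has_derivative frechet_derivative \<sigma> (at x)) (at x)" for x
    using \<sigma>(1) unfolding C_diff_1 by (intro partial_has_derivative) auto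
  have \<sigma>c: "continuous_on UNIV (partial i \<sigma>)" for i using \<sigma>(1) unfolding C_diff_1 by auto
  define D where "D = (\<lambda>x. partial 1 \<sigma> x *\<^sub>R blinfun_inner_left (axis 1 1 :: real^2) + partial 2 \<sigma> x *\<^sub>R blinfun_inner_left (axis 2 1))"
  have axis_split: "h = h $ 1 *\<^sub>R axis 1 1 + h $ 2 *\<^sub>R axis 2 1" for h :: "real^2"
    by (simp add: vec_eq_iff forall_2 axis_def)
  have D_apply: "blinfun_apply (D x) h = h $ 1 * partial 1 \<sigma> x + h $ 2 * partial 2 \<sigma> x" for x h
    by (simp add: D_def blinfun.add_left blinfun.scaleR_left inner_axis mult.commute)
  have D: "(\<sigma> has_derivative blinfun_apply (D x)) (at x)" for x
  proof -
    have lin: "linear (frechet_derivative \<sigma> (at x))" using \<sigma>d has_derivative_linear by blast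
    have "frechet_derivative \<sigma> (at x) h = blinfun_apply (D x) h" for h
      unfolding D_apply partial_def
      by (subst axis_split[of h]) (simp add: linear_add[OF lin] linear_scale[OF lin])
    then have "frechet_derivative \<sigma> (at x) = blinfun_apply (D x)" by auto
    then show ?thesis using \<sigma>d[of x] by simp
  qed
  have Dc: "continuous_on UNIV D" unfolding D_def by (intro continuous_intros \<sigma>c)
  define G where "G = (\<lambda>x. integral (cbox 0 1) (\<lambda>t::real. \<sigma> (x + t *\<^sub>R z)))"
  have Gd: "(G has_derivative integral (cbox 0 1) (\<lambda>t::real. D (x + t *\<^sub>R z))) (at x)" for x
    unfolding G_def
  proof (rule leibniz_rule[where U=UNIV])
    fix x and t :: real
    have "((\<lambda>x. x + t *\<^sub>R z) has_derivative (\<lambda>h. h)) (at x)" by (auto intro!: derivative_eq_intros)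
    from has_derivative_compose[OF this D] 
    show "((\<lambda>x. \<sigma> (x + t *\<^sub>R z)) has_derivative blinfun_apply (D (x + t *\<^sub>R z))) (at x)" by simp
  next
    fix x show "(\<lambda>t. \<sigma> (x + t *\<^sub>R z)) integrable_on cbox 0 1"
      by (intro integrable_continuous continuous_on_compose2[OF C_diff_1_cont[OF \<sigma>(1)]] continuous_intros) auto
  next
    show "continuous_on (UNIV \<times> cbox 0 1) (\<lambda>(x, t::real). D (x + t *\<^sub>R z))"
      unfolding case_prod_beta by (intro continuous_on_compose2[OF Dc] continuous_intros) auto
  qed auto
  have Dint: "(\<lambda>t::real. D (x + t *\<^sub>R z)) integrable_on cbox 0 1" for x
    by (intro integrable_continuous continuous_on_compose2[OF Dc] continuous_intros) auto
  have Gp: "partial i G x = integral (cbox 0 1) (\<lambda>t::real. partial i \<sigma> (x + t *\<^sub>R z))" for i x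
    unfolding partial_eqI[OF Gd] blinfun_apply_integral[OF Dint]
    using exhaust_2[of i] by (auto simp: D_apply axis_def)
  have Gc: "continuous_on UNIV (partial i G)" for i
    unfolding Gp[abs_def]
    by (rule integral_continuous_on_param) 
       (auto simp: case_prod_beta intro!: continuous_on_compose2[OF \<sigma>c] continuous_intros)
  have Gdiff: "G differentiable (at x)" for x using Gd differentiable_def by blast
  have divG: "z $ 1 * partial 1 G x + z $ 2 * partial 2 G x = \<sigma> (x + z) - \<sigma> x" for x
  proof -
    have "((\<lambda>t. blinfun_apply (D (x + t *\<^sub>R z)) z) has_integral (\<sigma> (x + 1 *\<^sub>R z) - \<sigma> (x + 0 *\<^sub>R z))) {0..1}"
    proof (rule fundamental_theorem_of_calculus)
      fix t :: real
      have "((\<lambda>t. x + t *\<^sub>R z) has_derivative (\<lambda>h. h *\<^sub>R z)) (at t)" by (auto intro!: derivative_eq_intros)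
      from has_derivative_compose[OF this D]
      have "((\<lambda>t. \<sigma> (x + t *\<^sub>R z)) has_derivative (\<lambda>h. blinfun_apply (D (x + t *\<^sub>R z)) (h *\<^sub>R z))) (at t)" .
      then show "((\<lambda>t. \<sigma> (x + t *\<^sub>R z)) has_vector_derivative blinfun_apply (D (x + t *\<^sub>R z)) z) (at t within {0..1})"
        unfolding has_vector_derivative_def blinfun.scaleR_right by (rule has_derivative_at_withinI)
    qed simp
    then have "integral (cbox 0 1) (\<lambda>t. blinfun_apply (D (x + t *\<^sub>R z)) z) = \<sigma> (x + z) - \<sigma> x"
      by (simp add: integral_unique)
    then have "blinfun_apply (integral (cbox 0 1) (\<lambda>t. D (x + t *\<^sub>R z))) z = \<sigma> (x + z) - \<sigma> x"
      by (simp only: blinfun_apply_integral[OF Dint])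
    moreover have "blinfun_apply (integral (cbox 0 1) (\<lambda>t. D (x + t *\<^sub>R z))) z = z $ 1 * partial 1 G x + z $ 2 * partial 2 G x"
      unfolding partial_eqI[OF Gd] by (subst axis_split[of z]) (simp add: blinfun.add_right blinfun.scaleR_right)
    ultimately show ?thesis by simp
  qed
  have Gb: "\<bar>G x\<bar> \<le> 1" for x
  proof -
    have "norm (integral (cbox 0 1) (\<lambda>t::real. \<sigma> (x + t *\<^sub>R z))) \<le> 1 * measure lborel (cbox (0::real) 1)"
    proof (rule has_integral_bound)
      show "((\<lambda>t. \<sigma> (x + t *\<^sub>R z)) has_integral integral (cbox 0 1) (\<lambda>t::real. \<sigma> (x + t *\<^sub>R z))) (cbox 0 1)"
        by (intro integrable_integral integrable_continuous continuous_on_compose2[OF C_diff_1_cont[OF \<sigma>(1)]] continuous_intros) auto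
    qed (use \<sigma>(2) in auto)
    then show ?thesis by (simp add: G_def)
  qed
  have Gs: "x \<in> cbox (pt (1/8) (1/8)) (pt (7/8) (7/8))" if "G x \<noteq> 0" for x
  proof -
    obtain t :: real where t: "t \<in> {0..1}" "\<sigma> (x + t *\<^sub>R z) \<noteq> 0"
    proof (rule ccontr)
      assume "\<not> thesis"
      then have "\<sigma> (x + t *\<^sub>R z) = 0" if "t \<in> cbox 0 1" for t using that \<open>\<And>t. \<lbrakk>t \<in> {0..1}; \<sigma> (x + t *\<^sub>R z) \<noteq> 0\<rbrakk> \<Longrightarrow> thesis\<close> by auto
      then have "G x = integral (cbox 0 1) (\<lambda>t::real. 0)" unfolding G_def by (intro Henstock_Kurzweil_Integration.integral_cong) auto
      with \<open>G x \<noteq> 0\<close> show False by simp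
    qed
    have "\<bar>t * z $ i\<bar> \<le> 1/8" for i
    proof -
      have "\<bar>z $ i\<bar> \<le> 1/8" using z exhaust_2[of i] by auto
      then have "\<bar>t\<bar> * \<bar>z $ i\<bar> \<le> 1 * (1/8)" using t by (intro mult_mono) auto
      then show ?thesis by (simp add: abs_mult)
    qed
    from this[of 1] this[of 2] \<sigma>(3)[OF t(2)] show ?thesis by (auto simp: cbox_real2 abs_le_iff)
  qed
  \<comment> \<open>\<open>G\<close> is bounded by 1, so the unit direction of \<open>z\<close>
    makes the field admissible; undoing the normalization yields the factor
    \<open>norm z\<close>.\<close>
  define \<Phi> where "\<Phi> = (\<lambda>x. G x *\<^sub>R ((1 / norm z) *\<^sub>R z))"
  have \<Phi>n: "(\<lambda>x. \<Phi> x $ i) = (\<lambda>x. G x * (z $ i / norm z))" for i by (auto simp: \<Phi>_def)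
  have C1: "C_diff 1 (\<lambda>x. \<Phi> x $ i)" for i
    unfolding \<Phi>n using Gdiff Gc by (intro C_diff_1_mult C_diff_1_const) (auto simp: C_diff_1)
  have pPhi: "partial i (\<lambda>x. \<Phi> x $ j) x = partial i G x * (z $ j / norm z)" for i j x
    unfolding \<Phi>n by (subst partial_eqI[OF has_derivative_mult_left[OF Gd]]) (simp add: partial_eqI[OF Gd])
  have div: "divergence \<Phi> x = (\<sigma> (x + z) - \<sigma> x) / norm z" for x
    unfolding divergence_def sum_2 pPhi using divG[of x] by (simp add: add_divide_distrib[symmetric] mult.commute)
  have sub: "{x. \<Phi> x \<noteq> 0} \<subseteq> cbox (pt (1/8) (1/8)) (pt (7/8) (7/8))"
    using Gs by (auto simp: \<Phi>_def)
  then have cl: "closure {x. \<Phi> x \<noteq> 0} \<subseteq> cbox (pt (1/8) (1/8)) (pt (7/8) (7/8))"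
    by (rule closure_minimal) (rule closed_cbox)
  have "compactly_supported_in (interior unit_square) \<Phi>"
    unfolding compactly_supported_in_def interior_unit_square
  proof
    show "compact (closure {x. \<Phi> x \<noteq> 0})"
      using cl bounded_subset[OF bounded_cbox cl] by (simp add: compact_eq_bounded_closed)
    show "closure {x. \<Phi> x \<noteq> 0} \<subseteq> box 0 1" using cl by (force simp: cbox_real2 box_real2)
  qed
  moreover have "norm (\<Phi> x) \<le> 1" for x using Gb[of x] False by (simp add: \<Phi>_def)
  ultimately have "ennreal (LINT x:box 0 1|lebesgue. u x * divergence \<Phi> x) \<le> total_variation (interior unit_square) u"
    using C1 unfolding total_variation_def interior_unit_square by (intro SUP_upper) auto
  with TV have "ennreal (LINT x:box 0 1|lebesgue. u x * divergence \<Phi> x) \<le> ennreal T" by (rule order_trans[rotated])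
  then have "(LINT x:box 0 1|lebesgue. u x * divergence \<Phi> x) \<le> T" using T by (simp add: ennreal_le_iff)
  also have "(LINT x:box 0 1|lebesgue. u x * divergence \<Phi> x) = (LINT x:box 0 1|lebesgue. u x * (\<sigma> (x + z) - \<sigma> x)) / norm z"
    unfolding div by (simp add: set_lebesgue_integral_def)
  finally show ?thesis using False by (simp add: field_simps)
qed (use T in \<open>simp add: set_lebesgue_integral_def\<close>)

text \<open>The supremum bounds integrals from above only; the other sign comes from
  \<open>-\<sigma>\<close>.\<close>

lemma translation_bound:
  fixes \<sigma> :: "real^2 \<Rightarrow> real"
  assumes \<sigma>: "C_diff 1 \<sigma>" "\<And>x. \<bar>\<sigma> x\<bar> \<le> 1" "\<And>x. \<sigma> x \<noteq> 0 \<Longrightarrow> x \<in> inner_square"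
    and z: "\<bar>z $ 1\<bar> \<le> 1/8" "\<bar>z $ 2\<bar> \<le> 1/8"
    and TV: "total_variation (interior unit_square) u \<le> ennreal T" and T: "0 \<le> T"
  shows "\<bar>LINT x:box 0 1|lebesgue. u x * (\<sigma> (x + z) - \<sigma> x)\<bar> \<le> norm z * T"
proof -
  have "C_diff 1 (\<lambda>x. (-1) * \<sigma> x)" by (intro C_diff_1_mult C_diff_1_const \<sigma>)
  then have "(LINT x:box 0 1|lebesgue. u x * ((-1) * \<sigma> (x + z) - (-1) * \<sigma> x)) \<le> norm z * T"
    by (rule translation_upper_bound[OF _ _ _ z TV T]) (use \<sigma> in auto)
  also have "(LINT x:box 0 1|lebesgue. u x * ((-1) * \<sigma> (x + z) - (-1) * \<sigma> x)) = 
     (LINT x:box 0 1|lebesgue. - (u x * (\<sigma> (x + z) - \<sigma> x)))"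
     by (simp add: algebra_simps)
  also have "\<dots> = - (LINT x:box 0 1|lebesgue. u x * (\<sigma> (x + z) - \<sigma> x))"
     by (simp add: set_lebesgue_integral_def)
  finally show ?thesis using translation_upper_bound[OF assms] by simp
qed

section \<open>Approximating the sign of a phase\<close>

lemma measure_cbox_real2:
  assumes "a $ 1 \<le> b $ 1" "a $ 2 \<le> (b::real^2) $ 2"
  shows "emeasure lborel (cbox a b) = ennreal ((b$1 - a$1) * (b$2 - a$2))"
    "measure lborel (cbox a b) = (b$1 - a$1) * (b$2 - a$2)"
proof -
  show 1: "emeasure lborel (cbox a b) = ennreal ((b$1 - a$1) * (b$2 - a$2))"
  proof (subst emeasure_lborel_cbox)
    show "a \<bullet> i \<le> b \<bullet> i" if "i \<in> Basis" for i
      using that assms by (auto simp: Basis_real2 inner_axis)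
    show "ennreal (\<Prod>i\<in>Basis. (b - a) \<bullet> i) = ennreal ((b$1 - a$1) * (b$2 - a$2))"
      unfolding prod_Basis_real2 by (simp add: inner_axis)
  qed
  show "measure lborel (cbox a b) = (b$1 - a$1) * (b$2 - a$2)"
    unfolding measure_def 1 using assms by simp
qed

lemma inner_closed_measure:
  fixes S :: "(real^2) set"
  assumes "S \<in> sets borel" "e > 0" "S \<subseteq> P" "measure lborel P < \<infinity>" "P \<in> sets borel" "emeasure lborel P < \<infinity>"
  obtains K where "closed K" "K \<subseteq> S" "measure lborel S - e \<le> measure lborel K"
proof -
  have "S \<in> sets lebesgue" using assms(1) by simp
  then obtain K where K: "closed K" "K \<subseteq> S" "emeasure lebesgue (S - K) < ennreal e"
    using sets_lebesgue_inner_closed[OF _ assms(2)] by metis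
  have Kb: "K \<in> sets borel" using K(1) by (rule borel_closed)
  have fin: "emeasure lborel A < \<infinity>" if "A \<subseteq> S" for A
    using le_less_trans[OF emeasure_mono[of A P lborel]] that assms(3,5,6) by auto
  have "emeasure lborel (S - K) < ennreal e" using K(3) assms(1) Kb by (simp add: emeasure_completion)
  then have "measure lborel (S - K) \<le> e"
    using assms(2) by (simp add: measure_def enn2real_leI order_less_imp_le)
  moreover have "measure lborel (S - K) = measure lborel S - measure lborel K"
    using fin[of S] fin[of K] K(2) assms(1) Kb by (intro measure_Diff) auto
  ultimately show ?thesis using K that by force
qed

text \<open>Inner regularity gives closed sets \<open>K\<close> and \<open>L\<close> inside
  \<open>U\<close> and its complement. An Urysohn function equal to -1 and 1 there is approximated
  by a polynomial and cut off, so a C^1 test function replaces the sign of the phase at a fixed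
  loss.\<close>

lemma smooth_sign_approximation:
  fixes U :: "(real^2) set"
  assumes U [measurable]: "U \<in> sets borel"
  shows "\<exists>\<sigma>. C_diff 1 \<sigma> \<and> (\<forall>x. \<bar>\<sigma> x\<bar> \<le> 1) \<and> (\<forall>x. \<sigma> x \<noteq> 0 \<longrightarrow> x \<in> inner_square) \<and>
    1/8 \<le> (LINT x|lborel. (indicator unit_square x * (if x \<in> U then -1 else 1)) * \<sigma> x)"
proof -
  let ?Q = "cbox (pt (26/100) (26/100)) (pt (74/100) (74/100))"
  have fQ: "emeasure lborel ?Q < \<infinity>" using measure_cbox_real2(1)[of "pt (26/100) (26/100)" "pt (74/100) (74/100)"] by simp
  have fI: "emeasure lborel inner_square < \<infinity>" using measure_cbox_real2(1)[of "pt (1/4) (1/4)" "pt (3/4) (3/4)"] by simp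
  obtain K where K: "closed K" "K \<subseteq> ?Q \<inter> U" "measure lborel (?Q \<inter> U) - 1/100 \<le> measure lborel K"
    by (rule inner_closed_measure[of "?Q \<inter> U" "1/100" ?Q]) (use fQ in \<open>auto simp: measure_def\<close>)
  obtain L where L: "closed L" "L \<subseteq> ?Q - U" "measure lborel (?Q - U) - 1/100 \<le> measure lborel L"
    by (rule inner_closed_measure[of "?Q - U" "1/100" ?Q]) (use fQ in \<open>auto simp: measure_def\<close>)
  have KLb [measurable]: "K \<in> sets borel" "L \<in> sets borel" using K(1) L(1) borel_closed by auto
  have disj: "K \<inter> L = {}" using K(2) L(2) by auto
  have finKL: "emeasure lborel K < \<infinity>" "emeasure lborel L < \<infinity>" "emeasure lborel (?Q \<inter> U) < \<infinity>" "emeasure lborel (?Q - U) < \<infinity>"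
    by (rule le_less_trans[OF emeasure_mono[of _ ?Q lborel] fQ]; use K(2) L(2) in auto)+
  have "measure lborel (?Q \<inter> U) + measure lborel (?Q - U) = measure lborel ?Q"
    using finKL by (subst measure_Union[symmetric]) (auto intro!: arg_cong[where f="measure lborel"])
  moreover have "measure lborel ?Q = 2304/10000" by (subst measure_cbox_real2) auto
  moreover have "measure lborel (K \<union> L) = measure lborel K + measure lborel L"
    using finKL disj by (intro measure_Union) auto
  ultimately have mKL: "measure lborel (K \<union> L) \<ge> 2104/10000" using K(3) L(3) by linarith
  obtain \<tau> :: "real^2 \<Rightarrow> real" where \<tau>: "continuous_on UNIV \<tau>" "\<And>x. \<tau> x \<in> closed_segment (-1) 1"
    "\<And>x. \<tau> x = -1 \<longleftrightarrow> x \<in> K" "\<And>x. \<tau> x = 1 \<longleftrightarrow> x \<in> L"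
    by (rule Urysohn_strong[OF K(1) L(1) disj, of "-1::real" 1]) auto
  have \<tau>b: "\<bar>\<tau> x\<bar> \<le> 1" for x using \<tau>(2)[of x] by (auto simp: closed_segment_eq_real_ivl abs_le_iff)
  have "continuous_on inner_square \<tau>" using \<tau>(1) continuous_on_subset by blast
  then obtain g where g: "real_polynomial_function g" "\<And>x. x \<in> inner_square \<Longrightarrow> \<bar>\<tau> x - g x\<bar> < 1/100"
    using Stone_Weierstrass_real_polynomial_function[OF compact_cbox _, of _ _ \<tau> "1/100"] by (metis zero_less_divide_1_iff zero_less_numeral)
  define e where "e = (\<lambda>s::real. sstep (100 * s + (-25)) * sstep ((-100) * s + 75))"
  have es: "smooth1 e" unfolding e_def by (intro smooth1_mult smooth1_affine smooth1_sstep)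
  have e1: "e s = 1" if "26/100 \<le> s" "s \<le> 74/100" for s using that by (simp add: e_def sstep_1)
  have e0: "1/4 \<le> s \<and> s \<le> 3/4" if "e s \<noteq> 0" for s
    using that sstep_0[of "100 * s + (-25)"] sstep_0[of "(-100) * s + 75"] by (fastforce simp: e_def)
  have eb: "0 \<le> e s" "e s \<le> 1" for s unfolding e_def
    using sstep_bounds by (auto intro!: mult_le_one mult_nonneg_nonneg)
  define \<eta> where "\<eta> = (\<lambda>x::real^2. e (x $ 1) * e (x $ 2))"
  have \<eta>b: "0 \<le> \<eta> x" "\<eta> x \<le> 1" for x unfolding \<eta>_def using eb by (auto intro!: mult_le_one mult_nonneg_nonneg)
  have \<eta>0: "x \<in> inner_square" if "\<eta> x \<noteq> 0" for x using that e0[of "x$1"] e0[of "x$2"] by (auto simp: \<eta>_def cbox_real2)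
  have \<eta>1: "\<eta> x = 1" if "x \<in> ?Q" for x using that e1[of "x$1"] e1[of "x$2"] by (auto simp: \<eta>_def cbox_real2)
  \<comment> \<open>On the inner square |g| <= 101/100, so this factor restores the bound 1.\<close>
  define \<sigma> where "\<sigma> = (\<lambda>x. (100/101) * (\<eta> x * g x))"
  have \<eta>C: "C_diff 1 \<eta>" unfolding \<eta>_def using es by (intro C_diff_product) (auto simp: smooth1_def simp del: One_nat_def)
  have \<sigma>C: "C_diff 1 \<sigma>" unfolding \<sigma>_def by (intro C_diff_1_mult C_diff_1_const \<eta>C C_diff_1_polynomial g)
  have \<sigma>0: "x \<in> inner_square" if "\<sigma> x \<noteq> 0" for x using that \<eta>0[of x] by (auto simp: \<sigma>_def)
  have \<sigma>1: "\<bar>\<sigma> x\<bar> \<le> 1" for x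
  proof (cases "x \<in> inner_square")
    case True
    have "\<bar>g x\<bar> \<le> 101/100" using g(2)[OF True] \<tau>b[of x] by linarith
    then have "\<bar>\<eta> x\<bar> * \<bar>g x\<bar> \<le> 1 * (101/100)" using \<eta>b[of x] by (intro mult_mono) auto
    then show ?thesis by (simp add: \<sigma>_def abs_mult)
  qed (use \<sigma>0 in force)
  let ?s = "\<lambda>x::real^2. indicator unit_square x * (if x \<in> U then -1 else 1::real)"
  have sm [measurable]: "?s \<in> borel_measurable borel" by measurable
  have \<sigma>m [measurable]: "\<sigma> \<in> borel_measurable borel" using C_diff_1_cont[OF \<sigma>C] by (rule borel_measurable_continuous_onI)
  have i: "integrable lborel (\<lambda>x. ?s x * \<sigma> x)"
  proof (rule integrableI_bounded_set[of inner_square _ _ 1])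
    show "AE x in lborel. x \<in> inner_square \<longrightarrow> norm (?s x * \<sigma> x) \<le> 1"
      using \<sigma>1 by (auto simp: indicator_def)
    show "AE x in lborel. x \<notin> inner_square \<longrightarrow> ?s x * \<sigma> x = 0" using \<sigma>0 by force
  qed (use fI in auto)
  \<comment> \<open>Pointwise minorant: on \<open>K \<union> L\<close> the product is at least
    99/101 >= 198/100 - 1, elsewhere it is at least -1 on the inner square and 0 outside. The
    integral is at least 198/100 * 2104/10000 - 1/4 > 1/8.\<close>
  have i2: "integrable lborel (\<lambda>x::real^2. (198/100) * indicator (K \<union> L) x - indicator inner_square x :: real)"
    using finKL fI emeasure_subadditive[of K lborel L]
    by (intro Bochner_Integration.integrable_diff integrable_mult_right integrable_real_indicator) (auto simp: le_less_trans)
  have "1/8 \<le> (198/100) * measure lborel (K \<union> L) - measure lborel inner_square"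
    using mKL by (subst measure_cbox_real2) auto
  also have "\<dots> = (LINT x|lborel. (198/100) * indicator (K \<union> L) x - indicator inner_square x)"
    using i2 finKL fI emeasure_subadditive[of K lborel L]
    by (subst Bochner_Integration.integral_diff) (auto simp: le_less_trans)
  also have "\<dots> \<le> (LINT x|lborel. ?s x * \<sigma> x)"
  proof (rule integral_mono[OF i2 i])
    fix x :: "real^2"
    have sub: "?Q \<subseteq> inner_square" "?Q \<subseteq> unit_square" "inner_square \<subseteq> unit_square" by (auto simp: cbox_real2)
    show "(198/100) * indicator (K \<union> L) x - indicator inner_square x \<le> ?s x * \<sigma> x"
    proof (cases "x \<in> K \<union> L")
      case True
      then have x: "x \<in> ?Q" using K(2) L(2) by auto
      have eq: "\<sigma> x = (100/101) * g x" using \<eta>1[OF x] by (simp add: \<sigma>_def)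
      have gx: "\<bar>\<tau> x - g x\<bar> < 1/100" using g(2) x sub by auto
      have xx: "x \<in> inner_square" "x \<in> unit_square" using x sub by auto
      from True show ?thesis
      proof
        assume "x \<in> K"
        then have "x \<in> U" "\<tau> x = -1" using K(2) \<tau>(3) by auto
        then show ?thesis using xx gx \<open>x \<in> K\<close> by (simp add: eq abs_if split: if_splits)
      next
        assume "x \<in> L"
        then have "x \<notin> U" "\<tau> x = 1" using L(2) \<tau>(4) by auto
        then show ?thesis using xx gx \<open>x \<in> L\<close> by (simp add: eq abs_if split: if_splits)
      qed
    next
      case False
      have "\<bar>?s x * \<sigma> x\<bar> \<le> indicator inner_square x"
        using \<sigma>1[of x] \<sigma>0[of x] by (auto simp: indicator_def)
      then show ?thesis using False by (simp add: abs_le_iff)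
    qed
  qed
  finally show ?thesis using \<sigma>C \<sigma>1 \<sigma>0 by (intro exI[of _ \<sigma>]) auto
qed

lemma AE_cbox_box: "AE x in lebesgue. x \<in> cbox a b \<longleftrightarrow> x \<in> box a (b::real^2)"
proof -
  have "negligible (cbox a b - box a b)" by (rule negligible_frontier_interval)
  then have "AE x in lebesgue. x \<notin> cbox a b - box a b"
    by (intro AE_not_in) (simp add: negligible_iff_null_sets)
  then show ?thesis by eventually_elim (use box_subset_cbox in blast)
qed

lemma phase_rep:
  assumes "u \<in> BV_phase"
  obtains U where "U \<in> sets borel" "AE x in lebesgue. x \<in> unit_square \<longrightarrow> u x = indicator U x"
proof -
  have u: "integrable lebesgue (\<lambda>x. indicator unit_square x *\<^sub>R u x)" "\<And>x. x \<in> unit_square \<Longrightarrow> u x \<in> {0, 1}"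
    using assms by (auto simp: BV_phase_def set_integrable_def)
  obtain u0 :: "real^2 \<Rightarrow> real" where u0: "u0 \<in> borel_measurable lborel" "AE x in lborel. indicator unit_square x *\<^sub>R u x = u0 x"
    using completion_ex_borel_measurable_real[OF borel_measurable_integrable[OF u(1)]] by blast
  define U where "U = {x. u0 x = 1}"
  have "U \<in> sets borel" using u0(1) unfolding U_def by measurable
  moreover have "AE x in lebesgue. x \<in> unit_square \<longrightarrow> u x = indicator U x"
    using AE_completion[OF u0(2)] by eventually_elim (use u(2) in \<open>fastforce simp: U_def indicator_def\<close>)
  ultimately show ?thesis by (rule that)
qed

section \<open>Elastic and interfacial bounds in terms of the phase\<close>

lemma lborel_reflect_integral:
  fixes F :: "real^2 \<Rightarrow> real"
  assumes [measurable]: "F \<in> borel_measurable borel"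
  shows "(LINT y|lborel. F y) = (LINT z|lborel. F (x - z))"
proof -
  have eq: "(lborel :: (real^2) measure) = distr lborel borel (\<lambda>z. x + (-1) *\<^sub>R z)"
    using lborel_affine[of "-1" x] by (simp add: density_1)
  show ?thesis by (subst eq, subst integral_distr) auto
qed

lemma lborel_translate_integral:
  fixes F :: "real^2 \<Rightarrow> real"
  assumes [measurable]: "F \<in> borel_measurable borel"
  shows "(LINT x|lborel. F (x - z)) = (LINT x|lborel. F x)"
proof -
  have eq: "(lborel :: (real^2) measure) = distr lborel borel (\<lambda>x. (-z) + 1 *\<^sub>R x)"
    using lborel_affine[of "1" "-z"] by (simp add: density_1)
  have "(LINT x|lborel. F x) = (LINT x|lborel. F ((-z) + 1 *\<^sub>R x))"
    by (subst eq, subst integral_distr) auto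
  then show ?thesis by simp
qed

text \<open>Cauchy-Schwarz on a set of measure one, obtained by integrating |g| <= t/2 + g^2/(2
  t).\<close>

lemma L1_from_L2:
  fixes g :: "real^2 \<Rightarrow> real"
  assumes g: "integrable lborel g" and t: "t > 0" and sup: "\<And>x. x \<notin> unit_square \<Longrightarrow> g x = 0"
    and G: "(\<integral>\<^sup>+x. ennreal (G x) * indicator unit_square x \<partial>lborel) \<le> ennreal (t\<^sup>2)"
    and le: "\<And>x. x \<in> unit_square \<Longrightarrow> (g x)\<^sup>2 \<le> G x" and [measurable]: "G \<in> borel_measurable borel"
  shows "(LINT x|lborel. \<bar>g x\<bar>) \<le> t"
proof -
  have sq1: "emeasure lborel unit_square = 1"
    using measure_cbox_real2(1)[of "0::real^2" 1] by simp
  have "ennreal \<bar>g x\<bar> \<le> ennreal (t/2) * indicator unit_square x + ennreal (1/(2*t)) * (ennreal (G x) * indicator unit_square x)" for x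
  proof (cases "x \<in> unit_square")
    case True
    have "0 \<le> (\<bar>g x\<bar> - t)\<^sup>2" by simp
    then have "2 * t * \<bar>g x\<bar> \<le> t * t + G x"
      using le[OF True] by (simp add: power2_eq_square algebra_simps)
    then have "\<bar>g x\<bar> \<le> t/2 + 1/(2*t) * G x" using t by (simp add: field_simps)
    moreover have "0 \<le> G x" using le[OF True] by (meson order_trans zero_le_power2)
    ultimately have "ennreal \<bar>g x\<bar> \<le> ennreal (t/2) + ennreal (1/(2*t)) * ennreal (G x)"
      using t by (subst ennreal_mult[symmetric]; simp)+ (simp add: ennreal_plus[symmetric] ennreal_leI del: ennreal_plus)
    then show ?thesis using True by simp
  qed (simp add: sup)
  then have "(\<integral>\<^sup>+x. ennreal \<bar>g x\<bar> \<partial>lborel) \<le> 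
     (\<integral>\<^sup>+x. ennreal (t/2) * indicator unit_square x + ennreal (1/(2*t)) * (ennreal (G x) * indicator unit_square x) \<partial>lborel)"
    by (intro nn_integral_mono)
  also have "\<dots> = ennreal (t/2) * emeasure lborel unit_square + ennreal (1/(2*t)) * (\<integral>\<^sup>+x. ennreal (G x) * indicator unit_square x \<partial>lborel)"
    by (simp add: nn_integral_add nn_integral_cmult nn_integral_cmult_indicator)
  also have "\<dots> \<le> ennreal (t/2) + ennreal (1/(2*t)) * ennreal (t\<^sup>2)"
    using G by (auto simp: sq1 intro!: add_mono mult_left_mono)
  also have "\<dots> = ennreal t"
    using t by (simp add: ennreal_mult[symmetric] ennreal_plus[symmetric] power2_eq_square del: ennreal_plus)
  finally have "ennreal (LINT x|lborel. \<bar>g x\<bar>) \<le> ennreal t"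
    using g by (subst (asm) nn_integral_eq_integral) auto
  then show ?thesis using t by (simp add: ennreal_le_iff)
qed

text \<open>Almost everywhere on the square the energy density is p^2 + 2 q^2 + (\<alpha> s - r)^2
  with s = 1 - 2 \<chi>, and it dominates each of the three squares.\<close>

lemma elastic_defect_bound:
  assumes w: "w \<in> D_curl_curl (mat 1)" and rep: "defect_rep w p q r"
    and U [measurable]: "U \<in> sets borel" and uU: "AE x in lebesgue. x \<in> unit_square \<longrightarrow> u x = indicator U x"
    and t: "t > 0" 
    and E: "(\<integral>\<^sup>+x\<in>unit_square. ennreal ((norm (w x -
         vector [vector [1, 0], vector [0, 1 + \<alpha> * (1 - 2 * u x)]]))\<^sup>2) \<partial>lebesgue) \<le> ennreal (t\<^sup>2)"
  defines "s \<equiv> \<lambda>x::real^2. indicator unit_square x * (if x \<in> U then -1 else 1::real)"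
  shows "(LINT x|lborel. \<bar>p x\<bar>) \<le> t" "(LINT x|lborel. \<bar>q x\<bar>) \<le> t" "(LINT x|lborel. \<bar>\<alpha> * s x - r x\<bar>) \<le> t"
    "integrable lborel s"
proof -
  have i: "integrable lborel p" "integrable lborel q" "integrable lborel r" 
     and z: "\<And>x. x \<notin> unit_square \<Longrightarrow> p x = 0" "\<And>x. x \<notin> unit_square \<Longrightarrow> q x = 0" "\<And>x. x \<notin> unit_square \<Longrightarrow> r x = 0"
     and ae: "AE x in lborel. w x = mat2 (1 + p x) (q x) (1 + r x)"
    using rep by (auto simp: defect_rep_def)
  note [measurable] = i[THEN borel_measurable_integrable, simplified]
  have [measurable]: "s \<in> borel_measurable borel" unfolding s_def by measurable
  show si: "integrable lborel s"
  proof (rule integrableI_bounded_set[of unit_square _ _ 1])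
    show "emeasure lborel unit_square < \<infinity>" using measure_cbox_real2(1)[of "0::real^2" 1] by simp
  qed (auto simp: s_def)
  define G where "G = (\<lambda>x. (p x)\<^sup>2 + (q x)\<^sup>2 + (q x)\<^sup>2 + (\<alpha> * s x - r x)\<^sup>2)"
  have [measurable]: "G \<in> borel_measurable borel" unfolding G_def by measurable
  have "(\<integral>\<^sup>+x. ennreal (G x) * indicator unit_square x \<partial>lborel) = (\<integral>\<^sup>+x. ennreal (G x) * indicator unit_square x \<partial>lebesgue)"
    by (simp add: nn_integral_completion)
  also have "\<dots> = (\<integral>\<^sup>+x\<in>unit_square. ennreal ((norm (w x -
         vector [vector [1, 0], vector [0, 1 + \<alpha> * (1 - 2 * u x)]]))\<^sup>2) \<partial>lebesgue)"
  proof (rule nn_integral_cong_AE)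
    show "AE x in lebesgue. ennreal (G x) * indicator unit_square x = ennreal ((norm (w x -
         vector [vector [1, 0], vector [0, 1 + \<alpha> * (1 - 2 * u x)]]))\<^sup>2) * indicator unit_square x"
      using AE_completion[OF ae] uU
    proof eventually_elim
      case (elim x)
      show ?case
      proof (cases "x \<in> unit_square")
        case True
        then have ux: "u x = indicator U x" using elim by auto
        have "(\<alpha> * s x - r x)\<^sup>2 = (1 + r x - (1 + \<alpha> * (1 - 2 * u x)))\<^sup>2"
          using True by (cases "x \<in> U") (simp_all add: ux s_def power2_eq_square algebra_simps)
        then show ?thesis unfolding elim(1) norm_mat22 G_def by simp
      qed simp
    qed
  qed
  finally have Gt: "(\<integral>\<^sup>+x. ennreal (G x) * indicator unit_square x \<partial>lborel) \<le> ennreal (t\<^sup>2)" using E by simp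
  show "(LINT x|lborel. \<bar>p x\<bar>) \<le> t" 
    by (rule L1_from_L2[OF i(1) t z(1) Gt]) (auto simp: G_def)
  show "(LINT x|lborel. \<bar>q x\<bar>) \<le> t" 
    by (rule L1_from_L2[OF i(2) t z(2) Gt]) (auto simp: G_def)
  show "(LINT x|lborel. \<bar>\<alpha> * s x - r x\<bar>) \<le> t"
    by (rule L1_from_L2[OF _ t _ Gt]) (use i si z in \<open>auto simp: G_def s_def\<close>)
qed

lemma measurable_pair_diff: 
  fixes F :: "real^2 \<Rightarrow> real^2 \<Rightarrow> real"
  assumes "continuous_on UNIV (\<lambda>p. F (fst p) (snd p))"
  shows "(\<lambda>p. F (fst p) (snd p)) \<in> borel_measurable (borel \<Otimes>\<^sub>M borel)"
  unfolding borel_prod using assms by (rule borel_measurable_continuous_onI)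

lemma kern_d_cont: "continuous_on S f \<Longrightarrow> continuous_on S (\<lambda>x. kern_d n (f x))"
  by (rule continuous_on_compose2[OF smooth1_continuous[OF smooth1_kern_d, of UNIV]]) auto

lemma rho_cont: "h > 0 \<Longrightarrow> continuous_on S f \<Longrightarrow> continuous_on S (\<lambda>x. rho h (f x))"
  unfolding rho_def by (intro continuous_intros kern_d_cont) auto

lemma rho_bound:
  assumes M: "1 \<le> M" "\<forall>n\<in>{1..4}. \<forall>t. \<bar>kern_d n t\<bar> \<le> M" and h: "h > 0"
  shows "\<bar>rho h z\<bar> \<le> M\<^sup>2 / h\<^sup>2 * indicator (cbox (pt (-h) (-h)) (pt h h)) z"
proof (cases "z \<in> cbox (pt (-h) (-h)) (pt h h)")
  case True
  have "\<bar>rho h z\<bar> \<le> M / h * (M / h)"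
    unfolding rho_def abs_mult using h M by (intro mult_mono) (auto simp: divide_right_mono)
  then show ?thesis using True by (simp add: power2_eq_square)
next
  case False
  then have "\<bar>z$1\<bar> \<ge> h \<or> \<bar>z$2\<bar> \<ge> h" by (auto simp: cbox_real2)
  then have "\<bar>z$1/h\<bar> \<ge> 1 \<or> \<bar>z$2/h\<bar> \<ge> 1" using h by auto
  then have "rho h z = 0" unfolding rho_def using kern_d_2_supp[of _ 0, folded numeral_2_eq_2] by auto
  then show ?thesis using False by simp
qed

text \<open>The increment of \<open>\<sigma>\<close> has integral zero, so in s = 1 - 2 \<chi> the
  constant drops out and the factor 2 remains; the rest is \<open>translation_bound\<close> with
  \<open>-z\<close>.\<close>

lemma phase_oscillation_bound:
  assumes \<sigma>: "C_diff 1 \<sigma>" "\<And>x. \<bar>\<sigma> x\<bar> \<le> 1" "\<And>x. \<sigma> x \<noteq> 0 \<Longrightarrow> x \<in> inner_square"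
    and z: "\<bar>z $ 1\<bar> \<le> 1/8" "\<bar>z $ 2\<bar> \<le> 1/8"
    and TV: "total_variation (interior unit_square) u \<le> ennreal T" and T: "0 \<le> T"
    and U [measurable]: "U \<in> sets borel" and uU: "AE x in lebesgue. x \<in> unit_square \<longrightarrow> u x = indicator U x"
  defines "s \<equiv> \<lambda>x::real^2. indicator unit_square x * (if x \<in> U then -1 else 1::real)"
  shows "\<bar>LINT x|lborel. s x * (\<sigma> x - \<sigma> (x - z))\<bar> \<le> 2 * norm z * T"
proof -
  have c: "continuous_on UNIV \<sigma>" by (rule C_diff_1_cont[OF \<sigma>(1)])
  have [measurable]: "\<sigma> \<in> borel_measurable borel" using c by (rule borel_measurable_continuous_onI)
  have fI: "emeasure lborel unit_square < \<infinity>" using measure_cbox_real2(1)[of "0::real^2" 1] by simp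
  define d where "d = (\<lambda>x. \<sigma> x - \<sigma> (x - z))"
  have [measurable]: "d \<in> borel_measurable borel" unfolding d_def by measurable
  have sub: "x \<in> unit_square" "x - z \<in> inner_square \<longrightarrow> x \<in> unit_square" if "x \<in> inner_square" for x
    using that z by (auto simp: cbox_real2 abs_le_iff)
  have sub2: "x \<in> unit_square" if "x - z \<in> inner_square" for x
    using that z by (auto simp: cbox_real2 abs_le_iff)
  have i\<sigma>: "integrable lborel \<sigma>"
  proof (rule integrableI_bounded_set[of unit_square _ _ 1])
    show "AE x in lborel. x \<notin> unit_square \<longrightarrow> \<sigma> x = 0" using \<sigma>(3) sub by blast
  qed (use \<sigma> fI in auto)
  have i\<sigma>': "integrable lborel (\<lambda>x. \<sigma> (x - z))"
  proof (rule integrableI_bounded_set[of unit_square _ _ 1])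
    show "AE x in lborel. x \<notin> unit_square \<longrightarrow> \<sigma> (x - z) = 0" using \<sigma>(3) sub2 by blast
  qed (use \<sigma> fI in auto)
  have int_d: "(LINT x|lborel. d x) = 0"
    unfolding d_def using i\<sigma> i\<sigma>' lborel_translate_integral[of \<sigma> z] by simp
  have id: "integrable lborel d" unfolding d_def using i\<sigma> i\<sigma>' by simp
  have iU: "integrable lborel (\<lambda>x. d x * indicator U x)"
    by (rule integrable_mult_bounded[OF id, of _ 1]) (auto simp: indicator_def)
  have d0: "d x = 0" if "x \<notin> unit_square" for x
  proof -
    have "\<sigma> x = 0" using that \<sigma>(3)[of x] sub(1)[of x] by blast
    moreover have "\<sigma> (x - z) = 0" using that \<sigma>(3)[of "x - z"] sub2[of x] by blast
    ultimately show ?thesis by (simp add: d_def)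
  qed
  have "(LINT x|lborel. s x * d x) = (LINT x|lborel. d x - 2 * (d x * indicator U x))"
    by (intro Bochner_Integration.integral_cong) (auto simp: s_def indicator_def d0)
  also have "\<dots> = - 2 * (LINT x|lborel. d x * indicator U x)"
    using id iU int_d by simp
  also have "(LINT x|lborel. d x * indicator U x) = (LINT x|lebesgue. d x * indicator U x)"
    by (rule integral_lebesgue_lborel[symmetric]) measurable
  also have "\<dots> = (LINT x|lebesgue. indicator (box 0 1) x *\<^sub>R (u x * d x))"
  proof (rule integral_cong_AE)
    show m1: "(\<lambda>x. d x * indicator U x) \<in> borel_measurable lebesgue"
      by (intro measurable_completion) measurable
    show ae: "AE x in lebesgue. d x * indicator U x = indicator (box 0 1) x *\<^sub>R (u x * d x)"
      using uU AE_cbox_box[of 0 1]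
      by eventually_elim (auto simp: indicator_def d0)
    show "(\<lambda>x. indicator (box 0 1) x *\<^sub>R (u x * d x)) \<in> borel_measurable lebesgue"
      by (rule borel_measurable_AE[OF m1 ae])
  qed
  also have "\<dots> = - (LINT x:box 0 1|lebesgue. u x * (\<sigma> (x + (-z)) - \<sigma> x))"
    unfolding set_lebesgue_integral_def
    by (subst Bochner_Integration.integral_minus[symmetric], rule Bochner_Integration.integral_cong)
       (auto simp: d_def algebra_simps)
  finally have "\<bar>LINT x|lborel. s x * d x\<bar> = 2 * \<bar>LINT x:box 0 1|lebesgue. u x * (\<sigma> (x + (-z)) - \<sigma> x)\<bar>" by simp
  also have "\<dots> \<le> 2 * (norm (-z) * T)"
    using translation_bound[OF \<sigma> _ _ TV T, of "-z"] z by simp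
  finally show ?thesis by (simp add: d_def)
qed

section \<open>The lower bound\<close>

text \<open>Tested with a smooth approximation \<open>\<sigma>\<close> of its sign, the phase \<open>s\<close> splits into the oscillation
  \<open>s (\<sigma> - S)\<close> below scale \<open>h\<close>, the elastic error \<open>(\<alpha> s - r) S\<close> and the mollified defect \<open>r S\<close>,
  where \<open>S\<close> is the mollification of \<open>\<sigma>\<close>.\<close>

lemma lower_bound_core:
  assumes \<alpha>: "0 < \<alpha>" and M: "1 \<le> M" "\<forall>n\<in>{1..4}. \<forall>t. \<bar>kern_d n t\<bar> \<le> M"
    and h: "0 < h" "h \<le> 1/8"
    and u: "u \<in> BV_phase" and w: "w \<in> D_curl_curl (mat 1)"
    and TV: "total_variation (interior unit_square) u \<le> ennreal T" and T: "0 \<le> T"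
    and t: "t > 0" 
    and E: "(\<integral>\<^sup>+x\<in>unit_square. ennreal ((norm (w x -
         vector [vector [1, 0], vector [0, 1 + \<alpha> * (1 - 2 * u x)]]))\<^sup>2) \<partial>lebesgue) \<le> ennreal (t\<^sup>2)"
  shows "\<alpha> / 8 \<le> 16 * M\<^sup>2 * \<alpha> * (h * T) + 10 * M\<^sup>2 * (t / h\<^sup>2)"
proof -
  obtain U where U [measurable]: "U \<in> sets borel" and uU: "AE x in lebesgue. x \<in> unit_square \<longrightarrow> u x = indicator U x"
    using phase_rep[OF u] by blast
  obtain p q r where rep: "defect_rep w p q r" using defect_rep_exists[OF w] by blast
  define s where "s = (\<lambda>x::real^2. indicator unit_square x * (if x \<in> U then -1 else 1::real))"
  have [measurable]: "s \<in> borel_measurable borel" unfolding s_def by measurable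
  have b: "(LINT x|lborel. \<bar>p x\<bar>) \<le> t" "(LINT x|lborel. \<bar>q x\<bar>) \<le> t" "(LINT x|lborel. \<bar>\<alpha> * s x - r x\<bar>) \<le> t"
    "integrable lborel s"
    unfolding s_def using elastic_defect_bound[OF w rep U uU t E] by auto
  have i: "integrable lborel p" "integrable lborel q" "integrable lborel r" 
     and z: "\<And>x. x \<notin> unit_square \<Longrightarrow> p x = 0" "\<And>x. x \<notin> unit_square \<Longrightarrow> q x = 0" "\<And>x. x \<notin> unit_square \<Longrightarrow> r x = 0"
    using rep by (auto simp: defect_rep_def)
  note [measurable] = i[THEN borel_measurable_integrable, simplified]
  obtain \<sigma> where \<sigma>': "C_diff 1 \<sigma>" "\<forall>x. \<bar>\<sigma> x\<bar> \<le> 1" "\<forall>x. \<sigma> x \<noteq> 0 \<longrightarrow> x \<in> inner_square"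
    and big: "1/8 \<le> (LINT x|lborel. s x * \<sigma> x)"
    using smooth_sign_approximation[OF U] unfolding s_def by (elim exE conjE)
  then have \<sigma>: "C_diff 1 \<sigma>" "\<And>x. \<bar>\<sigma> x\<bar> \<le> 1" "\<And>x. \<sigma> x \<noteq> 0 \<Longrightarrow> x \<in> inner_square" by blast+
  have \<sigma>c: "continuous_on UNIV \<sigma>" by (rule C_diff_1_cont[OF \<sigma>(1)])
  have [measurable]: "\<sigma> \<in> borel_measurable borel" using \<sigma>c by (rule borel_measurable_continuous_onI)
  have \<sigma>cc: "continuous_on S f \<Longrightarrow> continuous_on S (\<lambda>x. \<sigma> (f x))" for S and f :: "'b::topological_space \<Rightarrow> _"
    by (rule continuous_on_compose2[OF \<sigma>c]) auto
  define S where "S = (\<lambda>x. LINT y|lborel. \<sigma> y * rho h (x - y))"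
  define m where "m = M\<^sup>2 / h\<^sup>2"
  have m0: "m \<ge> 0" "m * (4 * h\<^sup>2) = 4 * M\<^sup>2" using h by (auto simp: m_def field_simps)
  have rb: "\<bar>rho h z\<bar> \<le> m * indicator (cbox (pt (-h) (-h)) (pt h h)) z" for z
    unfolding m_def by (rule rho_bound[OF M h(1)])
  define A where "A = (\<lambda>x::real^2. cbox (pt (x$1 - h) (x$2 - h)) (pt (x$1 + h) (x$2 + h)))"
  have A: "A x \<in> sets borel" "emeasure lborel (A x) \<le> ennreal (4 * h\<^sup>2)" for x
    using h unfolding A_def by (auto simp: measure_cbox_real2 power2_eq_square)
  have Hm: "(\<lambda>p. \<sigma> (snd p) * rho h (fst p - snd p)) \<in> borel_measurable (borel \<Otimes>\<^sub>M borel)"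
    by (rule measurable_pair_diff[where F = "\<lambda>x y. \<sigma> y * rho h (x - y)"]) (intro continuous_intros rho_cont \<sigma>cc h)
  have Hb: "\<bar>\<sigma> y * rho h (x - y)\<bar> \<le> m * indicator (A x) y" for x y
  proof -
    have "\<bar>\<sigma> y\<bar> * \<bar>rho h (x - y)\<bar> \<le> 1 * (m * indicator (cbox (pt (-h) (-h)) (pt h h)) (x - y))"
      using \<sigma>(2) rb by (intro mult_mono) auto
    also have "indicator (cbox (pt (-h) (-h)) (pt h h)) (x - y) = (indicator (A x) y :: real)"
      by (auto simp: indicator_def A_def cbox_real2)
    finally show ?thesis by (simp add: abs_mult)
  qed
  have F1: "integrable lborel (\<lambda>x. g x * S x)" "(LINT y|lborel. LINT x|lborel. g x * (\<sigma> y * rho h (x - y))) = (LINT x|lborel. g x * S x)"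
    "\<bar>LINT x|lborel. g x * S x\<bar> \<le> 4 * M\<^sup>2 * (LINT x|lborel. \<bar>g x\<bar>)"
    if "integrable lborel g" for g :: "real^2 \<Rightarrow> real"
  proof -
    have c: "0 \<le> 4 * h\<^sup>2" by simp
    note K = kernel_Fubini[where A=A, OF that Hm A c m0(1) Hb]
    show "integrable lborel (\<lambda>x. g x * S x)" "(LINT y|lborel. LINT x|lborel. g x * (\<sigma> y * rho h (x - y))) = (LINT x|lborel. g x * S x)"
      using K(1,5) unfolding S_def by auto
    show "\<bar>LINT x|lborel. g x * S x\<bar> \<le> 4 * M\<^sup>2 * (LINT x|lborel. \<bar>g x\<bar>)"
      using K(1,3) unfolding S_def m0(2) by simp
  qed
  have i_s: "integrable lborel s" by (rule b(4))
  have is': "integrable lborel (\<lambda>x. \<alpha> * s x)" "integrable lborel (\<lambda>x. \<alpha> * s x - r x)" using i_s i by auto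
  have is\<sigma>: "integrable lborel (\<lambda>x. s x * \<sigma> x)"
    by (rule integrable_mult_bounded[OF i_s _ \<sigma>(2)]) simp

  \<comment> \<open>\<open>\<sigma> - S\<close> averages the increments of \<open>\<sigma>\<close>
    over shifts with |z_1|, |z_2| <= h, so |z| <= 2 h. The mollifier contributes at most M^2/h^2
    times the area 4 h^2, each increment at most 4 h T.\<close>
  have "\<bar>LINT x|lborel. s x * (\<sigma> x - S x)\<bar> \<le> 16 * M\<^sup>2 * (h * T)"
  proof -
    define H where "H = (\<lambda>x z. rho h z * (\<sigma> x - \<sigma> (x - z)))"
    define B where "B = cbox (pt (-h) (-h)) (pt h h)"
    have B: "B \<in> sets borel" "emeasure lborel B \<le> ennreal (4 * h\<^sup>2)" "measure lborel B = 4 * h\<^sup>2" "emeasure lborel B < \<infinity>"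
      using h unfolding B_def by (auto simp: measure_cbox_real2 power2_eq_square)
    have Hm': "(\<lambda>p. H (fst p) (snd p)) \<in> borel_measurable (borel \<Otimes>\<^sub>M borel)"
      unfolding H_def by (rule measurable_pair_diff[where F = "\<lambda>x z. rho h z * (\<sigma> x - \<sigma> (x - z))"]) (intro continuous_intros rho_cont \<sigma>cc h)
    have Hb': "\<bar>H x z\<bar> \<le> (m * 2) * indicator B z" for x z
    proof -
      have "\<bar>\<sigma> x - \<sigma> (x - z)\<bar> \<le> 2" using \<sigma>(2)[of x] \<sigma>(2)[of "x - z"] by linarith
      then have "\<bar>rho h z\<bar> * \<bar>\<sigma> x - \<sigma> (x - z)\<bar> \<le> (m * indicator B z) * 2"
        using rb m0 by (intro mult_mono) (auto simp: B_def)
      then show ?thesis by (simp add: H_def abs_mult mult_ac)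
    qed
    have HS: "(LINT z|lborel. H x z) = \<sigma> x - S x" for x
    proof -
      have i1: "integrable lborel (\<lambda>z. rho h z * \<sigma> (x - z))"
        by (rule integrable_mult_bounded[OF integral_rho(1)[OF h(1)] _ \<sigma>(2)]) simp
      have "(LINT z|lborel. H x z) = (LINT z|lborel. rho h z * \<sigma> x - rho h z * \<sigma> (x - z))"
        by (simp add: H_def right_diff_distrib)
      also have "\<dots> = \<sigma> x - (LINT z|lborel. rho h z * \<sigma> (x - z))"
        using i1 integral_rho[OF h(1)] by simp
      also have "(LINT z|lborel. rho h z * \<sigma> (x - z)) = S x"
        unfolding S_def by (subst lborel_reflect_integral[of _ x]) (auto simp: mult.commute)
      finally show ?thesis .
    qed
    note F = kernel_Fubini[OF i_s Hm', of "\<lambda>_. B" "4 * h\<^sup>2" "m * 2"]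
    have "(LINT x|lborel. s x * (\<sigma> x - S x)) = (LINT z|lborel. LINT x|lborel. s x * H x z)"
      using F(1) B m0 h Hb' by (simp add: HS)
    also have "\<bar>\<dots>\<bar> \<le> (LINT z|lborel. \<bar>LINT x|lborel. s x * H x z\<bar>)"
      by (rule integral_abs_bound)
    also have "\<dots> \<le> (LINT z|lborel. m * (4 * h * T) * indicator B z)"
    proof (rule integral_mono)
      show "integrable lborel (\<lambda>z. \<bar>LINT x|lborel. s x * H x z\<bar>)"
        using F(4) B m0 h Hb' by (intro integrable_abs) simp
      show "integrable lborel (\<lambda>z. m * (4 * h * T) * indicator B z :: real)"
        using B by (intro integrable_mult_right integrable_real_indicator) auto
      fix z
      show "\<bar>LINT x|lborel. s x * H x z\<bar> \<le> m * (4 * h * T) * indicator B z"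
      proof (cases "z \<in> B")
        case True
        then have z: "\<bar>z $ 1\<bar> \<le> h" "\<bar>z $ 2\<bar> \<le> h" by (auto simp: B_def cbox_real2 abs_le_iff)
        have "norm z \<le> \<bar>z $ 1\<bar> + \<bar>z $ 2\<bar>" using norm_le_l1_cart[of z] by (simp add: sum_2)
        then have nz: "norm z \<le> 2 * h" using z by linarith
        have "(LINT x|lborel. s x * H x z) = (LINT x|lborel. rho h z * (s x * (\<sigma> x - \<sigma> (x - z))))"
          by (intro Bochner_Integration.integral_cong) (auto simp: H_def)
        then have "\<bar>LINT x|lborel. s x * H x z\<bar> = \<bar>rho h z\<bar> * \<bar>LINT x|lborel. s x * (\<sigma> x - \<sigma> (x - z))\<bar>"
          by (simp add: abs_mult)
        also have "\<dots> \<le> m * (2 * norm z * T)"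
          unfolding s_def using z h rb[of z] True m0
          by (intro mult_mono phase_oscillation_bound[OF \<sigma> _ _ TV T U uU]) (auto simp: B_def)
        also have "\<dots> \<le> m * (2 * (2 * h) * T)"
          using nz T m0 by (intro mult_left_mono mult_right_mono) auto
        finally show ?thesis using True by simp
      next
        case False
        then have "H x z = 0" for x using Hb'[of x z] by simp
        then show ?thesis using False by simp
      qed
    qed
    also have "\<dots> = m * (4 * h * T) * (4 * h\<^sup>2)" using B by simp
    also have "\<dots> = (m * (4 * h\<^sup>2)) * (4 * (h * T))" by (simp only: mult_ac)
    also have "\<dots> = 16 * M\<^sup>2 * (h * T)" unfolding m0 by simp
    finally show ?thesis .
  qed
  then have part1: "\<alpha> * (LINT x|lborel. s x * (\<sigma> x - S x)) \<le> \<alpha> * (16 * M\<^sup>2 * (h * T))"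
    using \<alpha> by (intro mult_left_mono) auto

  \<comment> \<open>The kernels live on strips of area 2 h. Hence \<open>q\<close> costs h^-2 times
    h and \<open>p\<close> costs h^-3 times h: the entry (1,1) dictates the loss h^-2.\<close>
  have "\<bar>LINT x|lborel. r x * S x\<bar> \<le> 6 * M\<^sup>2 * (t / h\<^sup>2)"
  proof -
    define A2 where "A2 = (\<lambda>x::real^2. cbox (pt 0 (x$2 - h)) (pt 1 (x$2 + h)))"
    have A2: "A2 x \<in> sets borel" "emeasure lborel (A2 x) \<le> ennreal (2 * h)" for x
      using h unfolding A2_def by (auto simp: measure_cbox_real2)
    define H1 where "H1 = (\<lambda>x y. \<sigma> y * (2 * (kern_d 1 ((x - y) $ 1 / h) * kern_d 3 ((x - y) $ 2 / h) / h\<^sup>2)))"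
    define H2 where "H2 = (\<lambda>x y. \<sigma> y * (h * kern_d 0 ((x - y) $ 1 / h) * (kern_d 4 ((x - y) $ 2 / h) / h ^ 3)))"
    have H1m: "(\<lambda>p. H1 (fst p) (snd p)) \<in> borel_measurable (borel \<Otimes>\<^sub>M borel)"
      unfolding H1_def by (rule measurable_pair_diff[where F = "\<lambda>x y. \<sigma> y * (2 * (kern_d 1 ((x - y) $ 1 / h) * kern_d 3 ((x - y) $ 2 / h) / h\<^sup>2))"])
        (use h in \<open>auto intro!: continuous_intros kern_d_cont \<sigma>cc\<close>)
    have H2m: "(\<lambda>p. H2 (fst p) (snd p)) \<in> borel_measurable (borel \<Otimes>\<^sub>M borel)"
      unfolding H2_def by (rule measurable_pair_diff[where F = "\<lambda>x y. \<sigma> y * (h * kern_d 0 ((x - y) $ 1 / h) * (kern_d 4 ((x - y) $ 2 / h) / h ^ 3))"])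
        (use h in \<open>auto intro!: continuous_intros kern_d_cont \<sigma>cc\<close>)
    have out: "kern_d (Suc (Suc n)) ((x - y) $ 2 / h) = 0 \<or> \<sigma> y = 0" if "y \<notin> A2 x" for x y n
    proof (cases "\<sigma> y = 0")
      case False
      then have "y $ 1 \<in> {0..1}" using \<sigma>(3)[OF False] by (auto simp: cbox_real2)
      then have "\<bar>(x - y) $ 2\<bar> \<ge> h" using that by (auto simp: A2_def cbox_real2)
      then have "\<bar>(x - y) $ 2 / h\<bar> \<ge> 1" using h by simp
      then show ?thesis using kern_d_2_supp by blast
    qed simp
    have H1b: "\<bar>H1 x y\<bar> \<le> 2 * M\<^sup>2 / h\<^sup>2 * indicator (A2 x) y" for x y
    proof (cases "y \<in> A2 x")
      case True
      have "\<bar>kern_d 1 ((x - y) $ 1 / h)\<bar> * \<bar>kern_d 3 ((x - y) $ 2 / h)\<bar> \<le> M * M"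
        using M by (intro mult_mono) auto
      then have "\<bar>\<sigma> y\<bar> * (2 * (\<bar>kern_d 1 ((x - y) $ 1 / h)\<bar> * \<bar>kern_d 3 ((x - y) $ 2 / h)\<bar> / h\<^sup>2)) \<le> 1 * (2 * (M * M / h\<^sup>2))"
        using \<sigma>(2) M by (intro mult_mono[of "\<bar>\<sigma> y\<bar>"] mult_left_mono divide_right_mono) auto
      then show ?thesis using True by (simp add: H1_def abs_mult power2_eq_square)
    next
      case False then show ?thesis using out[OF False, of 1] by (auto simp: H1_def numeral_3_eq_3)
    qed
    have H2b: "\<bar>H2 x y\<bar> \<le> M / h ^ 3 * indicator (A2 x) y" if "p x \<noteq> 0" for x y
    proof (cases "y \<in> A2 x")
      case True
      have x: "x \<in> unit_square" using z(1)[of x] that by auto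
      have "\<bar>\<sigma> y * (h * kern_d 0 ((x - y) $ 1 / h))\<bar> \<le> 1"
      proof (cases "\<sigma> y = 0")
        case False
        \<comment> \<open>The linear bound on \<open>kern\<close> cancels the scale: for
          \<open>x\<close> and \<open>y\<close> in the square this factor is at most 1 for every
          \<open>h\<close>.\<close>
        have "\<bar>h * kern_d 0 ((x - y) $ 1 / h)\<bar> \<le> \<bar>h\<bar> * \<bar>(x - y) $ 1 / h\<bar>"
          unfolding abs_mult by (rule mult_left_mono[OF kern_d_0_bound]) simp
        also have "\<dots> = \<bar>(x - y) $ 1\<bar>" using h by simp
        also have "\<dots> \<le> 1" using x \<sigma>(3)[OF False] by (auto simp: cbox_real2)
        finally have "\<bar>\<sigma> y\<bar> * \<bar>h * kern_d 0 ((x - y) $ 1 / h)\<bar> \<le> 1 * 1"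
          using \<sigma>(2)[of y] by (intro mult_mono) auto
        then show ?thesis by (simp add: abs_mult)
      qed simp
      moreover have "\<bar>kern_d 4 ((x - y) $ 2 / h) / h ^ 3\<bar> \<le> M / h ^ 3"
        using M h by (auto simp: divide_right_mono)
      ultimately have "\<bar>\<sigma> y * (h * kern_d 0 ((x - y) $ 1 / h))\<bar> * \<bar>kern_d 4 ((x - y) $ 2 / h) / h ^ 3\<bar> \<le> 1 * (M / h ^ 3)"
        by (intro mult_mono) auto
      moreover have "\<bar>H2 x y\<bar> = \<bar>\<sigma> y * (h * kern_d 0 ((x - y) $ 1 / h))\<bar> * \<bar>kern_d 4 ((x - y) $ 2 / h) / h ^ 3\<bar>"
        unfolding H2_def abs_mult[symmetric] by (simp only: mult.assoc)
      ultimately show ?thesis using True by simp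
    next
      case False then show ?thesis using out[OF False, of 2] by (auto simp: H2_def eval_nat_numeral)
    qed
    have c: "0 \<le> 2 * h" "0 \<le> 2 * M\<^sup>2 / h\<^sup>2" "0 \<le> M / h^3" using h M by auto
    note G1 = kernel_Fubini[where A=A2, OF i(2) H1m A2 c(1,2) H1b] 
      and G2 = kernel_Fubini[where A=A2, OF i(1) H2m A2 c(1,3) H2b]
    have inner: "(LINT x|lborel. r x * (\<sigma> y * rho h (x - y))) = (LINT x|lborel. q x * H1 x y) - (LINT x|lborel. p x * H2 x y)" for y
    proof (cases "\<sigma> y = 0")
      case False
      then have y: "y \<in> unit_square" using \<sigma>(3)[OF False] by (auto simp: cbox_real2)
      have pull: "(LINT x|lborel. g x * (\<sigma> y * F x)) = \<sigma> y * (LINT x|lborel. g x * F x)" for g F :: "real^2 \<Rightarrow> real"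
        by (subst integral_mult_right_zero[symmetric]) (simp add: mult.left_commute)
      show ?thesis unfolding H1_def H2_def pull
        using mollified_curl_curl[OF w rep h(1) _ y] h(2) by (simp add: right_diff_distrib)
    qed (simp add: H1_def H2_def)
    have "(LINT x|lborel. r x * S x) = (LINT y|lborel. LINT x|lborel. r x * (\<sigma> y * rho h (x - y)))"
      using F1(2)[OF i(3)] by simp
    also have "\<dots> = (LINT y|lborel. LINT x|lborel. q x * H1 x y) - (LINT y|lborel. LINT x|lborel. p x * H2 x y)"
      unfolding inner by (rule Bochner_Integration.integral_diff[OF G1(4) G2(4)])
    also have "\<bar>\<dots>\<bar> \<le> \<bar>LINT y|lborel. LINT x|lborel. q x * H1 x y\<bar> + \<bar>LINT y|lborel. LINT x|lborel. p x * H2 x y\<bar>"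
      by simp
    also have "\<dots> \<le> (2 * M\<^sup>2 / h\<^sup>2) * (2 * h) * (LINT x|lborel. \<bar>q x\<bar>) + (M / h^3) * (2 * h) * (LINT x|lborel. \<bar>p x\<bar>)"
      by (rule add_mono[OF G1(3) G2(3)])
    also have "\<dots> \<le> (2 * M\<^sup>2 / h\<^sup>2) * (2 * h) * t + (M / h^3) * (2 * h) * t"
      using b(1,2) c by (intro add_mono mult_left_mono mult_nonneg_nonneg) auto
    also have "\<dots> = (4 * M\<^sup>2 * h + 2 * M) * (t / h\<^sup>2)"
      using h by (simp add: field_simps power2_eq_square power3_eq_cube)
    also have "\<dots> \<le> (6 * M\<^sup>2) * (t / h\<^sup>2)"
    proof (rule mult_right_mono)
      have "M * 1 \<le> M * M" using M by (intro mult_left_mono) auto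
      moreover have "M\<^sup>2 * h \<le> M\<^sup>2 * 1" using h by (intro mult_left_mono) auto
      ultimately show "4 * M\<^sup>2 * h + 2 * M \<le> 6 * M\<^sup>2" by (simp add: power2_eq_square)
    qed (use t in auto)
    finally show ?thesis .
  qed
  then have part2: "(LINT x|lborel. r x * S x) \<le> 6 * M\<^sup>2 * (t / h\<^sup>2)" by linarith

  have "\<bar>LINT x|lborel. (\<alpha> * s x - r x) * S x\<bar> \<le> 4 * M\<^sup>2 * t"
    using F1(3)[OF is'(2)] mult_left_mono[OF b(3), of "4 * M\<^sup>2"] by simp
  moreover have "t \<le> t / h\<^sup>2"
  proof -
    have "h\<^sup>2 \<le> 1" using h by (simp add: power_le_one)
    then show ?thesis using t h by (simp add: field_simps)
  qed
  then have "4 * M\<^sup>2 * t \<le> 4 * M\<^sup>2 * (t / h\<^sup>2)" by (intro mult_left_mono) auto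
  ultimately have part3: "(LINT x|lborel. (\<alpha> * s x - r x) * S x) \<le> 4 * M\<^sup>2 * (t / h\<^sup>2)" by linarith

  have "\<alpha> * (LINT x|lborel. s x * \<sigma> x) = \<alpha> * (LINT x|lborel. s x * (\<sigma> x - S x)) + \<alpha> * (LINT x|lborel. s x * S x)"
  proof -
    have "(LINT x|lborel. s x * (\<sigma> x - S x)) = (LINT x|lborel. s x * \<sigma> x) - (LINT x|lborel. s x * S x)"
      unfolding right_diff_distrib by (rule Bochner_Integration.integral_diff[OF is\<sigma> F1(1)[OF i_s]])
    then show ?thesis by (simp add: right_diff_distrib)
  qed
  also have "\<alpha> * (LINT x|lborel. s x * S x) = (LINT x|lborel. (\<alpha> * s x - r x) * S x) + (LINT x|lborel. r x * S x)"
  proof -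
    have "(LINT x|lborel. (\<alpha> * s x - r x) * S x) + (LINT x|lborel. r x * S x) = (LINT x|lborel. (\<alpha> * s x - r x) * S x + r x * S x)"
      by (rule Bochner_Integration.integral_add[symmetric, OF F1(1)[OF is'(2)] F1(1)[OF i(3)]])
    also have "\<dots> = (LINT x|lborel. \<alpha> * (s x * S x))"
      by (intro Bochner_Integration.integral_cong) (auto simp: algebra_simps)
    finally show ?thesis by simp
  qed
  finally have "\<alpha> * (LINT x|lborel. s x * \<sigma> x) \<le> \<alpha> * (16 * M\<^sup>2 * (h * T)) + (4 * M\<^sup>2 * (t / h\<^sup>2) + 6 * M\<^sup>2 * (t / h\<^sup>2))"
    using part1 part2 part3 by linarith
  moreover have "\<alpha> * (1/8) \<le> \<alpha> * (LINT x|lborel. s x * \<sigma> x)" using big \<alpha> by (intro mult_left_mono) auto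
  moreover have "\<alpha> * (16 * M\<^sup>2 * (h * T)) = 16 * M\<^sup>2 * \<alpha> * (h * T)"
    "4 * M\<^sup>2 * (t / h\<^sup>2) + 6 * M\<^sup>2 * (t / h\<^sup>2) = 10 * M\<^sup>2 * (t / h\<^sup>2)" by (simp_all add: algebra_simps)
  ultimately show ?thesis by linarith
qed

text \<open>With h^5 = \<epsilon>, an energy below s^2 h^4 gives \<open>T\<close> = s^2/h and
  \<open>t\<close> = s h^2 in \<open>lower_bound_core\<close>. The right side is then at most 26 M^2
  s, against \<alpha>/8 = 27 M^2 s on the left. The threshold (1/8)^5 makes h <= 1/8, the range of
  admissible translations.\<close>

theorem energy_lower_bound:
  assumes \<alpha>: "0 < \<alpha>" "\<alpha> < 1"
  shows "\<exists>\<epsilon>0>0. \<exists>c>0. \<forall>\<epsilon>. 0 < \<epsilon> \<and> \<epsilon> < \<epsilon>0 \<longrightarrow> (\<forall>u\<in>BV_phase. \<forall>w\<in>D_curl_curl (mat 1).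
     ennreal (c * \<epsilon> powr (4/5)) \<le> energy \<alpha> \<epsilon> w u)"
proof -
  obtain M where M: "1 \<le> M" "\<forall>n\<in>{1..4}. \<forall>t. \<bar>kern_d n t\<bar> \<le> M" using kern_d_bound by blast
  define s where "s = \<alpha> / (8 * 27 * M\<^sup>2)"
  have M2: "1 \<le> M\<^sup>2" using M by simp
  have s: "s > 0" "s \<le> 1"
  proof -
    show "s > 0" unfolding s_def using \<alpha> M2 by (intro divide_pos_pos) auto
    have "\<alpha> \<le> 8 * 27 * M\<^sup>2" using \<alpha> M2 by linarith
    then show "s \<le> 1" unfolding s_def using M2 by (simp add: divide_le_eq)
  qed
  have "ennreal (s\<^sup>2 * \<epsilon> powr (4/5)) \<le> energy \<alpha> \<epsilon> w u"
    if \<epsilon>: "0 < \<epsilon>" "\<epsilon> < (1/8)^5" and u: "u \<in> BV_phase" and w: "w \<in> D_curl_curl (mat 1)" for \<epsilon> u w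
  proof (rule ccontr)
    assume "\<not> ?thesis"
    then have less: "energy \<alpha> \<epsilon> w u < ennreal (s\<^sup>2 * \<epsilon> powr (4/5))" by simp
    define h where "h = \<epsilon> powr (1/5)"
    have h0: "0 < h" using \<epsilon> by (simp add: h_def)
    have h5: "h ^ 5 = \<epsilon>" using \<epsilon> by (simp add: h_def powr_power)
    have h4: "h ^ 4 = \<epsilon> powr (4/5)" using \<epsilon> by (simp add: h_def powr_power)
    have h1: "h \<le> 1/8"
    proof (rule ccontr)
      assume "\<not> h \<le> 1/8"
      then have "(1/8)^5 \<le> h^5" by (intro power_mono) auto
      then show False using h5 \<epsilon> by simp
    qed
    let ?el = "(\<integral>\<^sup>+x\<in>unit_square. ennreal ((norm (w x -
         vector [vector [1, 0], vector [0, 1 + \<alpha> * (1 - 2 * u x)]]))\<^sup>2) \<partial>lebesgue)"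
    have el: "?el \<le> ennreal ((s * h\<^sup>2)\<^sup>2)"
    proof -
      have "?el \<le> energy \<alpha> \<epsilon> w u" unfolding energy_def by simp
      also have "\<dots> \<le> ennreal (s\<^sup>2 * h^4)" using less by (simp add: h4)
      also have "s\<^sup>2 * h^4 = (s * h\<^sup>2)\<^sup>2" by (simp add: power_mult_distrib power_mult[symmetric])
      finally show ?thesis .
    qed
    have "ennreal \<epsilon> * total_variation (interior unit_square) u \<le> energy \<alpha> \<epsilon> w u" unfolding energy_def by simp
    also have "\<dots> \<le> ennreal (s\<^sup>2 * h^4)" using less by (simp add: h4)
    also have "s\<^sup>2 * h^4 = \<epsilon> * (s\<^sup>2 / h)" unfolding h5[symmetric] using h0 by (simp add: field_simps eval_nat_numeral)
    also have "ennreal (\<epsilon> * (s\<^sup>2 / h)) = ennreal \<epsilon> * ennreal (s\<^sup>2 / h)"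
      using \<epsilon> h0 by (intro ennreal_mult) auto
    finally have TV: "total_variation (interior unit_square) u \<le> ennreal (s\<^sup>2 / h)"
      using \<epsilon> by (subst (asm) ennreal_mult_le_mult_iff) auto
    have "\<alpha> / 8 \<le> 16 * M\<^sup>2 * \<alpha> * (h * (s\<^sup>2 / h)) + 10 * M\<^sup>2 * ((s * h\<^sup>2) / h\<^sup>2)"
      by (rule lower_bound_core[OF \<alpha>(1) M h0 h1 u w TV _ _ el]) (use h0 s in auto)
    also have "\<dots> = 16 * M\<^sup>2 * (\<alpha> * s\<^sup>2) + 10 * M\<^sup>2 * s" using h0 by simp
    also have "\<dots> \<le> 16 * M\<^sup>2 * s + 10 * M\<^sup>2 * s"
    proof -
      have "\<alpha> * s\<^sup>2 \<le> 1 * (s * 1)" unfolding power2_eq_square using \<alpha> s by (intro mult_mono) auto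
      then show ?thesis by (intro add_mono mult_left_mono) auto
    qed
    also have "\<dots> < 27 * M\<^sup>2 * s" using M M2 s by (simp add: algebra_simps)
    also have "\<dots> = \<alpha> / 8" unfolding s_def using M M2 by (simp add: field_simps)
    finally show False by simp
  qed
  moreover have "s\<^sup>2 > 0" using s by simp
  ultimately show ?thesis by (intro exI[of _ "(1/8)^5"] conjI exI[of _ "s\<^sup>2"]) auto
qed

section \<open>Total variation of sets with convex slices\<close>

text \<open>Slices may contain either, both or none of their end points, so the interval is given by
  order convexity. End points are null, and the integral is a difference of two values of
  \<open>F\<close>.\<close>

lemma integral_deriv_interval:
  fixes F F' :: "real \<Rightarrow> real"
  assumes d: "\<And>t. (F has_real_derivative F' t) (at t)" and c: "continuous_on UNIV F'" 
    and b: "\<And>t. \<bar>F t\<bar> \<le> 1" and I: "I \<subseteq> {a..b}"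
    and conv: "\<And>s t u. s \<in> I \<Longrightarrow> u \<in> I \<Longrightarrow> s \<le> t \<Longrightarrow> t \<le> u \<Longrightarrow> t \<in> I"
  shows "\<bar>LINT t|lborel. indicator I t * F' t\<bar> \<le> 2"
proof (cases "I = {}")
  case False
  have bdd: "bdd_below I" "bdd_above I" using I by (auto intro: bdd_below_mono bdd_above_mono)
  let ?c = "Inf I" and ?d = "Sup I"
  have sub: "I \<subseteq> {?c..?d}" using bdd by (auto intro: cInf_lower cSup_upper)
  have sup: "{?c<..<?d} \<subseteq> I"
  proof
    fix x assume x: "x \<in> {?c<..<?d}"
    then obtain s u where "s \<in> I" "s < x" "u \<in> I" "x < u"
      using cInf_less_iff[OF False bdd(1), of x] less_cSup_iff[OF False bdd(2), of x] by auto
    then show "x \<in> I" using conv[of s u x] by simp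
  qed
  have le: "?c \<le> ?d" using False sub by fastforce
  have Ib: "I \<in> sets borel"
  proof -
    have "is_interval I" unfolding is_interval_1 using conv by blast
    then show ?thesis by (rule real_interval_borel_measurable)
  qed
  have [measurable]: "F' \<in> borel_measurable borel" using c by (rule borel_measurable_continuous_onI)
  have "(LINT t|lborel. indicator I t * F' t) = (LINT t|lborel. indicator {?c..?d} t *\<^sub>R F' t)"
  proof (rule integral_cong_AE)
    show "AE t in lborel. indicator I t * F' t = indicator {?c..?d} t *\<^sub>R F' t"
      using AE_lborel_singleton[of ?c] AE_lborel_singleton[of ?d]
    proof eventually_elim
      case (elim t)
      have "t \<in> I \<longleftrightarrow> t \<in> {?c..?d}" using elim sub sup by fastforce
      then show ?case by (simp add: indicator_def)
    qed
  qed (use Ib in auto)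
  also have "\<dots> = F ?d - F ?c"
    by (rule integral_FTC_atLeastAtMost[OF le])
       (use d c in \<open>auto simp: has_real_derivative_iff_has_vector_derivative[symmetric] intro: has_field_derivative_at_within continuous_on_subset\<close>)
  finally show ?thesis using b[of ?c] b[of ?d] by linarith
qed simp


text \<open>The pieces of the pattern have curved sides and are not convex in general; having
  intervals as axis-parallel slices is enough to bound the perimeter.\<close>

definition slice_convex :: "(real^2) set \<Rightarrow> bool" where
  "slice_convex A \<longleftrightarrow> 
    (\<forall>y s t u. pt s y \<in> A \<longrightarrow> pt u y \<in> A \<longrightarrow> s \<le> t \<longrightarrow> t \<le> u \<longrightarrow> pt t y \<in> A) \<and>
    (\<forall>y s t u. pt y s \<in> A \<longrightarrow> pt y u \<in> A \<longrightarrow> s \<le> t \<longrightarrow> t \<le> u \<longrightarrow> pt y t \<in> A)"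

text \<open>On each line the slice contributes at most 2; integrating over the projection of the box
  gives twice its side length.\<close>

lemma slice_integral_bound:
  fixes F :: "real^2 \<Rightarrow> real"
  assumes F: "C_diff 1 F" "\<And>x. \<bar>F x\<bar> \<le> 1" 
    and A [measurable]: "A \<in> sets borel" and sub: "A \<subseteq> cbox (pt a1 a2) (pt b1 b2)" and conv: "slice_convex A"
    and le: "a1 \<le> b1" "a2 \<le> b2"
  shows "\<bar>LINT x|lborel. indicator A x * partial 1 F x\<bar> \<le> 2 * (b2 - a2)"
    and "\<bar>LINT x|lborel. indicator A x * partial 2 F x\<bar> \<le> 2 * (b1 - a1)"
    and "integrable lborel (\<lambda>x. indicator A x * partial i F x)"
proof -
  have cont: "continuous_on UNIV (partial i F)" for i using F(1) unfolding C_diff_1 by blast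
  have bb: "bounded A" using sub bounded_cbox bounded_subset by blast
  then obtain R where R: "\<forall>x\<in>A. norm x < R" unfolding bounded_pos_less by blast
  have "loc_bdd (\<lambda>x. indicator A x :: real)"
    by (rule loc_bdd_bounded[of _ 1]) (auto simp: indicator_def)
  then show int: "integrable lborel (\<lambda>x. indicator A x * partial i F x)" for i
    by (intro loc_bdd_integrable[where R=R] loc_bdd_mult loc_bdd_continuous[OF cont]) 
      (use R in \<open>auto simp: indicator_def split: if_splits\<close>)
  have lc1: "continuous_on UNIV (\<lambda>t. partial i F (pt t y))" and lc2: "continuous_on UNIV (\<lambda>t. partial i F (pt y t))" for i y
    by (intro continuous_on_compose2[OF cont] continuous_intros; simp)+
  have d: "((\<lambda>t. F (pt t y)) has_real_derivative partial 1 F (pt t y)) (at t)"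
    "((\<lambda>t. F (pt y t)) has_real_derivative partial 2 F (pt y t)) (at t)" for t y
    using DERIV_line[of F] F(1) unfolding C_diff_1 by blast+
  have box: "integrable lborel (\<lambda>y. 2 * indicator {a..b} y :: real)" for a b :: real
    by (intro integrable_mult_right integrable_real_indicator) (auto simp: emeasure_lborel_Icc_eq)
  have s1: "\<bar>LINT t|lborel. indicator A (pt t y) * partial 1 F (pt t y)\<bar> \<le> 2 * indicator {a2..b2} y" for y
  proof (cases "y \<in> {a2..b2}")
    case True
    have "\<bar>LINT t|lborel. indicator {t. pt t y \<in> A} t * partial 1 F (pt t y)\<bar> \<le> 2"
    proof (rule integral_deriv_interval[OF d(1) lc1 F(2)])
      show "{t. pt t y \<in> A} \<subseteq> {a1..b1}" using sub by (auto simp: cbox_real2)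
      fix s t u assume "s \<in> {t. pt t y \<in> A}" "u \<in> {t. pt t y \<in> A}" "s \<le> t" "t \<le> u"
      then have "pt s y \<in> A" "pt u y \<in> A" "s \<le> t" "t \<le> u" by auto
      then show "t \<in> {t. pt t y \<in> A}" using conv unfolding slice_convex_def by blast
    qed
    then show ?thesis using True by (simp add: indicator_def)
  next
    case False
    then have "pt t y \<notin> A" for t using sub by (auto simp: cbox_real2)
    then show ?thesis by (simp add: indicator_def)
  qed
  have s2: "\<bar>LINT t|lborel. indicator A (pt y t) * partial 2 F (pt y t)\<bar> \<le> 2 * indicator {a1..b1} y" for y
  proof (cases "y \<in> {a1..b1}")
    case True
    have "\<bar>LINT t|lborel. indicator {t. pt y t \<in> A} t * partial 2 F (pt y t)\<bar> \<le> 2"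
    proof (rule integral_deriv_interval[OF d(2) lc2 F(2)])
      show "{t. pt y t \<in> A} \<subseteq> {a2..b2}" using sub by (auto simp: cbox_real2)
      fix s t u assume "s \<in> {t. pt y t \<in> A}" "u \<in> {t. pt y t \<in> A}" "s \<le> t" "t \<le> u"
      then have "pt y s \<in> A" "pt y u \<in> A" "s \<le> t" "t \<le> u" by auto
      then show "t \<in> {t. pt y t \<in> A}" using conv unfolding slice_convex_def by blast
    qed
    then show ?thesis using True by (simp add: indicator_def)
  next
    case False
    then have "pt y t \<notin> A" for t using sub by (auto simp: cbox_real2)
    then show ?thesis by (simp add: indicator_def)
  qed
  have abs_le: "\<bar>LINT y|lborel. g y\<bar> \<le> 2 * (b - a)" if "\<And>y. \<bar>g y\<bar> \<le> 2 * indicator {a..b} y" "a \<le> b" for g :: "real \<Rightarrow> real" and a b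
  proof (cases "integrable lborel g")
    case True
    have "\<bar>LINT y|lborel. g y\<bar> \<le> (LINT y|lborel. \<bar>g y\<bar>)" by (rule integral_abs_bound)
    also have "\<dots> \<le> (LINT y|lborel. 2 * indicator {a..b} y)"
      using True box that by (intro integral_mono) auto
    also have "\<dots> = 2 * (b - a)" using that(2) by simp
    finally show ?thesis .
  next
    case False then show ?thesis using that(2) by (simp add: not_integrable_integral_eq)
  qed
  show "\<bar>LINT x|lborel. indicator A x * partial 1 F x\<bar> \<le> 2 * (b2 - a2)"
    unfolding integral_real2(1)[OF int] by (rule abs_le[OF s1 le(2)])
  show "\<bar>LINT x|lborel. indicator A x * partial 2 F x\<bar> \<le> 2 * (b1 - a1)"
    unfolding integral_real2(2)[OF int] by (rule abs_le[OF s2 le(1)])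
qed

text \<open>Subadditivity: each set pays twice the sides of a bounding box, and an interface shared
  by several sets is simply counted repeatedly.\<close>

lemma total_variation_slices:
  assumes I: "finite I" and u: "AE x in lebesgue. x \<in> box 0 1 \<longrightarrow> u x = (\<Sum>i\<in>I. indicator (A i) x)"
    and A: "\<And>i. i \<in> I \<Longrightarrow> A i \<in> sets borel" "\<And>i. i \<in> I \<Longrightarrow> slice_convex (A i)"
      "\<And>i. i \<in> I \<Longrightarrow> A i \<subseteq> cbox (pt (l1 i) (l2 i)) (pt (l1 i + W i) (l2 i + V i))"
      "\<And>i. i \<in> I \<Longrightarrow> 0 \<le> W i" "\<And>i. i \<in> I \<Longrightarrow> 0 \<le> V i"
  shows "total_variation (interior unit_square) u \<le> ennreal (\<Sum>i\<in>I. 2 * (W i + V i))"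
  unfolding total_variation_def interior_unit_square
proof (rule SUP_least)
  fix \<Phi> :: "real^2 \<Rightarrow> real^2"
  assume "\<Phi> \<in> {\<phi>. (\<forall>i. C_diff 1 (\<lambda>x. \<phi> x $ i)) \<and> compactly_supported_in (box 0 1) \<phi> \<and> (\<forall>x. norm (\<phi> x) \<le> 1)}"
  then have C: "\<And>i. C_diff 1 (\<lambda>x. \<Phi> x $ i)" and supp: "closure {x. \<Phi> x \<noteq> 0} \<subseteq> box 0 1" and n: "\<And>x. norm (\<Phi> x) \<le> 1"
    by (auto simp: compactly_supported_in_def)
  have b: "\<bar>\<Phi> x $ i\<bar> \<le> 1" for x i using n[of x] component_le_norm_cart[of "\<Phi> x" i] by linarith
  let ?d1 = "partial 1 (\<lambda>x. \<Phi> x $ 1)" and ?d2 = "partial 2 (\<lambda>x. \<Phi> x $ 2)"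
  have out: "partial i (\<lambda>x. \<Phi> x $ j) x = 0" if "x \<notin> box 0 1" for x i j
  proof -
    have "{x. \<Phi> x $ j \<noteq> 0} \<subseteq> {x. \<Phi> x \<noteq> 0}" by auto
    then have "x \<notin> closure {x. \<Phi> x $ j \<noteq> 0}" using that supp closure_mono by blast
    then show ?thesis by (rule partial_zero_outside)
  qed
  have div: "divergence \<Phi> x = ?d1 x + ?d2 x" for x by (simp add: divergence_def sum_2)
  have cont: "continuous_on UNIV (partial i (\<lambda>x. \<Phi> x $ j))" for i j using C unfolding C_diff_1 by blast
  have [measurable]: "?d1 \<in> borel_measurable borel" "?d2 \<in> borel_measurable borel"
    using cont by (auto intro: borel_measurable_continuous_onI)
  have Am: "(\<lambda>x. \<Sum>i\<in>I. indicator (A i) x * ?d1 x + indicator (A i) x * ?d2 x) \<in> borel_measurable borel"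
    using A(1) by (intro borel_measurable_sum) auto
  note sl = slice_integral_bound[OF C b A(1) A(3) A(2)]
  have int: "integrable lborel (\<lambda>x. indicator (A i) x * ?d1 x)" "integrable lborel (\<lambda>x. indicator (A i) x * ?d2 x)" if "i \<in> I" for i
    using sl(3)[OF that that that] A(4,5)[OF that] by auto
  have m2: "(\<lambda>x. \<Sum>i\<in>I. indicator (A i) x * ?d1 x + indicator (A i) x * ?d2 x) \<in> borel_measurable lebesgue"
    using Am by (intro measurable_completion) simp
  have ae: "AE x in lebesgue. (\<Sum>i\<in>I. indicator (A i) x * ?d1 x + indicator (A i) x * ?d2 x) = indicator (box 0 1) x *\<^sub>R (u x * divergence \<Phi> x)"
    using u
  proof eventually_elim
    case (elim x)
    show ?case
    proof (cases "x \<in> box 0 1")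
      case True
      then show ?thesis using elim by (simp add: div distrib_left sum_distrib_right sum.distrib)
    qed (simp add: out)
  qed
  have ae': "AE x in lebesgue. indicator (box 0 1) x *\<^sub>R (u x * divergence \<Phi> x) = (\<Sum>i\<in>I. indicator (A i) x * ?d1 x + indicator (A i) x * ?d2 x)"
    using ae by eventually_elim simp
  have "(LINT x:box 0 1|lebesgue. u x * divergence \<Phi> x) = (LINT x|lebesgue. (\<Sum>i\<in>I. indicator (A i) x * ?d1 x + indicator (A i) x * ?d2 x))"
    unfolding set_lebesgue_integral_def by (rule integral_cong_AE[OF borel_measurable_AE[OF m2 ae] m2 ae'])
  also have "\<dots> = (LINT x|lborel. (\<Sum>i\<in>I. indicator (A i) x * ?d1 x + indicator (A i) x * ?d2 x))"
    by (rule integral_lebesgue_lborel[OF Am])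
  also have "\<dots> = (\<Sum>i\<in>I. (LINT x|lborel. indicator (A i) x * ?d1 x) + (LINT x|lborel. indicator (A i) x * ?d2 x))"
    using int by (subst Bochner_Integration.integral_sum) auto
  also have "\<dots> \<le> (\<Sum>i\<in>I. 2 * (W i + V i))"
  proof (rule sum_mono)
    fix i assume i: "i \<in> I"
    have "\<bar>LINT x|lborel. indicator (A i) x * ?d1 x\<bar> \<le> 2 * V i"
      using sl(1)[OF i i i] A(4,5)[OF i] by simp
    moreover have "\<bar>LINT x|lborel. indicator (A i) x * ?d2 x\<bar> \<le> 2 * W i"
      using sl(2)[OF i i i] A(4,5)[OF i] by simp
    ultimately show "(LINT x|lborel. indicator (A i) x * ?d1 x) + (LINT x|lborel. indicator (A i) x * ?d2 x) \<le> 2 * (W i + V i)"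
      by simp
  qed
  finally show "ennreal (LINT x:box 0 1|lebesgue. u x * divergence \<Phi> x) \<le> ennreal (\<Sum>i\<in>I. 2 * (W i + V i))"
    by (rule ennreal_leI)
qed

section \<open>The branching cell\<close>

abbreviation pos :: "real \<Rightarrow> real" where "pos r \<equiv> max 0 r"
text \<open>The value 0 at 0 makes this step left-continuous, so periods become half-open intervals
  (k, k + 1] that fit together without overlap.\<close>

abbreviation Hv :: "real \<Rightarrow> real" where "Hv r \<equiv> of_bool (0 < r)"

lemma has_derivative_pos_sq: "((\<lambda>r. (pos r)\<^sup>2) has_real_derivative 2 * pos r) (at r)"
proof -
  consider "r < 0" | "r = 0" | "r > 0" by linarith
  then show ?thesis
  proof cases
    case 1
    have "((\<lambda>r::real. 0) has_real_derivative 0) (at r)" by simp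
    then have "((\<lambda>r. (pos r)\<^sup>2) has_real_derivative 0) (at r)"
      by (rule has_field_derivative_transform_within_open[of _ _ _ "{..<0}"]) (use 1 in auto)
    then show ?thesis using 1 by (simp add: max_def)
  next
    case 2
    have "((\<lambda>h::real. (pos h)\<^sup>2 / h) \<longlongrightarrow> 0) (at 0)"
    proof (rule Lim_null_comparison)
      show "\<forall>\<^sub>F h in at (0::real). norm ((pos h)\<^sup>2 / h) \<le> \<bar>h\<bar>"
        by (rule always_eventually) (auto simp: max_def power2_eq_square)
      show "((\<lambda>h::real. \<bar>h\<bar>) \<longlongrightarrow> 0) (at 0)" by (auto intro!: tendsto_eq_intros)
    qed
    then show ?thesis using 2 by (simp add: DERIV_def)
  next
    case 3
    have "((\<lambda>r. r\<^sup>2) has_real_derivative 2 * r) (at r)" by (auto intro!: derivative_eq_intros)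
    then have "((\<lambda>r. (pos r)\<^sup>2) has_real_derivative 2 * r) (at r)"
      by (rule has_field_derivative_transform_within_open[of _ _ _ "{0<..}"]) (use 3 in auto)
    then show ?thesis using 3 by (simp add: max_def)
  qed
qed

lemma has_derivative_pos: "r \<noteq> 0 \<Longrightarrow> ((\<lambda>r. pos r) has_real_derivative Hv r) (at r)"
proof -
  assume "r \<noteq> 0"
  then consider "r < 0" | "r > 0" by linarith
  then show ?thesis
  proof cases
    case 1
    have "((\<lambda>r::real. 0) has_real_derivative 0) (at r)" by simp
    then have "((\<lambda>r. pos r) has_real_derivative 0) (at r)"
      by (rule has_field_derivative_transform_within_open[of _ _ _ "{..<0}"]) (use 1 in auto)
    then show ?thesis using 1 by simp
  next
    case 2
    have "((\<lambda>r::real. r) has_real_derivative 1) (at r)" by (auto intro!: derivative_eq_intros)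
    then have "((\<lambda>r. pos r) has_real_derivative 1) (at r)"
      by (rule has_field_derivative_transform_within_open[of _ _ _ "{0<..}"]) (use 2 in auto)
    then show ?thesis using 2 by simp
  qed
qed

text \<open>At a zero of \<open>f\<close> the difference quotient of \<open>pos f\<close> stays
  bounded while \<open>k\<close> tends to 0, so the kink disappears. With \<open>k\<close> the slope
  of a kink curve, this removes all points where the curve is horizontal, possibly whole intervals,
  from the exceptional set.\<close>

lemma pos_mult_deriv:
  fixes f k :: "real \<Rightarrow> real"
  assumes f: "(f has_real_derivative f') (at t)" and k: "(k has_real_derivative k') (at t)"
    and 0: "f t = 0 \<Longrightarrow> k t = 0"
  shows "((\<lambda>s. pos (f s) * k s) has_real_derivative f' * Hv (f t) * k t + pos (f t) * k') (at t)"
proof (cases "f t = 0")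
  case True
  then have kt: "k t = 0" by (rule 0)
  have "((\<lambda>s. (f s / (s - t)) * k s) \<longlongrightarrow> f' * 0) (at t)"
  proof (rule tendsto_mult)
    show "((\<lambda>s. f s / (s - t)) \<longlongrightarrow> f') (at t)"
      using f True unfolding has_field_derivative_iff by simp
    show "(k \<longlongrightarrow> 0) (at t)" using DERIV_isCont[OF k] kt by (simp add: isCont_def)
  qed
  from tendsto_rabs_zero[OF this[unfolded mult_zero_right]]
  have "((\<lambda>s. \<bar>(f s / (s - t)) * k s\<bar>) \<longlongrightarrow> 0) (at t)" .
  then have "((\<lambda>s. (pos (f s) * k s - pos (f t) * k t) / (s - t)) \<longlongrightarrow> 0) (at t)"
    by (rule Lim_null_comparison[rotated]) 
       (auto intro!: always_eventually divide_right_mono mult_right_mono simp: True abs_mult)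
  then show ?thesis unfolding has_field_derivative_iff by (simp add: True kt)
next
  case False
  have "((\<lambda>s. pos (f s)) has_real_derivative Hv (f t) * f') (at t)"
    using DERIV_chain2[OF has_derivative_pos[OF False] f] .
  from DERIV_mult[OF this k] show ?thesis by (simp add: algebra_simps)
qed

lemma smooth1_fst_cont: "smooth1 f \<Longrightarrow> continuous_on S (\<lambda>x::real^2. f (x $ 1))"
  by (rule continuous_on_compose2[OF smooth1_continuous[of f UNIV]]) (auto intro: continuous_intros)

text \<open>Zeros of the derivative are exempt because the profiles used are constant on long
  intervals; the remaining crossings with a horizontal line form the finite exceptional set of
  \<open>weak_deriv_line_1\<close>.\<close>

definition transversal :: "(real \<Rightarrow> real) \<Rightarrow> bool" where
  "transversal \<beta> \<longleftrightarrow> smooth1 \<beta> \<and> (\<forall>v. finite {t. \<beta> t = v \<and> deriv \<beta> t \<noteq> 0})"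

text \<open>Pairs of second derivatives of one potential form a linear space, so the pattern can be
  assembled from its summands without naming potentials.\<close>

definition has_potential :: "(real^2 \<Rightarrow> real) \<Rightarrow> (real^2 \<Rightarrow> real) \<Rightarrow> bool" where
  "has_potential F11 F22 \<longleftrightarrow> (\<exists>F F1 F2. weak_deriv 1 F F1 \<and> weak_deriv 1 F1 F11 \<and> weak_deriv 2 F F2 \<and> weak_deriv 2 F2 F22)"

lemma has_potential_add: "has_potential F11 F22 \<Longrightarrow> has_potential G11 G22 \<Longrightarrow> 
    has_potential (\<lambda>x. F11 x + G11 x) (\<lambda>x. F22 x + G22 x)"
  unfolding has_potential_def by (elim exE conjE) (intro exI conjI; rule weak_deriv_add; assumption)

lemma has_potential_scale: "has_potential F11 F22 \<Longrightarrow> has_potential (\<lambda>x. c * F11 x) (\<lambda>x. c * F22 x)"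
  unfolding has_potential_def by (elim exE conjE) (intro exI conjI; rule weak_deriv_scale; assumption)

lemma has_potential_0: "has_potential (\<lambda>x. 0) (\<lambda>x. 0)"
  unfolding has_potential_def using weak_deriv_0 by blast

lemma has_potential_sum:
  "(\<And>j. j \<in> I \<Longrightarrow> has_potential (f j) (g j)) \<Longrightarrow> has_potential (\<lambda>x. \<Sum>j\<in>I. f j x) (\<lambda>x. \<Sum>j\<in>I. g j x)"
proof (induction I rule: infinite_finite_induct)
  case (insert i I)
  then have "has_potential (\<lambda>x. f i x + (\<Sum>j\<in>I. f j x)) (\<lambda>x. g i x + (\<Sum>j\<in>I. g j x))"
    by (intro has_potential_add) blast+
  then show ?case using insert.hyps by simp
qed (simp_all add: has_potential_0)

text \<open>The potential is \<Theta>(x_1) times the square of the positive part of c x_2 -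
  \<beta>(x_1), a quadratic ridge starting at the curve c x_2 = \<beta>(x_1); the two functions are
  its pure second derivatives.\<close>

lemma has_potential_ridge:
  fixes \<Theta> \<beta> :: "real \<Rightarrow> real" and c :: real
  assumes \<Theta>: "smooth1 \<Theta>" and \<beta>: "transversal \<beta>" and c: "c > 0"
  defines "P \<equiv> \<lambda>x::real^2. c * x $ 2 - \<beta> (x $ 1)"
  shows "has_potential 
    (\<lambda>x. deriv (deriv \<Theta>) (x $ 1) * (pos (P x))\<^sup>2 - 4 * deriv \<Theta> (x $ 1) * deriv \<beta> (x $ 1) * pos (P x) 
       + \<Theta> (x $ 1) * (2 * (deriv \<beta> (x $ 1))\<^sup>2 * Hv (P x) - 2 * deriv (deriv \<beta>) (x $ 1) * pos (P x)))
    (\<lambda>x. 2 * c\<^sup>2 * \<Theta> (x $ 1) * Hv (P x))"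
proof -
  have \<beta>s: "smooth1 \<beta>" and fin: "\<And>v. finite {t. \<beta> t = v \<and> deriv \<beta> t \<noteq> 0}" using \<beta> by (auto simp: transversal_def)
  note S = smooth1_deriv(2)
  note Sc = smooth1_fst_cont[OF \<Theta>] smooth1_fst_cont[OF S[OF \<Theta>]] smooth1_fst_cont[OF S[OF S[OF \<Theta>]]]
    smooth1_fst_cont[OF \<beta>s] smooth1_fst_cont[OF S[OF \<beta>s]] smooth1_fst_cont[OF S[OF S[OF \<beta>s]]]
  have Pc: "continuous_on UNIV P" unfolding P_def by (intro continuous_intros Sc)
  have [measurable]: "P \<in> borel_measurable borel" using Pc by (rule borel_measurable_continuous_onI)
  have LH: "loc_bdd (\<lambda>x. Hv (P x))" by (rule loc_bdd_bounded[of _ 1]) auto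
  let ?T = "\<lambda>x. \<Theta> (x $ 1)" and ?T' = "\<lambda>x. deriv \<Theta> (x $ 1)" and ?T'' = "\<lambda>x. deriv (deriv \<Theta>) (x $ 1)"
  let ?b' = "\<lambda>x. deriv \<beta> (x $ 1)" and ?b'' = "\<lambda>x. deriv (deriv \<beta>) (x $ 1)"
  let ?F = "\<lambda>x. ?T x * (pos (P x))\<^sup>2"
  let ?F1 = "\<lambda>x. ?T' x * (pos (P x))\<^sup>2 + (-2) * (?T x * (pos (P x) * ?b' x))"
  let ?F2 = "\<lambda>x. 2 * c * ?T x * pos (P x)"
  let ?F11 = "\<lambda>x. ?T'' x * (pos (P x))\<^sup>2 - 4 * ?T' x * ?b' x * pos (P x) + ?T x * (2 * (?b' x)\<^sup>2 * Hv (P x) - 2 * ?b'' x * pos (P x))"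
  let ?F22 = "\<lambda>x. 2 * c\<^sup>2 * ?T x * Hv (P x)"
  have L: "loc_bdd ?F" "loc_bdd ?F1" "loc_bdd ?F2"
    by (intro loc_bdd_continuous continuous_intros Pc Sc)+
  have L11: "loc_bdd ?F11"
  proof -
    have "?F11 = (\<lambda>x. (?T'' x * (pos (P x))\<^sup>2 - 4 * ?T' x * ?b' x * pos (P x) - 2 * ?T x * ?b'' x * pos (P x)) + 
      (2 * ?T x * (?b' x)\<^sup>2) * Hv (P x))" by (simp add: algebra_simps fun_eq_iff)
    then show ?thesis by (simp only:) (intro loc_bdd_add loc_bdd_mult LH loc_bdd_continuous continuous_intros Pc Sc)
  qed
  have L22: "loc_bdd ?F22" by (intro loc_bdd_mult[OF _ LH] loc_bdd_continuous continuous_intros Sc)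
  note d\<Theta> = smooth1_deriv(1)[OF \<Theta>] smooth1_deriv(1)[OF S[OF \<Theta>]]
  note d\<beta> = smooth1_deriv(1)[OF \<beta>s] smooth1_deriv(1)[OF S[OF \<beta>s]]
  have dP1: "((\<lambda>t. P (pt t b)) has_real_derivative - deriv \<beta> t) (at t)" for t b
    unfolding P_def using d\<beta>(1)[of t] by (auto intro!: derivative_eq_intros)
  have dP2: "((\<lambda>t. P (pt a t)) has_real_derivative c) (at t)" for t a
    unfolding P_def by (auto intro!: derivative_eq_intros)
  have dsq1: "((\<lambda>t. (pos (P (pt t b)))\<^sup>2) has_real_derivative 2 * pos (P (pt t b)) * (- deriv \<beta> t)) (at t)" for t b
    using DERIV_chain2[OF has_derivative_pos_sq dP1] .
  have dsq2: "((\<lambda>t. (pos (P (pt a t)))\<^sup>2) has_real_derivative 2 * pos (P (pt a t)) * c) (at t)" for t a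
    using DERIV_chain2[OF has_derivative_pos_sq dP2] .
  have lin1: "continuous_on UNIV (\<lambda>t. G (pt t b))" and lin2: "continuous_on UNIV (\<lambda>t. G (pt b t))" if "continuous_on UNIV G" for G b
    by (rule continuous_on_compose2[OF that]; auto intro: continuous_intros)+
  have "weak_deriv 1 ?F ?F1"
  proof (rule weak_deriv_line_1[where S="\<lambda>_. {}"])
    fix b t
    show "((\<lambda>t. ?F (pt t b)) has_real_derivative ?F1 (pt t b)) (at t)"
      using DERIV_mult[OF d\<Theta>(1) dsq1] by (simp add: algebra_simps)
    show "continuous_on UNIV (\<lambda>t. ?F (pt t b))" by (rule lin1) (intro continuous_intros Pc Sc)
  qed (use L in auto)
  moreover have "weak_deriv 1 ?F1 ?F11"
  proof (rule weak_deriv_line_1[where S="\<lambda>b. {t. \<beta> t = c * b \<and> deriv \<beta> t \<noteq> 0}"])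
    fix b t assume t: "t \<notin> {t. \<beta> t = c * b \<and> deriv \<beta> t \<noteq> 0}"
    have "P (pt t b) = 0 \<Longrightarrow> deriv \<beta> t = 0" using t by (auto simp: P_def)
    from pos_mult_deriv[OF dP1 d\<beta>(2) this]
    have "((\<lambda>t. pos (P (pt t b)) * deriv \<beta> t) has_real_derivative
      - deriv \<beta> t * Hv (P (pt t b)) * deriv \<beta> t + pos (P (pt t b)) * deriv (deriv \<beta>) t) (at t)" .
    note D = DERIV_add[OF DERIV_mult[OF d\<Theta>(2) dsq1] DERIV_cmult[OF DERIV_mult[OF d\<Theta>(1) this], of "-2"]]
    show "((\<lambda>t. ?F1 (pt t b)) has_real_derivative ?F11 (pt t b)) (at t)"
      unfolding pt_nth by (rule DERIV_cong, rule D) (simp add: algebra_simps power2_eq_square)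
  next
    fix b
    show "continuous_on UNIV (\<lambda>t. ?F1 (pt t b))" by (rule lin1) (intro continuous_intros Pc Sc)
  qed (use L L11 fin in auto)
  moreover have "weak_deriv 2 ?F ?F2"
  proof (rule weak_deriv_line_2[where S="\<lambda>_. {}"])
    fix a t
    show "((\<lambda>t. ?F (pt a t)) has_real_derivative ?F2 (pt a t)) (at t)"
      using DERIV_cmult[OF dsq2, of "\<Theta> a"] by (simp add: algebra_simps)
    show "continuous_on UNIV (\<lambda>t. ?F (pt a t))" by (rule lin2) (intro continuous_intros Pc Sc)
  qed (use L in auto)
  moreover have "weak_deriv 2 ?F2 ?F22"
  \<comment> \<open>A vertical line meets the kink curve exactly once, since c > 0.\<close>
  proof (rule weak_deriv_line_2[where S="\<lambda>a. {\<beta> a / c}"])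
    fix a t assume "t \<notin> {\<beta> a / c}"
    then have "P (pt a t) \<noteq> 0" using c by (auto simp: P_def field_simps)
    from DERIV_cmult[OF DERIV_chain2[OF has_derivative_pos[OF this] dP2], of "2 * c * \<Theta> a"]
    show "((\<lambda>t. ?F2 (pt a t)) has_real_derivative ?F22 (pt a t)) (at t)"
      by (simp add: algebra_simps power2_eq_square)
  next
    fix a
    show "continuous_on UNIV (\<lambda>t. ?F2 (pt a t))" by (rule lin2) (intro continuous_intros Pc Sc)
  qed (use L L22 in auto)
  ultimately show ?thesis unfolding has_potential_def P_def by blast
qed

text \<open>One period of the laminate is \<open>[0, 1]\<close>; the second derivative of the profile
  \<open>\<Sum> \<kappa> (y - b(a))\<^sub>+\<^sup>2\<close> is \<open>+1\<close> on \<open>(0, a)\<close>, \<open>-1\<close> on \<open>(a, a + 1/4)\<close>, \<open>+1\<close> on \<open>(a + 1/4, 3/4 - a)\<close>,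
  \<open>-1\<close> on \<open>(3/4 - a, 1 - a)\<close> and \<open>+1\<close> on \<open>(1 - a, 1)\<close>. Moving \<open>a\<close> from \<open>1/4\<close> to \<open>1/8\<close> halves the period.\<close>

definition kap :: "nat \<Rightarrow> real" where "kap m = [1/2, -1, 1, -1, 1, -1/2] ! m"
definition bp0 :: "nat \<Rightarrow> real" where "bp0 m = [0, 0, 1/4, 3/4, 1, 1] ! m"
definition bp1 :: "nat \<Rightarrow> real" where "bp1 m = [0, 1, 1, -1, -1, 0] ! m"

definition brk :: "nat \<Rightarrow> real \<Rightarrow> real" where "brk m a = bp0 m + bp1 m * a"

definition cell :: "real \<Rightarrow> real \<Rightarrow> real" where
  "cell a y = (\<Sum>m<6. kap m * (pos (y - brk m a))\<^sup>2)"
text \<open>This and the next two are termwise derivatives of \<open>cell\<close>: once in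
  \<open>a\<close>, twice in \<open>a\<close>, twice in \<open>y\<close>, with \<open>Hv\<close> as
  the derivative of \<open>pos\<close>.\<close>

definition cell_a :: "real \<Rightarrow> real \<Rightarrow> real" where
  "cell_a a y = (\<Sum>m<6. kap m * (- 2 * bp1 m * pos (y - brk m a)))"
definition cell_aa :: "real \<Rightarrow> real \<Rightarrow> real" where
  "cell_aa a y = (\<Sum>m<6. kap m * (2 * (bp1 m)\<^sup>2 * Hv (y - brk m a)))"
definition cell_yy :: "real \<Rightarrow> real \<Rightarrow> real" where
  "cell_yy a y = (\<Sum>m<6. kap m * (2 * Hv (y - brk m a)))"

lemma sum6: "(\<Sum>m<6::nat. f m) = f 0 + f 1 + f 2 + f 3 + f 4 + (f 5 :: real)"
  by (simp add: eval_nat_numeral)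

lemmas cell_defs = cell_def cell_a_def cell_aa_def cell_yy_def sum6 brk_def kap_def bp0_def bp1_def

lemma cell_expand: "cell a y = (pos y)\<^sup>2 / 2 - (pos (y - a))\<^sup>2 + (pos (y - (1/4 + a)))\<^sup>2
    - (pos (y - (3/4 - a)))\<^sup>2 + (pos (y - (1 - a)))\<^sup>2 - (pos (y - 1))\<^sup>2 / 2"
  by (simp add: cell_defs)

text \<open>Beyond 1 every \<open>pos\<close> is active and \<open>cell\<close> is a quadratic
  polynomial in \<open>y\<close>. It vanishes because the weights \<open>kap\<close> annihilate the
  moments of order 0, 1 and 2 of the breakpoints for every \<open>a\<close>, so periods can be glued
  freely.\<close>

lemma cell_outside:
  assumes a: "1/8 \<le> a" "a \<le> 1/4" and y: "y \<le> 0 \<or> 1 < y"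
  shows "cell a y = 0" "cell_a a y = 0" "cell_aa a y = 0" "cell_yy a y = 0"
proof -
  show "cell a y = 0"
    using assms unfolding cell_expand by (auto simp: power2_eq_square field_simps)
  show "cell_a a y = 0" "cell_aa a y = 0" "cell_yy a y = 0"
    using assms by (auto simp: cell_defs)
qed

lemma cell_bounds:
  assumes a: "1/8 \<le> a" "a \<le> 1/4" 
  shows "\<bar>cell a y\<bar> \<le> 5" "\<bar>cell_a a y\<bar> \<le> 8" "\<bar>cell_aa a y\<bar> \<le> 8"
proof -
  have "\<bar>cell a y\<bar> \<le> 5 \<and> \<bar>cell_a a y\<bar> \<le> 8 \<and> \<bar>cell_aa a y\<bar> \<le> 8"
  proof (cases "y \<le> 0 \<or> 1 < y")
    case True then show ?thesis using cell_outside[OF a True] by simp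
  next
    case False
    have p: "0 \<le> pos (y - b)" "pos (y - b) \<le> 1" "0 \<le> (pos (y - b))\<^sup>2" "(pos (y - b))\<^sup>2 \<le> 1" if "0 \<le> b" for b
      using that False by (auto simp: power_le_one)
    have "\<bar>cell a y\<bar> \<le> 5"
    proof -
      have u: "0 \<le> (pos y)\<^sup>2" "(pos y)\<^sup>2 \<le> 1" using p(3,4)[of 0] by auto
      have v: "0 \<le> (pos (y - b))\<^sup>2 \<and> (pos (y - b))\<^sup>2 \<le> 1" if "b \<in> {a, 1/4 + a, 3/4 - a, 1 - a, 1}" for b
        using p(3,4)[of b] that a by auto
      have "\<bar>s0 / 2 - s1 + s2 - s3 + s4 - s5 / 2\<bar> \<le> 5" 
        if "0 \<le> s0 \<and> s0 \<le> 1" "0 \<le> s1 \<and> s1 \<le> 1" "0 \<le> s2 \<and> s2 \<le> 1" "0 \<le> s3 \<and> s3 \<le> 1" "0 \<le> s4 \<and> s4 \<le> 1" "0 \<le> s5 \<and> s5 \<le> 1"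
        for s0 s1 s2 s3 s4 s5 :: real using that by linarith
      then show ?thesis unfolding cell_expand using u v by auto
    qed
    moreover have "\<bar>cell_a a y\<bar> \<le> 8"
    proof -
      have v: "0 \<le> pos (y - b) \<and> pos (y - b) \<le> 1" if "b \<in> {a, 1/4 + a, 3/4 - a, 1 - a}" for b
        using p(1,2)[of b] that a by auto
      have eq: "cell_a a y = 2 * pos (y - a) - 2 * pos (y - (1/4 + a)) - 2 * pos (y - (3/4 - a)) + 2 * pos (y - (1 - a))"
        by (simp add: cell_defs)
      have "\<bar>2 * s1 - 2 * s2 - 2 * s3 + 2 * s4\<bar> \<le> 8" 
        if "0 \<le> s1 \<and> s1 \<le> 1" "0 \<le> s2 \<and> s2 \<le> 1" "0 \<le> s3 \<and> s3 \<le> 1" "0 \<le> s4 \<and> s4 \<le> 1"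
        for s1 s2 s3 s4 :: real using that by linarith
      then show ?thesis unfolding eq using v by auto
    qed
    moreover have "\<bar>cell_aa a y\<bar> \<le> 8"
      by (simp add: cell_defs eval_nat_numeral abs_le_iff)
    ultimately show ?thesis by simp
  qed
  then show "\<bar>cell a y\<bar> \<le> 5" "\<bar>cell_a a y\<bar> \<le> 8" "\<bar>cell_aa a y\<bar> \<le> 8" by auto
qed

lemma cell_yy_value:
  assumes a: "1/8 \<le> a" "a \<le> 1/4" and y: "0 < y" "y \<le> 1"
  shows "cell_yy a y = 1 - 2 * (of_bool (y \<in> {a<..a + 1/4}) + of_bool (y \<in> {3/4 - a<..1 - a}))"
    "of_bool (y \<in> {a<..a + 1/4}) + of_bool (y \<in> {3/4 - a<..1 - a}) \<in> {0, 1 :: real}"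
  using assms by (auto simp: cell_defs eval_nat_numeral)

text \<open>At a = 1/8 the negative part is (1/8, 3/8] and (5/8, 7/8], two half-size copies of (1/4,
  3/4]; the jumps at the common end 1/2 cancel. Successive levels hence match exactly.\<close>

lemma cell_yy_refine: "cell_yy (1/8) y = cell_yy (1/4) (2 * y) + cell_yy (1/4) (2 * y - 1)"
  by (auto simp: cell_defs eval_nat_numeral)

lemma transversal_affine:
  assumes "transversal a" shows "transversal (\<lambda>t. k + (b + d * a t))"
proof -
  have s: "smooth1 a" and f: "\<And>v. finite {t. a t = v \<and> deriv a t \<noteq> 0}" using assms by (auto simp: transversal_def)
  have d: "deriv (\<lambda>t. k + (b + d * a t)) = (\<lambda>t. d * deriv a t)"
    by (intro ext DERIV_imp_deriv) (rule derivative_eq_intros refl smooth1_deriv(1)[OF s] | simp)+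
  have "finite {t. k + (b + d * a t) = v \<and> d * deriv a t \<noteq> 0}" for v
    by (rule finite_subset[OF _ f[of "(v - k - b) / d"]]) (auto simp: field_simps)
  moreover have "smooth1 (\<lambda>t. k + (b + d * a t))"
    by (intro smooth1_add smooth1_mult smooth1_const s)
  ultimately show ?thesis unfolding transversal_def d by blast
qed

text \<open>The potential is h^2 \<Theta>(x_1) cell(a(x_1), x_2/h - k), a sum of six ridges whose
  kink curves are the moving breakpoints; the factor h^2 compensates two derivatives in x_2.\<close>

lemma has_potential_cell:
  fixes \<Theta> a :: "real \<Rightarrow> real" and k :: real
  assumes \<Theta>: "smooth1 \<Theta>" and a: "transversal a" and h: "h > 0"
  defines "y \<equiv> \<lambda>x::real^2. x $ 2 / h - k"
  shows "has_potential 
    (\<lambda>x. h\<^sup>2 * (deriv (deriv \<Theta>) (x $ 1) * cell (a (x $ 1)) (y x) + 2 * deriv \<Theta> (x $ 1) * deriv a (x $ 1) * cell_a (a (x $ 1)) (y x) 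
       + \<Theta> (x $ 1) * ((deriv a (x $ 1))\<^sup>2 * cell_aa (a (x $ 1)) (y x) + deriv (deriv a) (x $ 1) * cell_a (a (x $ 1)) (y x))))
    (\<lambda>x. \<Theta> (x $ 1) * cell_yy (a (x $ 1)) (y x))"
proof -
  define \<beta> where "\<beta> = (\<lambda>m t. k + (bp0 m + bp1 m * a t))"
  have \<beta>: "transversal (\<beta> m)" for m unfolding \<beta>_def by (rule transversal_affine[OF a])
  have s: "smooth1 a" using a by (simp add: transversal_def)
  have d1: "deriv (\<beta> m) = (\<lambda>t. bp1 m * deriv a t)" for m
    unfolding \<beta>_def by (intro ext DERIV_imp_deriv) (rule derivative_eq_intros refl smooth1_deriv(1)[OF s] | simp)+
  have d2: "deriv (deriv (\<beta> m)) = (\<lambda>t. bp1 m * deriv (deriv a) t)" for m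
    unfolding d1 by (intro ext DERIV_imp_deriv) (rule derivative_eq_intros refl smooth1_deriv(1)[OF smooth1_deriv(2)[OF s]] | simp)+
  have P: "(1/h) * x $ 2 - \<beta> m (x $ 1) = y x - brk m (a (x $ 1))" for m and x :: "real^2"
    by (simp add: y_def \<beta>_def brk_def)
  have c: "1 / h > 0" using h by simp
  let ?f = "\<lambda>m x. deriv (deriv \<Theta>) (x $ 1) * (pos (y x - brk m (a (x $ 1))))\<^sup>2 - 4 * deriv \<Theta> (x $ 1) * (bp1 m * deriv a (x $ 1)) * pos (y x - brk m (a (x $ 1)))
       + \<Theta> (x $ 1) * (2 * (bp1 m * deriv a (x $ 1))\<^sup>2 * Hv (y x - brk m (a (x $ 1))) - 2 * (bp1 m * deriv (deriv a) (x $ 1)) * pos (y x - brk m (a (x $ 1))))"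
  let ?g = "\<lambda>m x. 2 * (1/h)\<^sup>2 * \<Theta> (x $ 1) * Hv (y x - brk m (a (x $ 1)))"
  have "has_potential (?f m) (?g m)" for m
    using has_potential_ridge[OF \<Theta> \<beta>[of m] c, unfolded P d2, unfolded d1] .
  then have pot: "has_potential (\<lambda>x. h\<^sup>2 * (\<Sum>m<6. kap m * ?f m x)) (\<lambda>x. h\<^sup>2 * (\<Sum>m<6. kap m * ?g m x))"
    by (intro has_potential_scale has_potential_sum)
  have e1: "h\<^sup>2 * (\<Sum>m<6. kap m * ?f m x) = h\<^sup>2 * (deriv (deriv \<Theta>) (x $ 1) * cell (a (x $ 1)) (y x) + 2 * deriv \<Theta> (x $ 1) * deriv a (x $ 1) * cell_a (a (x $ 1)) (y x) 
       + \<Theta> (x $ 1) * ((deriv a (x $ 1))\<^sup>2 * cell_aa (a (x $ 1)) (y x) + deriv (deriv a) (x $ 1) * cell_a (a (x $ 1)) (y x)))" for x :: "real^2"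
    unfolding cell_def cell_a_def cell_aa_def sum_distrib_left sum.distrib[symmetric] distrib_left
    by (intro arg_cong2[where f=sum] refl ext) (simp add: algebra_simps power_mult_distrib)
  have e2: "h\<^sup>2 * (\<Sum>m<6. kap m * (2 * (1/h)\<^sup>2 * \<Theta> (x $ 1) * Hv (y x - brk m (a (x $ 1))))) = \<Theta> (x $ 1) * cell_yy (a (x $ 1)) (y x)" for x :: "real^2"
    unfolding cell_yy_def sum_distrib_left 
    using h by (intro arg_cong2[where f=sum] refl ext) (simp add: field_simps)
  show ?thesis using pot unfolding e1 e2 .
qed

section \<open>The branching pattern\<close>

text \<open>The second summand mirrors the first at t = 1/2. For 0 < l <= T <= 1/2 the profile is 1
  within distance T - l of the vertical sides and beyond them, and 0 at depth at least T.\<close>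

definition bump :: "real \<Rightarrow> real \<Rightarrow> real \<Rightarrow> real" where
  "bump T l t = sstep ((T - t) / l) + sstep ((T - 1 + t) / l)"

lemma smooth1_bump: "smooth1 (bump T l)"
proof -
  have "smooth1 (\<lambda>t. sstep ((-1/l) * t + T/l) + sstep ((1/l) * t + (T - 1)/l))"
    by (intro smooth1_add smooth1_affine smooth1_sstep)
  moreover have "(-1/l) * t + T/l = (T - t) / l" "(1/l) * t + (T - 1)/l = (T - 1 + t) / l" for t
    by (simp_all add: diff_divide_distrib add_divide_distrib)
  then have "(\<lambda>t. sstep ((-1/l) * t + T/l) + sstep ((1/l) * t + (T - 1)/l)) = bump T l"
    by (simp only: bump_def[abs_def])
  ultimately show ?thesis by simp
qed

lemma deriv_bump:
  "deriv (bump T l) = (\<lambda>t. (sstep' ((T - 1 + t) / l) - sstep' ((T - t) / l)) / l)"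
  "deriv (deriv (bump T l)) = (\<lambda>t. (sstep'' ((T - 1 + t) / l) + sstep'' ((T - t) / l)) / l\<^sup>2)"
proof -
  have a: "((\<lambda>t. (T - t) / l) has_real_derivative (-1/l)) (at t)" 
    and b: "((\<lambda>t. (T - 1 + t) / l) has_real_derivative (1/l)) (at t)" for t
    using DERIV_cmult[OF DERIV_diff[OF DERIV_const[of T] DERIV_ident], of "1/l" t] 
      DERIV_cmult[OF DERIV_add[OF DERIV_const[of "T - 1"] DERIV_ident], of "1/l" t] by auto
  show 1: "deriv (bump T l) = (\<lambda>t. (sstep' ((T - 1 + t) / l) - sstep' ((T - t) / l)) / l)"
  proof (intro ext DERIV_imp_deriv)
    fix t
    show "(bump T l has_real_derivative (sstep' ((T - 1 + t) / l) - sstep' ((T - t) / l)) / l) (at t)"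
      unfolding bump_def[abs_def]
      using DERIV_add[OF DERIV_chain2[OF sstep_deriv a] DERIV_chain2[OF sstep_deriv b]]
      by (rule DERIV_cong) (simp add: diff_divide_distrib)
  qed
  show "deriv (deriv (bump T l)) = (\<lambda>t. (sstep'' ((T - 1 + t) / l) + sstep'' ((T - t) / l)) / l\<^sup>2)"
    unfolding 1
  proof (intro ext DERIV_imp_deriv)
    fix t
    show "((\<lambda>t. (sstep' ((T - 1 + t) / l) - sstep' ((T - t) / l)) / l) has_real_derivative (sstep'' ((T - 1 + t) / l) + sstep'' ((T - t) / l)) / l\<^sup>2) (at t)"
      using DERIV_cdivide[OF DERIV_diff[OF DERIV_chain2[OF sstep_deriv2 b] DERIV_chain2[OF sstep_deriv2 a]], of l]
      by (rule DERIV_cong) (simp add: add_divide_distrib power2_eq_square)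
  qed
qed

context
  fixes T l :: real assumes l: "0 < l" "l \<le> T" "T \<le> 1/2"
begin

lemma bump_eq_0:
  assumes "T \<le> min t (1 - t)"
  shows "bump T l t = 0" "deriv (bump T l) t = 0" "deriv (deriv (bump T l)) t = 0"
proof -
  have k: "(T - t) / l \<le> 0" "(T - 1 + t) / l \<le> 0" using assms l by (auto simp: divide_le_0_iff)
  then show "bump T l t = 0" "deriv (bump T l) t = 0"
    by (auto simp: bump_def deriv_bump(1) sstep_0 sstep_1 sstep'_eq_0)
  show "deriv (deriv (bump T l)) t = 0"
    unfolding deriv_bump(2) using k by (auto simp: sstep''_eq_0)
qed

lemma bump_eq_1:
  assumes "min t (1 - t) \<le> T - l"
  shows "bump T l t = 1" "deriv (bump T l) t = 0" "deriv (deriv (bump T l)) t = 0"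
proof -
  have k: "((T - t) / l \<ge> 1 \<and> (T - 1 + t) / l \<le> 0) \<or> ((T - t) / l \<le> 0 \<and> (T - 1 + t) / l \<ge> 1)" 
    using assms l by (auto simp: divide_le_0_iff le_divide_eq min_def split: if_splits)
  then show "bump T l t = 1" "deriv (bump T l) t = 0"
    by (auto simp: bump_def deriv_bump(1) sstep_0 sstep_1 sstep'_eq_0)
  show "deriv (deriv (bump T l)) t = 0"
    unfolding deriv_bump(2) using k by (auto simp: sstep''_eq_0)
qed

lemma bump_bounds: "0 \<le> bump T l t" "bump T l t \<le> 1"
proof -
  have "(T - t) / l \<le> 0 \<or> (T - 1 + t) / l \<le> 0" using l by (auto simp: divide_le_0_iff)
  then show "0 \<le> bump T l t" "bump T l t \<le> 1"
    using sstep_bounds[of "(T - t) / l"] sstep_bounds[of "(T - 1 + t) / l"] 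
      sstep_0[of "(T - t) / l"] sstep_0[of "(T - 1 + t) / l"] by (auto simp: bump_def)
qed

lemma bump_deriv_bounds:
  assumes "\<And>s. \<bar>sstep' s\<bar> \<le> M" "\<And>s. \<bar>sstep'' s\<bar> \<le> M"
  shows "\<bar>deriv (bump T l) t\<bar> \<le> 2 * M / l" "\<bar>deriv (deriv (bump T l)) t\<bar> \<le> 2 * M / l\<^sup>2"
proof -
  have "\<bar>sstep' ((T - 1 + t) / l) - sstep' ((T - t) / l)\<bar> \<le> 2 * M"
    using assms(1)[of "(T - 1 + t) / l"] assms(1)[of "(T - t) / l"] by linarith
  then show "\<bar>deriv (bump T l) t\<bar> \<le> 2 * M / l"
    unfolding deriv_bump abs_divide using l by (simp add: divide_right_mono)
  have "\<bar>sstep'' ((T - 1 + t) / l) + sstep'' ((T - t) / l)\<bar> \<le> 2 * M"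
    using assms(2)[of "(T - 1 + t) / l"] assms(2)[of "(T - t) / l"] by linarith
  then show "\<bar>deriv (deriv (bump T l)) t\<bar> \<le> 2 * M / l\<^sup>2"
    unfolding deriv_bump(2) abs_divide using l by (simp add: divide_right_mono)
qed

lemma bump_antimono: assumes "s \<le> t" "t \<le> 1/2" shows "bump T l t \<le> bump T l s"
proof -
  have "(T - 1 + t) / l \<le> 0" "(T - 1 + s) / l \<le> 0" using assms l by (auto simp: divide_le_0_iff)
  moreover have "(T - t) / l \<le> (T - s) / l" using assms l by (auto simp: divide_right_mono)
  ultimately show ?thesis using sstep_mono by (simp add: bump_def sstep_0)
qed

lemma bump_reflect: "bump T l (1 - t) = bump T l t"
proof -
  have "T - (1 - t) = T - 1 + t" "T - 1 + (1 - t) = T - t" by auto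
  then show ?thesis unfolding bump_def by (simp only: add.commute)
qed

text \<open>The derivative lives on two transition intervals, and \<open>sstep_inj\<close> makes
  each value occur at most once on each.\<close>

lemma transversal_bump: "transversal (bump T l)"
  unfolding transversal_def
proof (intro conjI allI smooth1_bump)
  fix v
  let ?L = "{T - l<..<T}" and ?R = "{1 - T<..<1 - T + l}"
  have "{t. bump T l t = v \<and> deriv (bump T l) t \<noteq> 0} \<subseteq> (bump T l -` {v} \<inter> ?L) \<union> (bump T l -` {v} \<inter> ?R)"
  proof
    fix t assume "t \<in> {t. bump T l t = v \<and> deriv (bump T l) t \<noteq> 0}"
    then have t: "bump T l t = v" "deriv (bump T l) t \<noteq> 0" by auto
    have "\<not> T \<le> min t (1 - t)" "\<not> min t (1 - t) \<le> T - l" using t bump_eq_0 bump_eq_1 by auto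
    then have "t \<in> ?L \<union> ?R" by (auto simp: min_def split: if_splits)
    then show "t \<in> (bump T l -` {v} \<inter> ?L) \<union> (bump T l -` {v} \<inter> ?R)" using t by auto
  qed
  moreover have "inj_on (bump T l) ?L"
  proof (rule inj_onI)
    fix s t assume st: "s \<in> ?L" "t \<in> ?L" "bump T l s = bump T l t"
    then have "(T - 1 + t) / l \<le> 0" "(T - 1 + s) / l \<le> 0" using l by (auto simp: divide_le_0_iff)
    then have "sstep ((T - s) / l) = sstep ((T - t) / l)" using st(3) by (simp add: bump_def sstep_0)
    then have "(T - s) / l = (T - t) / l" 
      by (rule sstep_inj[rotated 4]) (use st(1,2) l in \<open>auto simp: divide_less_eq\<close>)
    then show "s = t" using l by simp
  qed
  moreover have "inj_on (bump T l) ?R"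
  proof (rule inj_onI)
    fix s t assume st: "s \<in> ?R" "t \<in> ?R" "bump T l s = bump T l t"
    then have "(T - t) / l \<le> 0" "(T - s) / l \<le> 0" using l by (auto simp: divide_le_0_iff)
    then have "sstep ((T - 1 + s) / l) = sstep ((T - 1 + t) / l)" using st(3) by (simp add: bump_def sstep_0)
    then have "(T - 1 + s) / l = (T - 1 + t) / l" 
      by (rule sstep_inj[rotated 4]) (use st(1,2) l in \<open>auto simp: divide_less_eq\<close>)
    then show "s = t" using l by simp
  qed
  ultimately show "finite {t. bump T l t = v \<and> deriv (bump T l) t \<noteq> 0}"
    by (meson finite.emptyI finite.insertI finite_Un finite_subset finite_vimage_IntI)
qed

end

definition len :: "nat \<Rightarrow> real" where "len j = (2/5) ^ j / 2"

text \<open>The transition width 3/5 is 1 - 2/5, so the parameter reaches 1/8 exactly at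
  \<open>len (Suc j)\<close>, where the next level takes over.\<close>

definition act :: "nat \<Rightarrow> real \<Rightarrow> real" where
  "act j t = 1/4 - bump (len j) (3/5 * len j) t / 8"

lemma len_pos: "0 < len j" and len_le: "len j \<le> 1/2" and len_Suc: "len (Suc j) = len j - 3/5 * len j"
  by (auto simp: len_def power_le_one)

lemma len_antimono: "i \<le> j \<Longrightarrow> len j \<le> len i"
  by (auto simp: len_def intro!: power_decreasing)

text \<open>Facts 1 to 3 instantiate the assumptions on \<open>bump\<close> for \<open>act\<close>;
  facts 4, 5 and 3 do so for the final cutoff, where l = T.\<close>

lemma len_bump: "0 < 3/5 * len j" "3/5 * len j \<le> len j" "len j \<le> 1/2" "0 < len j" "len j \<le> len j"
  using len_pos[of j] len_le[of j] by auto

lemma act_bounds: "1/8 \<le> act j t" "act j t \<le> 1/4"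
  using bump_bounds[OF len_bump(1-3), of j t] by (auto simp: act_def)

lemma transversal_act: "transversal (act j)"
proof -
  have "act j = (\<lambda>t. 0 + (1/4 + (-1/8) * bump (len j) (3/5 * len j) t))" by (auto simp: act_def fun_eq_iff)
  then show ?thesis using transversal_affine[OF transversal_bump[OF len_bump(1-3)]] by metis
qed

lemma deriv_act:
  "deriv (act j) = (\<lambda>t. - (deriv (bump (len j) (3/5 * len j)) t / 8))"
  "deriv (deriv (act j)) = (\<lambda>t. - (deriv (deriv (bump (len j) (3/5 * len j))) t / 8))"
proof -
  let ?B = "bump (len j) (3/5 * len j)"
  note d = smooth1_deriv(1)[OF smooth1_bump[of "len j" "3/5 * len j"]] 
    smooth1_deriv(1)[OF smooth1_deriv(2)[OF smooth1_bump[of "len j" "3/5 * len j"]]]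
  show 1: "deriv (act j) = (\<lambda>t. - (deriv ?B t / 8))"
  proof (intro ext DERIV_imp_deriv)
    fix t show "(act j has_real_derivative - (deriv ?B t / 8)) (at t)"
      unfolding act_def[abs_def] using DERIV_diff[OF DERIV_const DERIV_cdivide[OF d(1), of 8], of "1/4" t] by simp
  qed
  show "deriv (deriv (act j)) = (\<lambda>t. - (deriv (deriv ?B) t / 8))"
    unfolding 1
  proof (intro ext DERIV_imp_deriv)
    fix t show "((\<lambda>t. - (deriv ?B t / 8)) has_real_derivative - (deriv (deriv ?B) t / 8)) (at t)"
      using DERIV_minus[OF DERIV_cdivide[OF d(2), of 8], of t] by simp
  qed
qed

lemma act_far: 
  assumes "len j \<le> min t (1 - t)" shows "act j t = 1/4" "deriv (act j) t = 0" "deriv (deriv (act j)) t = 0"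
proof -
  note b = bump_eq_0[OF len_bump(1-3) assms]
  show "act j t = 1/4" using b by (simp add: act_def)
  show "deriv (act j) t = 0" using b by (simp add: deriv_act(1))
  show "deriv (deriv (act j)) t = 0" using b unfolding deriv_act(2) by simp
qed

lemma act_near:
  assumes "min t (1 - t) \<le> len (Suc j)" shows "act j t = 1/8" "deriv (act j) t = 0" "deriv (deriv (act j)) t = 0"
proof -
  note b = bump_eq_1[OF len_bump(1-3) assms[unfolded len_Suc]]
  show "act j t = 1/8" using b by (simp add: act_def)
  show "deriv (act j) t = 0" using b by (simp add: deriv_act(1))
  show "deriv (deriv (act j)) t = 0" using b unfolding deriv_act(2) by simp
qed

section \<open>Periodic stripes and their superposition\<close>

definition stripe :: "nat \<Rightarrow> real \<Rightarrow> real \<Rightarrow> real" where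
  "stripe n a y = (\<Sum>k<n. cell_yy a (y * real n - real k))"

lemma sum_pairs: "(\<Sum>k<2 * (m::nat). f k) = (\<Sum>k<m. f (2 * k) + f (2 * k + 1) :: real)"
  by (induction m) (auto simp: algebra_simps)

lemma stripe_refine: "stripe n (1/8) y = stripe (2 * n) (1/4) y"
  unfolding stripe_def sum_pairs cell_yy_refine
  by (intro arg_cong2[where f=sum] refl ext) (simp add: algebra_simps)

lemma periodic_sum:
  fixes f :: "real \<Rightarrow> real"
  assumes f: "\<And>z. z \<le> 0 \<or> 1 < z \<Longrightarrow> f z = 0" and y: "0 < y" "y \<le> 1" and n: "n > 0"
  obtains k where "k < n" "0 < y * real n - real k" "y * real n - real k \<le> 1"
    "(\<Sum>k<n. f (y * real n - real k)) = f (y * real n - real k)"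
    "\<And>k'. k' \<noteq> k \<Longrightarrow> y * real n - real k' \<le> 0 \<or> 1 < y * real n - real k'"
proof -
  have yn: "0 < y * real n" "y * real n \<le> real n" using y n by (auto simp: mult_le_cancel_right1)
  \<comment> \<open>Ceiling minus one, because the periods (k, k + 1] are closed on the
    right.\<close>
  define k where "k = nat (\<lceil>y * real n\<rceil> - 1)"
  have ce: "1 \<le> \<lceil>y * real n\<rceil>" using yn by (simp add: one_le_ceiling)
  then have rk: "real k = real_of_int \<lceil>y * real n\<rceil> - 1" by (simp add: k_def)
  have k1: "0 < y * real n - real k" "y * real n - real k \<le> 1" unfolding rk by linarith+
  have "real k < real n" using k1 yn by linarith
  then have kn: "k < n" by simp
  have oth: "y * real n - real k' \<le> 0 \<or> 1 < y * real n - real k'" if "k' \<noteq> k" for k'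
  proof (cases "k' < k")
    case True then have "real k' + 1 \<le> real k" by linarith
    then show ?thesis using k1 by linarith
  next
    case False then have "real k + 1 \<le> real k'" using that by linarith
    then show ?thesis using k1 by linarith
  qed
  have "(\<Sum>k<n. f (y * real n - real k)) = (\<Sum>k\<in>{k}. f (y * real n - real k))"
    by (rule sum.mono_neutral_right) (use kn oth f in auto)
  then show ?thesis using that[OF kn k1 _ oth] by simp
qed

lemma periodic_sum_outside:
  fixes f :: "real \<Rightarrow> real"
  assumes f: "\<And>z. z \<le> 0 \<or> 1 < z \<Longrightarrow> f z = 0" and y: "y \<le> 0 \<or> 1 < y"
  shows "(\<Sum>k<n. f (y * real n - real k)) = 0"
proof (rule sum.neutral, rule ballI, rule f)
  fix k assume k: "k \<in> {..<n}"
  from y show "y * real n - real k \<le> 0 \<or> 1 < y * real n - real k"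
  proof
    assume "y \<le> 0"
    then have "y * real n \<le> 0" by (simp add: mult_nonpos_nonneg)
    then show ?thesis by linarith
  next
    assume "1 < y"
    moreover have "real k + 1 \<le> real n" using k by auto
    moreover have "n > 0" using k by auto
    ultimately have "real n < y * real n" by simp
    then show ?thesis using \<open>real k + 1 \<le> real n\<close> by linarith
  qed
qed

text \<open>The periods are disjoint, so the bound does not grow with \<open>n\<close>.\<close>

lemma periodic_sum_bound:
  fixes f :: "real \<Rightarrow> real"
  assumes f: "\<And>z. z \<le> 0 \<or> 1 < z \<Longrightarrow> f z = 0" and b: "\<And>z. \<bar>f z\<bar> \<le> B"
  shows "\<bar>\<Sum>k<n. f (y * real n - real k)\<bar> \<le> B"
proof (cases "0 < y \<and> y \<le> 1 \<and> n > 0")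
  case True
  then obtain k where "(\<Sum>k<n. f (y * real n - real k)) = f (y * real n - real k)"
    using periodic_sum[of f y n, OF f] by blast
  then show ?thesis using b by simp
next
  case False
  then have "(\<Sum>k<n. f (y * real n - real k)) = 0"
    using periodic_sum_outside[of f y n, OF f] by (cases "n = 0") auto
  then show ?thesis using b[of 0] by simp
qed

lemma stripe_outside: "1/8 \<le> a \<Longrightarrow> a \<le> 1/4 \<Longrightarrow> y \<le> 0 \<or> 1 < y \<Longrightarrow> stripe n a y = 0"
  unfolding stripe_def by (rule periodic_sum_outside) (auto intro: cell_outside)

text \<open>Level \<open>j\<close> has \<open>N 2\<^sup>j\<close> periods and the refinement to level \<open>j + 1\<close> takes place at
  distances between \<open>len (j + 1)\<close> and \<open>len j\<close> from the vertical sides. The pattern is written as a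
  telescoping sum, so that every summand is smooth across the levels.\<close>

definition pattern :: "nat \<Rightarrow> nat \<Rightarrow> real^2 \<Rightarrow> real" where
  "pattern N J x = stripe N (1/4) (x $ 2) + 
     (\<Sum>j<J. stripe (N * 2 ^ j) (act j (x $ 1)) (x $ 2) - stripe (N * 2 ^ j) (1/4) (x $ 2))"

text \<open>The last level is switched off over the width \<open>len J\<close>. At the vertical
  sides and beyond, the pattern equals the subtracted stripes, so the boundary condition holds
  exactly.\<close>

definition pat22 :: "nat \<Rightarrow> nat \<Rightarrow> real^2 \<Rightarrow> real" where
  "pat22 N J x = pattern N J x - bump (len J) (len J) (x $ 1) * stripe (N * 2 ^ J) (1/4) (x $ 2)"

definition bend :: "nat \<Rightarrow> nat \<Rightarrow> real^2 \<Rightarrow> real" where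
  "bend n j x = (\<Sum>k<n. (deriv (act j) (x $ 1))\<^sup>2 * cell_aa (act j (x $ 1)) (x $ 2 * real n - real k)
       + deriv (deriv (act j)) (x $ 1) * cell_a (act j (x $ 1)) (x $ 2 * real n - real k)) / (real n)\<^sup>2"

text \<open>Stripes with a constant parameter depend on x_2 only and do not bend; bending comes from
  the moving breakpoints and from the final cutoff.\<close>

definition pat11 :: "nat \<Rightarrow> nat \<Rightarrow> real^2 \<Rightarrow> real" where
  "pat11 N J x = (\<Sum>j<J. bend (N * 2 ^ j) j x) - 
     deriv (deriv (bump (len J) (len J))) (x $ 1) * (\<Sum>k<N * 2 ^ J. cell (1/4) (x $ 2 * real (N * 2 ^ J) - real k)) / (real (N * 2 ^ J))\<^sup>2"

lemma transversal_const: "transversal (\<lambda>t. c)"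
  by (simp add: transversal_def smooth1_const)

lemma has_potential_stripe:
  assumes n: "n > 0"
  shows "has_potential (\<lambda>x. 0) (\<lambda>x. stripe n (1/4) (x $ 2))"
    and "has_potential (bend n j) (\<lambda>x. stripe n (act j (x $ 1)) (x $ 2))"
    and "has_potential (\<lambda>x. deriv (deriv (bump T l)) (x $ 1) * (\<Sum>k<n. cell (1/4) (x $ 2 * real n - real k)) / (real n)\<^sup>2)
          (\<lambda>x. bump T l (x $ 1) * stripe n (1/4) (x $ 2))"
proof -
  have h: "1 / real n > 0" using n by simp
  have "has_potential (\<lambda>x. \<Sum>k<n. 0) (\<lambda>x. \<Sum>k<n. cell_yy (1/4) (x $ 2 * real n - real k))"
    using has_potential_cell[OF smooth1_const[of 1] transversal_const[of "1/4"] h]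
    by (intro has_potential_sum) simp
  then show "has_potential (\<lambda>x. 0) (\<lambda>x. stripe n (1/4) (x $ 2))" by (simp add: stripe_def)
  have "has_potential (\<lambda>x. \<Sum>k<n. ((deriv (act j) (x $ 1))\<^sup>2 * cell_aa (act j (x $ 1)) (x $ 2 * real n - real k)
       + deriv (deriv (act j)) (x $ 1) * cell_a (act j (x $ 1)) (x $ 2 * real n - real k)) / (real n)\<^sup>2) 
      (\<lambda>x. \<Sum>k<n. cell_yy (act j (x $ 1)) (x $ 2 * real n - real k))"
    using has_potential_cell[OF smooth1_const[of 1] transversal_act[of j] h]
    by (intro has_potential_sum) (simp add: power_divide)
  then show "has_potential (bend n j) (\<lambda>x. stripe n (act j (x $ 1)) (x $ 2))" 
    by (simp add: stripe_def bend_def[abs_def] sum_divide_distrib)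
  have "has_potential (\<lambda>x. \<Sum>k<n. deriv (deriv (bump T l)) (x $ 1) * cell (1/4) (x $ 2 * real n - real k) / (real n)\<^sup>2)
     (\<lambda>x. \<Sum>k<n. bump T l (x $ 1) * cell_yy (1/4) (x $ 2 * real n - real k))"
    using has_potential_cell[OF smooth1_bump[of T l] transversal_const[of "1/4"] h]
    by (intro has_potential_sum) (simp add: power_divide)
  then show "has_potential (\<lambda>x. deriv (deriv (bump T l)) (x $ 1) * (\<Sum>k<n. cell (1/4) (x $ 2 * real n - real k)) / (real n)\<^sup>2)
          (\<lambda>x. bump T l (x $ 1) * stripe n (1/4) (x $ 2))"
    by (simp add: stripe_def sum_divide_distrib sum_distrib_left)
qed

lemma has_potential_pattern:
  assumes N: "N > 0"
  shows "has_potential (pat11 N J) (pat22 N J)"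
proof -
  have n: "N * 2 ^ j > 0" for j using N by simp
  note pot = has_potential_add[OF has_potential_add[OF has_potential_stripe(1)[OF N] 
      has_potential_sum[where I="{..<J}", OF has_potential_add[OF has_potential_stripe(2)[OF n] has_potential_scale[OF has_potential_stripe(1)[OF n], where c="-1"]]]]
      has_potential_scale[OF has_potential_stripe(3)[OF n[of J], of "len J" "len J"], of "-1"]]
  have "has_potential (\<lambda>x. (0 + (\<Sum>j<J. bend (N * 2 ^ j) j x + (-1) * 0)) + (-1) * (deriv (deriv (bump (len J) (len J))) (x $ 1) * (\<Sum>k<N * 2 ^ J. cell (1/4) (x $ 2 * real (N * 2 ^ J) - real k)) / (real (N * 2 ^ J))\<^sup>2))
     (\<lambda>x. (stripe N (1/4) (x $ 2) + (\<Sum>j<J. stripe (N * 2 ^ j) (act j (x $ 1)) (x $ 2) + (-1) * stripe (N * 2 ^ j) (1/4) (x $ 2))) + (-1) * (bump (len J) (len J) (x $ 1) * stripe (N * 2 ^ J) (1/4) (x $ 2)))"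
    by (intro has_potential_add has_potential_sum has_potential_scale has_potential_stripe N n)
  then show ?thesis by (simp add: pat11_def[abs_def] pat22_def[abs_def] pattern_def)
qed

text \<open>Below \<open>i\<close> each summand is, by \<open>stripe_refine\<close>, the difference
  of two consecutive unrefined stripes and telescopes; above \<open>i\<close> the summands
  vanish.\<close>

lemma pattern_level:
  assumes i: "i < J" "\<And>j. j < i \<Longrightarrow> act j (x $ 1) = 1/8" "\<And>j. i < j \<Longrightarrow> j < J \<Longrightarrow> act j (x $ 1) = 1/4"
  shows "pattern N J x = stripe (N * 2 ^ i) (act i (x $ 1)) (x $ 2)"
proof -
  let ?g = "\<lambda>j. stripe (N * 2 ^ j) (1/4) (x $ 2)"
  let ?d = "\<lambda>j. stripe (N * 2 ^ j) (act j (x $ 1)) (x $ 2) - ?g j"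
  have "{..<J} = {..<i} \<union> {i..<J}" using i(1) by auto
  then have "(\<Sum>j<J. ?d j) = (\<Sum>j<i. ?d j) + (\<Sum>j\<in>{i..<J}. ?d j)"
    by (simp add: sum.union_disjoint ivl_disj_int)
  also have "(\<Sum>j<i. ?d j) = (\<Sum>j<i. ?g (Suc j) - ?g j)"
    by (intro sum.cong refl) (simp only: lessThan_iff i(2) stripe_refine, simp add: mult_ac)
  also have "\<dots> = ?g i - ?g 0" by (rule sum_lessThan_telescope)
  also have "(\<Sum>j\<in>{i..<J}. ?d j) = (\<Sum>j\<in>{i}. ?d j)"
  proof (rule sum.mono_neutral_right)
    show "\<forall>j\<in>{i..<J} - {i}. ?d j = 0"
    proof
      fix j assume "j \<in> {i..<J} - {i}"
      then have "act j (x $ 1) = 1/4" by (intro i(3)) auto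
      then show "?d j = 0" by (simp only: diff_self)
    qed
  qed (use i(1) in auto)
  finally show ?thesis by (simp add: pattern_def)
qed

lemma level_exists:
  assumes t: "0 < t" "t < 1" and J: "0 < J"
  shows "\<exists>i<J. min t (1 - t) \<le> len i \<and> (Suc i < J \<longrightarrow> len (Suc i) < min t (1 - t)) \<and>
    (\<forall>j<i. min t (1 - t) \<le> len (Suc j)) \<and> (\<forall>j. i < j \<and> j < J \<longrightarrow> len j < min t (1 - t))"
proof -
  let ?d = "min t (1 - t)"
  let ?A = "{j. j < J \<and> ?d \<le> len j}"
  have "0 \<in> ?A" using J t by (auto simp: len_def min_def)
  then have ne: "finite ?A" "?A \<noteq> {}" by auto
  \<comment> \<open>The last level that still covers this distance. For i = J - 1 there is no lower
    limit, as that level extends to the sides.\<close>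
  define i where "i = Max ?A"
  have i: "i \<in> ?A" unfolding i_def using ne by (rule Max_in)
  have up: "len j < ?d" if "i < j" "j < J" for j
  proof (rule ccontr)
    assume "\<not> len j < ?d"
    then have "j \<in> ?A" using that by auto
    then have "j \<le> i" unfolding i_def using ne(1) by (rule Max_ge[rotated])
    then show False using that by simp
  qed
  have "?d \<le> len (Suc j)" if "j < i" for j
    using i len_antimono[of "Suc j" i] that by auto
  then show ?thesis using i up by (intro exI[of _ i]) auto
qed

lemma level_act:
  assumes "min t (1 - t) \<le> len i"
    "\<And>j. j < i \<Longrightarrow> min t (1 - t) \<le> len (Suc j)" "\<And>j. i < j \<Longrightarrow> j < J \<Longrightarrow> len j < min t (1 - t)"
  shows "j < i \<Longrightarrow> act j t = 1/8" "i < j \<Longrightarrow> j < J \<Longrightarrow> act j t = 1/4"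
    "j \<noteq> i \<Longrightarrow> j < J \<Longrightarrow> deriv (act j) t = 0 \<and> deriv (deriv (act j)) t = 0"
  using act_near[of t j] act_far[of j t] assms(2)[of j] assms(3)[of j] 
  by (auto simp: nat_neq_iff)

text \<open>Above and below the square every cell vanishes. To its left and right all levels are
  fully refined and the cutoff is 1, so the last stripes cancel.\<close>

lemma pat_outside:
  assumes "x \<notin> unit_square" and J: "0 < J"
  shows "pat11 N J x = 0" "pat22 N J x = 0"
proof -
  have "pat11 N J x = 0 \<and> pat22 N J x = 0"
  proof (cases "x $ 2 \<in> {0..1}")
    case False
    then have y: "x $ 2 \<le> 0 \<or> 1 < x $ 2" by auto
    have "bend n j x = 0" for n j
      unfolding bend_def using periodic_sum_outside[OF _ y, of "\<lambda>z. (deriv (act j) (x $ 1))\<^sup>2 * cell_aa (act j (x $ 1)) z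
       + deriv (deriv (act j)) (x $ 1) * cell_a (act j (x $ 1)) z" n] cell_outside[OF act_bounds]
      by simp
    moreover have "(\<Sum>k<n. cell (1/4) (x $ 2 * real n - real k)) = 0" for n
      by (rule periodic_sum_outside[OF _ y]) (auto intro: cell_outside)
    moreover have "stripe n (act j t) (x $ 2) = 0" "stripe n (1/4) (x $ 2) = 0" for n j t
      by (rule stripe_outside[OF _ _ y]; simp add: act_bounds[simplified])+
    ultimately show ?thesis by (simp add: pat11_def pat22_def pattern_def del: of_nat_mult)
  next
    case True
    then have "min (x $ 1) (1 - x $ 1) \<le> 0" using assms by (auto simp: cbox_real2)
    then have d: "min (x $ 1) (1 - x $ 1) \<le> len (Suc j)" for j using len_pos[of "Suc j"] by linarith
    note a = act_near[OF d]
    have "bend n j x = 0" for n j by (simp add: bend_def a)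
    moreover have b: "bump (len J) (len J) (x $ 1) = 1" "deriv (deriv (bump (len J) (len J))) (x $ 1) = 0"
      using bump_eq_1[OF len_bump(4,5,3), of "x $ 1" J] \<open>min (x $ 1) (1 - x $ 1) \<le> 0\<close> by auto
    moreover have "pattern N J x = stripe (N * 2 ^ (J - 1)) (act (J - 1) (x $ 1)) (x $ 2)"
      by (rule pattern_level) (use J a in auto)
    moreover have "\<dots> = stripe (N * 2 ^ J) (1/4) (x $ 2)"
      using J stripe_refine[of "N * 2 ^ (J - 1)" "x $ 2"] by (cases J) (auto simp: a mult_ac)
    ultimately show ?thesis by (simp add: pat11_def pat22_def)
  qed
  then show "pat11 N J x = 0" "pat22 N J x = 0" by auto
qed

section \<open>The energy of the branching pattern\<close>

definition phase :: "nat \<Rightarrow> nat \<Rightarrow> real^2 \<Rightarrow> real" where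
  "phase N J x = of_bool (pattern N J x < 0)"

definition strain :: "real \<Rightarrow> nat \<Rightarrow> nat \<Rightarrow> real^2 \<Rightarrow> real^2^2" where
  "strain \<alpha> N J x = mat2 (1 - \<alpha> * pat11 N J x) 0 (1 + \<alpha> * pat22 N J x)"

lemma has_potential_measurable:
  assumes "has_potential f g" shows "f \<in> borel_measurable borel" "g \<in> borel_measurable borel"
  using assms unfolding has_potential_def weak_deriv_def by (auto intro: loc_bdd_measurable)

lemma strain_admissible:
  assumes N: "N > 0" and J: "J > 0"
  shows "strain \<alpha> N J \<in> D_curl_curl (mat 1)" "\<exists>v. has_sym_grad v (strain \<alpha> N J)"
proof -
  obtain \<psi> \<psi>1 \<psi>2 where \<psi>: "weak_deriv 1 \<psi> \<psi>1" "weak_deriv 1 \<psi>1 (\<lambda>x. \<alpha> * pat11 N J x)"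
      "weak_deriv 2 \<psi> \<psi>2" "weak_deriv 2 \<psi>2 (\<lambda>x. \<alpha> * pat22 N J x)"
    using has_potential_scale[OF has_potential_pattern[OF N]] unfolding has_potential_def by blast
  have "(\<lambda>x. mat2 (1 - \<alpha> * pat11 N J x) 0 (1 + \<alpha> * pat22 N J x)) = strain \<alpha> N J"
    by (simp add: fun_eq_iff strain_def)
  note P = potential_competitor[OF \<psi>, unfolded this]
  show "\<exists>v. has_sym_grad v (strain \<alpha> N J)" using P(1) by blast
  have "strain \<alpha> N J x = mat 1" if "x \<notin> unit_square" for x
    using pat_outside[OF that J] by (simp add: strain_def mat_1_eq)
  then show "strain \<alpha> N J \<in> D_curl_curl (mat 1)"
    using P(2,3) unfolding D_curl_curl_def by (auto simp: strain_def transpose_mat2)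
qed

definition dst :: "real^2 \<Rightarrow> real" where "dst x = min (x $ 1) (1 - x $ 1)"

lemma level_values:
  assumes x: "x \<in> box 0 1" and N: "N > 0" and J: "J > 0"
  shows "\<exists>i. i < J \<and> dst x \<le> len i \<and> (Suc i < J \<longrightarrow> len (Suc i) < dst x) \<and>
    (\<forall>j<i. dst x \<le> len (Suc j)) \<and> (\<forall>j. i < j \<and> j < J \<longrightarrow> len j < dst x) \<and>
    pattern N J x = stripe (N * 2 ^ i) (act i (x $ 1)) (x $ 2) \<and>
    (\<forall>j<J. j \<noteq> i \<longrightarrow> deriv (act j) (x $ 1) = 0 \<and> deriv (deriv (act j)) (x $ 1) = 0)"
proof -
  have t: "0 < x $ 1" "x $ 1 < 1" using x by (auto simp: box_real2)
  obtain i where i': "i < J" "min (x $ 1) (1 - x $ 1) \<le> len i" "Suc i < J \<longrightarrow> len (Suc i) < min (x $ 1) (1 - x $ 1)"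
    "\<forall>j<i. min (x $ 1) (1 - x $ 1) \<le> len (Suc j)" "\<forall>j. i < j \<and> j < J \<longrightarrow> len j < min (x $ 1) (1 - x $ 1)"
    using level_exists[OF t J] by auto
  then have i: "i < J" "min (x $ 1) (1 - x $ 1) \<le> len i" "Suc i < J \<Longrightarrow> len (Suc i) < min (x $ 1) (1 - x $ 1)"
    "\<And>j. j < i \<Longrightarrow> min (x $ 1) (1 - x $ 1) \<le> len (Suc j)" "\<And>j. i < j \<Longrightarrow> j < J \<Longrightarrow> len j < min (x $ 1) (1 - x $ 1)"
    by auto
  note a = level_act[OF i(2) i(4) i(5)]
  have "pattern N J x = stripe (N * 2 ^ i) (act i (x $ 1)) (x $ 2)"
    by (rule pattern_level[OF i(1) a(1) a(2)])
  moreover have "\<forall>j<J. j \<noteq> i \<longrightarrow> deriv (act j) (x $ 1) = 0 \<and> deriv (deriv (act j)) (x $ 1) = 0"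
    using a(3) by blast
  ultimately show ?thesis using i' unfolding dst_def by blast
qed

text \<open>The part of one period on which the laminate takes the value -1, that is, where the
  phase is 1.\<close>

definition minority :: "real \<Rightarrow> real \<Rightarrow> real" where
  "minority a z = of_bool (z \<in> {a<..a + 1/4}) + of_bool (z \<in> {3/4 - a<..1 - a})"

lemma minority_outside: "1/8 \<le> a \<Longrightarrow> a \<le> 1/4 \<Longrightarrow> z \<le> 0 \<or> 1 < z \<Longrightarrow> minority a z = 0"
  by (auto simp: minority_def)

lemma stripe_minority:
  assumes a: "1/8 \<le> a" "a \<le> 1/4" and y: "0 < y" "y \<le> 1" and n: "n > 0"
  shows "stripe n a y = 1 - 2 * (\<Sum>k<n. minority a (y * real n - real k))"
    "(\<Sum>k<n. minority a (y * real n - real k)) \<in> {0, 1}"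
proof -
  obtain k where k: "k < n" "0 < y * real n - real k" "y * real n - real k \<le> 1"
    "\<And>k'. k' \<noteq> k \<Longrightarrow> y * real n - real k' \<le> 0 \<or> 1 < y * real n - real k'"
    using periodic_sum[of "\<lambda>_. 0" y n, OF _ y n] by blast
  have s: "(\<Sum>k<n. f (y * real n - real k)) = f (y * real n - real k)" if "\<And>z. z \<le> 0 \<or> 1 < z \<Longrightarrow> f z = 0" for f :: "real \<Rightarrow> real"
  proof -
    have "(\<Sum>k<n. f (y * real n - real k)) = (\<Sum>k\<in>{k}. f (y * real n - real k))"
      by (rule sum.mono_neutral_right) (use k that in auto)
    then show ?thesis by simp
  qed
  have 1: "stripe n a y = cell_yy a (y * real n - real k)"
    unfolding stripe_def by (rule s) (rule cell_outside[OF a])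
  have 2: "(\<Sum>k<n. minority a (y * real n - real k)) = minority a (y * real n - real k)"
    by (rule s) (rule minority_outside[OF a])
  show "stripe n a y = 1 - 2 * (\<Sum>k<n. minority a (y * real n - real k))"
    unfolding 1 2 using cell_yy_value(1)[OF a k(2,3)] by (simp only: minority_def)
  show "(\<Sum>k<n. minority a (y * real n - real k)) \<in> {0, 1}"
    unfolding 2 using cell_yy_value(2)[OF a k(2,3)] by (simp only: minority_def)
qed

lemma pattern_phase:
  assumes x: "x \<in> box 0 1" and N: "N > 0" and J: "J > 0"
  shows "pattern N J x = 1 - 2 * phase N J x"
proof -
  obtain i where i: "pattern N J x = stripe (N * 2 ^ i) (act i (x $ 1)) (x $ 2)"
    using level_values[OF x N J] by blast
  have y: "0 < x $ 2" "x $ 2 \<le> 1" using x by (auto simp: box_real2)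
  have n: "N * 2 ^ i > 0" using N by simp
  show ?thesis
    using stripe_minority(1)[OF act_bounds y n, of i "x $ 1"] stripe_minority(2)[OF act_bounds[of i "x $ 1"] y n]
    unfolding i phase_def by (elim insertE emptyE) simp_all
qed

lemma stripe_bound: "1/8 \<le> a \<Longrightarrow> a \<le> 1/4 \<Longrightarrow> \<bar>stripe n a y\<bar> \<le> 1"
  unfolding stripe_def
proof (rule periodic_sum_bound)
  fix z assume a: "1/8 \<le> a" "a \<le> 1/4"
  show "\<bar>cell_yy a z\<bar> \<le> 1"
  proof (cases "0 < z \<and> z \<le> 1")
    case True then show ?thesis using cell_yy_value[OF a, of z] by auto
  next
    case False then show ?thesis using cell_outside(4)[OF a, of z] by auto
  qed
qed (rule cell_outside)

text \<open>Scaling: the potential of a level has size n^-2 and varies in x_1 on the length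
  \<open>len j\<close>.\<close>

lemma bend_bound:
  assumes M: "1 \<le> M" "\<And>s. \<bar>sstep' s\<bar> \<le> M" "\<And>s. \<bar>sstep'' s\<bar> \<le> M"
  shows "\<bar>bend n j x\<bar> \<le> 8 * M\<^sup>2 / (len j * real n)\<^sup>2"
proof -
  define A where "A = deriv (act j) (x $ 1)"
  define B where "B = deriv (deriv (act j)) (x $ 1)"
  define a where "a = act j (x $ 1)"
  have a: "1/8 \<le> a" "a \<le> 1/4" unfolding a_def by (rule act_bounds)+
  note L = len_pos[of j]
  \<comment> \<open>Amplitude 1/8 over the transition length 3/5 of \<open>len j\<close>: 2/8 times
    5/3 is 5/12, and 2/8 times 25/9 is 25/36 for the second derivative.\<close>
  have A: "\<bar>A\<bar> \<le> 5 * M / (12 * len j)"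
    using bump_deriv_bounds(1)[OF len_bump(1-3)[of j] M(2,3), of "x $ 1"] L unfolding A_def deriv_act(1) by simp
  have B: "\<bar>B\<bar> \<le> 25 * M / (36 * (len j)\<^sup>2)"
    using bump_deriv_bounds(2)[OF len_bump(1-3)[of j] M(2,3), of "x $ 1"] L unfolding B_def deriv_act(2) by (simp add: power_mult_distrib power_divide)
  have A2: "A\<^sup>2 \<le> (5 * M / (12 * len j))\<^sup>2" using A by (metis abs_ge_zero power2_abs power_mono)
  have "\<bar>\<Sum>k<n. A\<^sup>2 * cell_aa a (x $ 2 * real n - real k) + B * cell_a a (x $ 2 * real n - real k)\<bar> \<le> A\<^sup>2 * 8 + \<bar>B\<bar> * 8"
  proof (rule periodic_sum_bound)
    fix z
    have "\<bar>A\<^sup>2 * cell_aa a z\<bar> \<le> A\<^sup>2 * 8" unfolding abs_mult using cell_bounds[OF a] by (intro mult_mono) auto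
    moreover have "\<bar>B * cell_a a z\<bar> \<le> \<bar>B\<bar> * 8" unfolding abs_mult using cell_bounds[OF a] by (intro mult_mono) auto
    ultimately show "\<bar>A\<^sup>2 * cell_aa a z + B * cell_a a z\<bar> \<le> A\<^sup>2 * 8 + \<bar>B\<bar> * 8" by linarith
  qed (use cell_outside[OF a] in simp)
  also have "\<dots> \<le> (5 * M / (12 * len j))\<^sup>2 * 8 + (25 * M / (36 * (len j)\<^sup>2)) * 8"
    using A2 B by (intro add_mono mult_right_mono) auto
  also have "\<dots> = (25/18 * M\<^sup>2 + 50/9 * M) / (len j)\<^sup>2"
    using L by (simp add: power_mult_distrib power_divide field_simps)
  also have "\<dots> \<le> (8 * M\<^sup>2) / (len j)\<^sup>2"
  proof (rule divide_right_mono)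
    have "M * 1 \<le> M * M" using M by (intro mult_left_mono) auto
    then have "M \<le> M\<^sup>2" by (simp add: power2_eq_square)
    then show "25/18 * M\<^sup>2 + 50/9 * M \<le> 8 * M\<^sup>2" using M by simp
  qed simp
  finally have "\<bar>\<Sum>k<n. A\<^sup>2 * cell_aa a (x $ 2 * real n - real k) + B * cell_a a (x $ 2 * real n - real k)\<bar> / (real n)\<^sup>2 \<le> (8 * M\<^sup>2) / (len j)\<^sup>2 / (real n)\<^sup>2"
    by (rule divide_right_mono) simp
  then show ?thesis unfolding bend_def A_def B_def a_def by (simp add: power_mult_distrib)
qed

text \<open>At a given point only one level bends, so there are no cross terms between levels; the
  final cutoff is separated by (b - c)^2 <= 2 b^2 + 2 c^2. The summand 1 pays for the layer in which
  the stripes are switched off.\<close>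

lemma elastic_pointwise:
  assumes M: "1 \<le> M" "\<And>s. \<bar>sstep' s\<bar> \<le> M" "\<And>s. \<bar>sstep'' s\<bar> \<le> M"
    and x: "x \<in> box 0 1" and N: "N > 0" and J: "J > 0"
  shows "(pat11 N J x)\<^sup>2 + (pat22 N J x - pattern N J x)\<^sup>2 \<le> 
    (\<Sum>j<J. 128 * M ^ 4 / (len j * real (N * 2 ^ j)) ^ 4 * of_bool (dst x \<le> len j)) 
      + (200 * M\<^sup>2 / (len J * real (N * 2 ^ J)) ^ 4 + 1) * of_bool (dst x \<le> len J)"
proof -
  obtain i where i: "i < J" "dst x \<le> len i"
    "\<forall>j<J. j \<noteq> i \<longrightarrow> deriv (act j) (x $ 1) = 0 \<and> deriv (deriv (act j)) (x $ 1) = 0"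
    using level_values[OF x N J] by blast
  define b where "b = (\<Sum>j<J. bend (N * 2 ^ j) j x)"
  define n where "n = N * 2 ^ J"
  define c where "c = deriv (deriv (bump (len J) (len J))) (x $ 1) * (\<Sum>k<n. cell (1/4) (x $ 2 * real n - real k)) / (real n)\<^sup>2"
  have "b = (\<Sum>j\<in>{i}. bend (N * 2 ^ j) j x)" unfolding b_def
    by (rule sum.mono_neutral_right) (use i in \<open>auto simp: bend_def\<close>)
  then have "\<bar>b\<bar> \<le> 8 * M\<^sup>2 / (len i * real (N * 2 ^ i))\<^sup>2" using bend_bound[OF M, of "N * 2 ^ i" i x] by simp
  then have "b\<^sup>2 \<le> (8 * M\<^sup>2 / (len i * real (N * 2 ^ i))\<^sup>2)\<^sup>2" by (metis abs_ge_zero power2_abs power_mono)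
  also have "\<dots> = 64 * M ^ 4 / (len i * real (N * 2 ^ i)) ^ 4"
    by (simp only: power_divide power_mult_distrib[of 8] power_mult[symmetric]) simp
  finally have b2: "2 * b\<^sup>2 \<le> 128 * M ^ 4 / (len i * real (N * 2 ^ i)) ^ 4" by simp
  also have "\<dots> = 128 * M ^ 4 / (len i * real (N * 2 ^ i)) ^ 4 * of_bool (dst x \<le> len i)" using i by simp
  also have "\<dots> \<le> (\<Sum>j<J. 128 * M ^ 4 / (len j * real (N * 2 ^ j)) ^ 4 * of_bool (dst x \<le> len j))"
    by (rule member_le_sum) (use i M in auto)
  finally have part1: "2 * b\<^sup>2 \<le> (\<Sum>j<J. 128 * M ^ 4 / (len j * real (N * 2 ^ j)) ^ 4 * of_bool (dst x \<le> len j))" .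
  have part2: "2 * c\<^sup>2 + (bump (len J) (len J) (x $ 1) * stripe n (1/4) (x $ 2))\<^sup>2 \<le> (200 * M\<^sup>2 / (len J * real n) ^ 4 + 1) * of_bool (dst x \<le> len J)"
  proof (cases "dst x \<le> len J")
    case False
    then have "len J \<le> min (x $ 1) (1 - x $ 1)" unfolding dst_def by linarith
    from bump_eq_0[OF len_bump(4,5,3) this] False show ?thesis by (simp add: c_def)
  next
    case True
    have d: "\<bar>deriv (deriv (bump (len J) (len J))) (x $ 1)\<bar> \<le> 2 * M / (len J)\<^sup>2"
      by (rule bump_deriv_bounds(2)[OF len_bump(4,5,3) M(2,3)])
    have s: "\<bar>\<Sum>k<n. cell (1/4) (x $ 2 * real n - real k)\<bar> \<le> 5"
      by (rule periodic_sum_bound) (use cell_outside(1)[of "1/4"] cell_bounds(1)[of "1/4"] in auto)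
    have "\<bar>c\<bar> = \<bar>deriv (deriv (bump (len J) (len J))) (x $ 1)\<bar> * \<bar>\<Sum>k<n. cell (1/4) (x $ 2 * real n - real k)\<bar> / (real n)\<^sup>2"
      unfolding c_def by (simp add: abs_mult)
    also have "\<dots> \<le> (2 * M / (len J)\<^sup>2) * 5 / (real n)\<^sup>2"
      using d s M by (intro divide_right_mono mult_mono) auto
    also have "\<dots> = 10 * M / (len J * real n)\<^sup>2" by (simp add: power_mult_distrib)
    finally have "c\<^sup>2 \<le> (10 * M / (len J * real n)\<^sup>2)\<^sup>2" by (metis abs_ge_zero power2_abs power_mono)
    also have "\<dots> = 100 * M\<^sup>2 / (len J * real n) ^ 4"
      by (simp only: power_divide power_mult_distrib[of 10] power_mult[symmetric]) simp
    finally have c2: "2 * c\<^sup>2 \<le> 200 * M\<^sup>2 / (len J * real n) ^ 4" by simp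
    have "\<bar>bump (len J) (len J) (x $ 1)\<bar> * \<bar>stripe n (1/4) (x $ 2)\<bar> \<le> 1 * 1"
      using bump_bounds[OF len_bump(4,5,3), of J "x $ 1"] stripe_bound[of "1/4" n "x $ 2"] by (intro mult_mono) auto
    then have "(bump (len J) (len J) (x $ 1) * stripe n (1/4) (x $ 2))\<^sup>2 \<le> 1" 
      by (simp add: abs_mult[symmetric] abs_square_le_1)
    then show ?thesis using c2 True by simp
  qed
  have "(b - c)\<^sup>2 \<le> 2 * b\<^sup>2 + 2 * c\<^sup>2" using zero_le_power2[of "b + c"] by (simp add: power2_eq_square algebra_simps)
  moreover have "(pat11 N J x)\<^sup>2 = (b - c)\<^sup>2" by (simp add: pat11_def b_def c_def n_def)
  moreover have "(pat22 N J x - pattern N J x)\<^sup>2 = (bump (len J) (len J) (x $ 1) * stripe n (1/4) (x $ 2))\<^sup>2"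
    by (simp add: pat22_def n_def)
  ultimately show ?thesis using part1 part2 unfolding n_def by linarith
qed

lemma boundary_layer_measure:
  assumes T: "0 < T" "T \<le> 1/2"
  shows "(\<integral>\<^sup>+x. of_bool (x \<in> box 0 1 \<and> dst x \<le> T) \<partial>lborel) \<le> ennreal (2 * T)"
proof -
  let ?A = "cbox (pt 0 0) (pt T 1)" and ?B = "cbox (pt (1 - T) 0) (pt 1 1)"
  have "(\<integral>\<^sup>+x. of_bool (x \<in> box 0 1 \<and> dst x \<le> T) \<partial>lborel) \<le> (\<integral>\<^sup>+x. indicator ?A x + indicator ?B x \<partial>lborel)"
    by (intro nn_integral_mono) (auto simp: box_real2 cbox_real2 dst_def indicator_def min_def split: if_splits)
  also have "\<dots> = emeasure lborel ?A + emeasure lborel ?B"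
    by (simp add: nn_integral_add)
  also have "\<dots> = ennreal (2 * T)"
    using T by (subst (1 2) measure_cbox_real2) (auto simp: ennreal_plus[symmetric] simp del: ennreal_plus)
  finally show ?thesis .
qed

text \<open>The pointwise bound is integrated: the boundary zone of depth T has area at most 2 T,
  and \<alpha> < 1 absorbs the factor \<alpha>^2.\<close>

lemma elastic_energy_bound:
  assumes \<alpha>: "0 < \<alpha>" "\<alpha> < 1" and M: "1 \<le> M" "\<And>s. \<bar>sstep' s\<bar> \<le> M" "\<And>s. \<bar>sstep'' s\<bar> \<le> M"
    and N: "N > 0" and J: "J > 0"
  shows "(\<integral>\<^sup>+x\<in>unit_square. ennreal ((norm (strain \<alpha> N J x -
         vector [vector [1, 0], vector [0, 1 + \<alpha> * (1 - 2 * phase N J x)]]))\<^sup>2) \<partial>lebesgue)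
    \<le> ennreal ((\<Sum>j<J. 128 * M ^ 4 / (len j * real (N * 2 ^ j)) ^ 4 * (2 * len j)) 
      + (200 * M\<^sup>2 / (len J * real (N * 2 ^ J)) ^ 4 + 1) * (2 * len J))"
proof -
  define c where "c = (\<lambda>j. 128 * M ^ 4 / (len j * real (N * 2 ^ j)) ^ 4)"
  define d where "d = 200 * M\<^sup>2 / (len J * real (N * 2 ^ J)) ^ 4 + 1"
  have c0: "0 \<le> c j" for j unfolding c_def using M by simp
  have d0: "0 \<le> d" unfolding d_def by simp
  let ?I = "\<lambda>j x. (of_bool (x \<in> box 0 1 \<and> dst x \<le> len j)) :: ennreal"
  have Im [measurable]: "?I j \<in> borel_measurable borel" for j
    unfolding dst_def by measurable
  let ?G = "\<lambda>x. (\<Sum>j<J. ennreal (c j) * ?I j x) + ennreal d * ?I J x"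
  have "(\<integral>\<^sup>+x\<in>unit_square. ennreal ((norm (strain \<alpha> N J x -
         vector [vector [1, 0], vector [0, 1 + \<alpha> * (1 - 2 * phase N J x)]]))\<^sup>2) \<partial>lebesgue) \<le> (\<integral>\<^sup>+x. ?G x \<partial>lebesgue)"
  proof (rule nn_integral_mono_AE)
    show "AE x in lebesgue. ennreal ((norm (strain \<alpha> N J x -
         vector [vector [1, 0], vector [0, 1 + \<alpha> * (1 - 2 * phase N J x)]]))\<^sup>2) * indicator unit_square x \<le> ?G x"
      using AE_cbox_box[of 0 1]
    proof eventually_elim
      case (elim x)
      show ?case
      proof (cases "x \<in> box 0 1")
        case True
        have "(norm (strain \<alpha> N J x - vector [vector [1, 0], vector [0, 1 + \<alpha> * (1 - 2 * phase N J x)]]))\<^sup>2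
           = (\<alpha> * pat11 N J x)\<^sup>2 + (\<alpha> * (pat22 N J x - pattern N J x))\<^sup>2"
          unfolding norm_mat22 pattern_phase[OF True N J] by (simp add: strain_def right_diff_distrib)
        also have "\<dots> = \<alpha>\<^sup>2 * ((pat11 N J x)\<^sup>2 + (pat22 N J x - pattern N J x)\<^sup>2)"
          by (simp add: power_mult_distrib distrib_left)
        also have "\<dots> \<le> 1 * ((pat11 N J x)\<^sup>2 + (pat22 N J x - pattern N J x)\<^sup>2)"
          using \<alpha> by (intro mult_right_mono) (auto simp: power_le_one)
        also have "\<dots> \<le> (\<Sum>j<J. c j * of_bool (dst x \<le> len j)) + d * of_bool (dst x \<le> len J)"
          unfolding c_def d_def using elastic_pointwise[OF M True N J] by simp
        finally have "ennreal ((norm (strain \<alpha> N J x - vector [vector [1, 0], vector [0, 1 + \<alpha> * (1 - 2 * phase N J x)]]))\<^sup>2)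
           \<le> ennreal ((\<Sum>j<J. c j * of_bool (dst x \<le> len j)) + d * of_bool (dst x \<le> len J))" by (rule ennreal_leI)
        also have "\<dots> = ennreal (\<Sum>j<J. c j * of_bool (dst x \<le> len j)) + ennreal (d * of_bool (dst x \<le> len J))"
          using c0 d0 by (intro ennreal_plus sum_nonneg) auto
        also have "ennreal (\<Sum>j<J. c j * of_bool (dst x \<le> len j)) = (\<Sum>j<J. ennreal (c j * of_bool (dst x \<le> len j)))"
          using c0 by (subst sum_ennreal) auto
        also have "(\<Sum>j<J. ennreal (c j * of_bool (dst x \<le> len j))) + ennreal (d * of_bool (dst x \<le> len J)) = ?G x"
          using True by (intro arg_cong2[where f="(+)"] sum.cong refl) auto
        finally show ?thesis using elim True by simp
      next
        case False then show ?thesis using elim by simp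
      qed
    qed
  qed
  also have "\<dots> = (\<integral>\<^sup>+x. ?G x \<partial>lborel)" by (simp add: nn_integral_completion)
  also have "\<dots> = (\<integral>\<^sup>+x. (\<Sum>j<J. ennreal (c j) * ?I j x) \<partial>lborel) + (\<integral>\<^sup>+x. ennreal d * ?I J x \<partial>lborel)"
    by (rule nn_integral_add) measurable
  also have "(\<integral>\<^sup>+x. (\<Sum>j<J. ennreal (c j) * ?I j x) \<partial>lborel) = (\<Sum>j<J. \<integral>\<^sup>+x. ennreal (c j) * ?I j x \<partial>lborel)"
    by (rule nn_integral_sum) measurable
  also have "\<dots> = (\<Sum>j<J. ennreal (c j) * (\<integral>\<^sup>+x. ?I j x \<partial>lborel))"
    by (intro sum.cong refl nn_integral_cmult) measurable
  also have "(\<integral>\<^sup>+x. ennreal d * ?I J x \<partial>lborel) = ennreal d * (\<integral>\<^sup>+x. ?I J x \<partial>lborel)"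
    by (rule nn_integral_cmult) measurable
  also have "(\<Sum>j<J. ennreal (c j) * (\<integral>\<^sup>+x. ?I j x \<partial>lborel)) + ennreal d * (\<integral>\<^sup>+x. ?I J x \<partial>lborel)
     \<le> (\<Sum>j<J. ennreal (c j) * ennreal (2 * len j)) + ennreal d * ennreal (2 * len J)"
    by (intro add_mono sum_mono mult_left_mono boundary_layer_measure len_pos len_le) auto
  also have "\<dots> = ennreal ((\<Sum>j<J. c j * (2 * len j)) + d * (2 * len J))"
    using c0 d0 len_pos by (subst ennreal_plus) (auto simp: sum_ennreal[symmetric] ennreal_mult less_imp_le intro!: sum_nonneg)
  finally show ?thesis unfolding c_def d_def .
qed

text \<open>The value 0 for the last level lets its pieces reach the vertical sides.\<close>

definition lower_len :: "nat \<Rightarrow> nat \<Rightarrow> real" where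
  "lower_len J j = (if Suc j < J then len (Suc j) else 0)"

text \<open>The piece of the minority phase in period \<open>k\<close> of level \<open>j\<close>; the flag \<open>s\<close> selects the left or
  right half of the square, the flag \<open>m\<close> the lower or upper inclusion of the period.\<close>

definition piece :: "nat \<Rightarrow> nat \<Rightarrow> nat \<Rightarrow> nat \<Rightarrow> bool \<Rightarrow> bool \<Rightarrow> (real^2) set" where
  "piece N J j k m s = {x. let t = (if s then x $ 1 else 1 - x $ 1); y = x $ 2 * real (N * 2 ^ j) - real k;
       b = (if m then act j (x $ 1) else 3/4 - act j (x $ 1))
     in lower_len J j < t \<and> t \<le> len j \<and> b < y \<and> y \<le> b + 1/4}"

lemma act_measurable [measurable]: "act j \<in> borel_measurable borel"
  using transversal_act[of j] unfolding transversal_def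
  by (intro borel_measurable_continuous_onI smooth1_continuous) auto

lemma piece_measurable: "piece N J j k m s \<in> sets borel"
proof -
  have [measurable]: "(\<lambda>x::real^2. act j (x $ 1)) \<in> borel_measurable borel"
    by (rule measurable_compose[OF measurable_nth2 act_measurable])
  show ?thesis unfolding piece_def Let_def by (cases m; cases s; simp) measurable
qed

lemma act_mono: assumes "s \<le> t" "t \<le> 1/2" shows "act j s \<le> act j t"
  using bump_antimono[OF len_bump(1-3) assms, of j] by (simp add: act_def)

lemma act_reflect: "act j (1 - t) = act j t"
  using bump_reflect[OF len_bump(1-3), of j t] by (simp add: act_def)

text \<open>Within one half of the square \<open>act j\<close> is monotone, so on a horizontal line
  each of the two conditions on the height cuts out a one-sided range. This is why the pieces are
  split by the flag \<open>s\<close>.\<close>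

lemma piece_slice_convex: "slice_convex (piece N J j k m s)"
  unfolding slice_convex_def
proof (intro conjI allI impI)
  fix y p q r :: real
  let ?n = "real (N * 2 ^ j)"
  define a where "a = (\<lambda>t. act j (if s then t else 1 - t))"
  have aa: "act j t = a t" for t by (simp add: a_def act_reflect)
  define u where "u = (\<lambda>t::real. if s then t else 1 - t)"
  assume pr: "pt p y \<in> piece N J j k m s" "pt r y \<in> piece N J j k m s" "p \<le> q" "q \<le> r"
  have half: "u p \<le> 1/2" "u r \<le> 1/2" using pr len_le[of j] by (auto simp: piece_def u_def Let_def)
  have mono: "(act j p \<le> act j q \<and> act j q \<le> act j r) \<or> (act j r \<le> act j q \<and> act j q \<le> act j p)"
  proof (cases s)
    case True
    then show ?thesis using act_mono[of p q j] act_mono[of q r j] half pr by (auto simp: u_def)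
  next
    case False
    then have "act j (1 - r) \<le> act j (1 - q)" "act j (1 - q) \<le> act j (1 - p)"
      using half pr by (auto intro!: act_mono simp: u_def)
    then show ?thesis by (simp add: act_reflect)
  qed
  show "pt q y \<in> piece N J j k m s"
    using pr mono unfolding piece_def Let_def by (cases m; cases s) auto
next
  fix y p q r :: real
  let ?n = "real (N * 2 ^ j)"
  assume pr: "pt y p \<in> piece N J j k m s" "pt y r \<in> piece N J j k m s" "p \<le> q" "q \<le> r"
  have "p * ?n \<le> q * ?n" "q * ?n \<le> r * ?n" using pr by (auto intro!: mult_right_mono)
  then show "pt y q \<in> piece N J j k m s"
    using pr unfolding piece_def Let_def by auto
qed

lemma piece_box:
  assumes N: "N > 0"
  shows "piece N J j k m s \<subseteq> cbox (pt (if s then 0 else 1 - len j) (real k / real (N * 2 ^ j)))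
    (pt ((if s then 0 else 1 - len j) + len j) (real k / real (N * 2 ^ j) + 1 / real (N * 2 ^ j)))"
proof
  fix x assume x: "x \<in> piece N J j k m s"
  let ?n = "real (N * 2 ^ j)"
  have n: "0 < ?n" using N by simp
  have ll: "0 \<le> lower_len J j" using len_pos by (auto simp: lower_len_def less_imp_le)
  have y: "0 \<le> x $ 2 * ?n - real k" "x $ 2 * ?n - real k \<le> 1"
    using x act_bounds[of j "x $ 1"] by (auto simp: piece_def Let_def split: if_splits)
  have "real k / ?n \<le> x $ 2" using y(1) n by (simp only: divide_le_eq) simp
  moreover have "x $ 2 \<le> (real k + 1) / ?n" using y(2) n by (simp only: le_divide_eq) simp
  moreover have "(real k + 1) / ?n = real k / ?n + 1 / ?n" by (rule add_divide_distrib)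
  ultimately show "x \<in> cbox (pt (if s then 0 else 1 - len j) (real k / ?n)) (pt ((if s then 0 else 1 - len j) + len j) (real k / ?n + 1 / ?n))"
    using x ll by (auto simp: cbox_real2 piece_def Let_def split: if_splits)
qed

definition pieces :: "nat \<Rightarrow> nat \<Rightarrow> (nat \<times> nat \<times> bool \<times> bool) set" where
  "pieces N J = (SIGMA j:{..<J}. {..<N * 2 ^ j} \<times> UNIV \<times> UNIV)"

text \<open>On the middle line x_1 = 1/2 both flags \<open>s\<close> would apply at level 0 and
  count a point twice; this null set is left out.\<close>

lemma phase_eq_sum_pieces:
  assumes x: "x \<in> box 0 1" "x $ 1 \<noteq> 1/2" and N: "N > 0" and J: "J > 0"
  shows "phase N J x = (\<Sum>(j, k, m, s)\<in>pieces N J. indicator (piece N J j k m s) x)"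
proof -
  obtain i where i: "i < J" "dst x \<le> len i" "Suc i < J \<longrightarrow> len (Suc i) < dst x"
    "\<forall>j<i. dst x \<le> len (Suc j)" "\<forall>j. i < j \<and> j < J \<longrightarrow> len j < dst x"
    "pattern N J x = stripe (N * 2 ^ i) (act i (x $ 1)) (x $ 2)"
    using level_values[OF x(1) N J] by blast
  have xx: "0 < x $ 1" "x $ 1 < 1" "0 < x $ 2" "x $ 2 \<le> 1" using x by (auto simp: box_real2)
  define s0 where "s0 = (x $ 1 < 1/2)"
  define a where "a = act i (x $ 1)"
  define n where "n = N * 2 ^ i"
  have n: "n > 0" using N by (simp add: n_def)
  have range: "(lower_len J j < (if s then x $ 1 else 1 - x $ 1) \<and> (if s then x $ 1 else 1 - x $ 1) \<le> len j) \<longleftrightarrow> j = i \<and> s = s0"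
    if "j < J" for j s
  proof (cases "s = s0")
    case True
    have "(if s then x $ 1 else 1 - x $ 1) = dst x" unfolding True s0_def dst_def by (auto simp: min_def)
    moreover have "(lower_len J j < dst x \<and> dst x \<le> len j) \<longleftrightarrow> j = i"
    proof
      assume r: "lower_len J j < dst x \<and> dst x \<le> len j"
      have "\<not> i < j" using r i(5) that by force
      moreover have "\<not> j < i"
      proof
        assume "j < i"
        then have "Suc j < J" using i(1) by simp
        then show False using r i(4) \<open>j < i\<close> by (force simp: lower_len_def)
      qed
      ultimately show "j = i" by simp
    next
      assume "j = i"
      then show "lower_len J j < dst x \<and> dst x \<le> len j" 
        using i(2,3) xx by (auto simp: lower_len_def dst_def)
    qed
    ultimately show ?thesis using True by simp
  next
    case False
    then have "(if s then x $ 1 else 1 - x $ 1) > 1/2" using x(2) by (auto simp: s0_def)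
    then show ?thesis using False len_le[of j] by auto
  qed
  have ind: "indicator (piece N J j k m s) x = (if j = i \<and> s = s0 then 
      of_bool ((if m then a else 3/4 - a) < x $ 2 * real n - real k \<and> x $ 2 * real n - real k \<le> (if m then a else 3/4 - a) + 1/4) else 0 :: real)"
    if "j < J" for j k m s
  proof -
    have "x \<in> piece N J j k m s \<longleftrightarrow> (j = i \<and> s = s0) \<and> (if m then act j (x $ 1) else 3/4 - act j (x $ 1)) < x $ 2 * real (N * 2 ^ j) - real k
       \<and> x $ 2 * real (N * 2 ^ j) - real k \<le> (if m then act j (x $ 1) else 3/4 - act j (x $ 1)) + 1/4"
      unfolding piece_def Let_def mem_Collect_eq using range[OF that, of s] by blast
    then show ?thesis unfolding indicator_def by (cases "j = i \<and> s = s0") (simp_all only: a_def n_def simp_thms if_True if_False of_bool_eq)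
  qed
  have "(\<Sum>(j, k, m, s)\<in>pieces N J. indicator (piece N J j k m s) x :: real) = 
      (\<Sum>j<J. \<Sum>(k, m, s)\<in>{..<N * 2 ^ j} \<times> UNIV \<times> UNIV. indicator (piece N J j k m s) x)"
    unfolding pieces_def by (subst sum.Sigma) (auto intro!: sum.cong)
  also have "\<dots> = (\<Sum>j\<in>{i}. \<Sum>(k, m, s)\<in>{..<N * 2 ^ j} \<times> UNIV \<times> UNIV. indicator (piece N J j k m s) x)"
    by (rule sum.mono_neutral_right) (use i(1) ind in \<open>auto intro!: sum.neutral\<close>)
  also have "\<dots> = (\<Sum>k<n. \<Sum>m\<in>UNIV. \<Sum>s\<in>UNIV. indicator (piece N J i k m s) x)"
    by (simp add: sum.cartesian_product n_def)
  also have "\<dots> = (\<Sum>k<n. minority a (x $ 2 * real n - real k))"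
  proof (rule sum.cong[OF refl])
    fix k
    have "(\<Sum>m\<in>UNIV. \<Sum>s\<in>UNIV. indicator (piece N J i k m s) x) = (\<Sum>m\<in>UNIV. 
      of_bool ((if m then a else 3/4 - a) < x $ 2 * real n - real k \<and> x $ 2 * real n - real k \<le> (if m then a else 3/4 - a) + 1/4) :: real)"
      by (rule sum.cong[OF refl]) (cases s0; simp add: UNIV_bool ind[OF i(1)])
    then show "(\<Sum>m\<in>UNIV. \<Sum>s\<in>UNIV. indicator (piece N J i k m s) x) = minority a (x $ 2 * real n - real k)"
      by (simp add: UNIV_bool minority_def)
  qed
  also have "\<dots> = phase N J x"
  proof -
    have "pattern N J x = 1 - 2 * (\<Sum>k<n. minority a (x $ 2 * real n - real k))"
      unfolding i(6) n_def[symmetric] a_def[symmetric]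
      by (rule stripe_minority(1)) (use act_bounds n xx in \<open>auto simp: a_def\<close>)
    then show ?thesis using pattern_phase[OF x(1) N J] by simp
  qed
  finally show ?thesis by simp
qed

lemma AE_component: "AE x in (lebesgue :: (real^2) measure). x $ 1 \<noteq> c"
proof -
  have "negligible {x::real^2. x \<bullet> axis 1 1 = c}"
    by (rule negligible_standard_hyperplane) (simp add: Basis_real2)
  then have "AE x in lebesgue. x \<notin> {x::real^2. x \<bullet> axis 1 1 = c}"
    by (intro AE_not_in) (simp add: negligible_iff_null_sets)
  then show ?thesis by (simp add: inner_axis)
qed

text \<open>Level j has 4 N 2^j pieces in boxes with sides \<open>len j\<close> and 1/(N 2^j). Their
  horizontal sides sum to 4 N (4/5)^j, a convergent series, and the vertical ones to 8 per level,
  whence the term in \<open>J\<close>.\<close>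

lemma phase_total_variation:
  assumes N: "N > 0" and J: "J > 0"
  shows "total_variation (interior unit_square) (phase N J) \<le> ennreal (20 * real N + 8 * real J)"
proof -
  let ?W = "\<lambda>(j, k, m, s). len j" and ?V = "\<lambda>(j, k, m, s). 1 / real (N * 2 ^ j)"
  have fin: "finite (pieces N J)" unfolding pieces_def by auto
  have ae: "AE x in lebesgue. x \<in> box 0 1 \<longrightarrow> phase N J x = (\<Sum>i\<in>pieces N J. indicator ((\<lambda>(j, k, m, s). piece N J j k m s) i) x)"
    using AE_component[of "1/2"]
    by eventually_elim (auto simp: phase_eq_sum_pieces[OF _ _ N J] case_prod_beta)
  have "total_variation (interior unit_square) (phase N J) \<le> ennreal (\<Sum>i\<in>pieces N J. 2 * (?W i + ?V i))"
  proof (rule total_variation_slices[OF fin ae, where ?l1.0 = "\<lambda>(j, k, m, s). if s then 0 else 1 - len j" and ?l2.0 = "\<lambda>(j, k, m, s). real k / real (N * 2 ^ j)"])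
    fix i :: "nat \<times> nat \<times> bool \<times> bool"
    obtain j k m s where i: "i = (j, k, m, s)" by (cases i)
    show "(\<lambda>(j, k, m, s). piece N J j k m s) i \<in> sets borel"
      unfolding i split by (rule piece_measurable)
    show "slice_convex ((\<lambda>(j, k, m, s). piece N J j k m s) i)"
      unfolding i split by (rule piece_slice_convex)
    show "(\<lambda>(j, k, m, s). piece N J j k m s) i \<subseteq> cbox (pt ((\<lambda>(j, k, m, s). if s then 0 else 1 - len j) i) ((\<lambda>(j, k, m, s). real k / real (N * 2 ^ j)) i))
      (pt ((\<lambda>(j, k, m, s). if s then 0 else 1 - len j) i + ?W i) ((\<lambda>(j, k, m, s). real k / real (N * 2 ^ j)) i + ?V i))"
      unfolding i split by (rule piece_box[OF N])
    show "0 \<le> ?W i" "0 \<le> ?V i" unfolding i split using len_pos[of j] by auto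
  qed
  also have "(\<Sum>i\<in>pieces N J. 2 * (?W i + ?V i)) = (\<Sum>j<J. \<Sum>i\<in>{..<N * 2 ^ j} \<times> (UNIV :: bool set) \<times> (UNIV :: bool set). 2 * (len j + 1 / real (N * 2 ^ j)))"
    unfolding pieces_def by (subst sum.Sigma) (auto intro!: sum.cong)
  also have "\<dots> = (\<Sum>j<J. 4 * real N * (4/5) ^ j + 8)"
  proof (rule sum.cong[OF refl])
    fix j
    have "(\<Sum>i\<in>{..<N * 2 ^ j} \<times> (UNIV :: bool set) \<times> (UNIV :: bool set). 2 * (len j + 1 / real (N * 2 ^ j))) = 
       real (N * 2 ^ j) * 4 * (2 * (len j + 1 / real (N * 2 ^ j)))"
      by (simp add: card_cartesian_product)
    also have "\<dots> = 8 * (real (N * 2 ^ j) * len j) + 8" using N by (simp add: field_simps)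
    also have "real (N * 2 ^ j) * len j = real N * (4/5) ^ j / 2"
    proof -
      have "(2::real) ^ j * (2/5) ^ j = (4/5) ^ j" unfolding power_mult_distrib[symmetric] by simp
      then show ?thesis by (simp add: len_def mult.assoc)
    qed
    finally show "(\<Sum>i\<in>{..<N * 2 ^ j} \<times> (UNIV :: bool set) \<times> (UNIV :: bool set). 2 * (len j + 1 / real (N * 2 ^ j))) = 4 * real N * (4/5) ^ j + 8" by simp
  qed
  also have "\<dots> = 4 * real N * (\<Sum>j<J. (4/5) ^ j) + 8 * real J"
    by (simp add: sum.distrib sum_distrib_left)
  also have "(\<Sum>j<J. (4/5::real) ^ j) = 5 * (1 - (4/5) ^ J)"
    by (subst sum_gp_strict) simp
  also have "ennreal (4 * real N * (5 * (1 - (4/5) ^ J)) + 8 * real J) \<le> ennreal (20 * real N + 8 * real J)"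
  proof (rule ennreal_leI)
    have "4 * real N * (5 * (1 - (4/5) ^ J)) \<le> 4 * real N * 5"
      by (rule mult_left_mono) auto
    then show "4 * real N * (5 * (1 - (4/5) ^ J)) + 8 * real J \<le> 20 * real N + 8 * real J" by simp
  qed
  finally show ?thesis .
qed

lemma pattern_measurable [measurable]: "N > 0 \<Longrightarrow> pattern N J \<in> borel_measurable borel"
proof -
  assume N: "N > 0"
  have "N * 2 ^ j > 0" for j using N by simp
  note m = has_potential_measurable(2)[OF has_potential_stripe(1)[OF this]] has_potential_measurable(2)[OF has_potential_stripe(2)[OF this]]
  have "(\<lambda>x::real^2. stripe N (1/4) (x $ 2) + (\<Sum>j<J. stripe (N * 2 ^ j) (act j (x $ 1)) (x $ 2) - stripe (N * 2 ^ j) (1/4) (x $ 2))) \<in> borel_measurable borel"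
    using m m(1)[of 0] by (intro borel_measurable_add borel_measurable_sum borel_measurable_diff) auto
  then show ?thesis by (simp add: pattern_def[abs_def])
qed

lemma phase_BV:
  assumes N: "N > 0" and J: "J > 0"
  shows "phase N J \<in> BV_phase"
proof -
  have "phase N J \<in> borel_measurable borel"
    using pattern_measurable[OF N, of J] unfolding phase_def[abs_def] by measurable
  then have "loc_bdd (phase N J)" by (rule loc_bdd_bounded[of _ 1]) (auto simp: phase_def)
  then have "phase N J absolutely_integrable_on unit_square" by (rule loc_bdd_absint) (rule compact_cbox)
  moreover have "total_variation (interior unit_square) (phase N J) < \<infinity>"
    using phase_total_variation[OF N J] by (simp add: le_less_trans)
  ultimately show ?thesis by (auto simp: BV_phase_def phase_def)
qed

section \<open>The scaling law\<close>

text \<open>The number of levels is chosen such that the last periods are comparable to their distance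
  from the vertical sides, while the remaining layer has width \<open>N\<^sup>-\<^sup>4\<close>. Both are possible at once
  because \<open>(4/5)\<^sup>4 \<ge> 2/5\<close>, and the bending energy of the levels is summable because \<open>16 (2/5)\<^sup>3 > 1\<close>.\<close>

lemma number_of_levels:
  assumes N: "N > (0::nat)"
  obtains J where "J > 0" "2 * len J \<le> 1 / real N ^ 4" "1 / (len J * real (N * 2 ^ J)) ^ 4 \<le> 40" "real J \<le> 8 * real N"
proof -
  have N1: "1 \<le> real N" using N by simp
  have ex: "\<exists>J. (2/5::real) ^ J < 1 / real N ^ 4"
    using real_arch_pow_inv[of "1 / real N ^ 4" "2/5"] N by simp
  \<comment> \<open>Minimality gives the reverse inequality at J - 1, so (2/5)^J is comparable to
    N^-4 from both sides.\<close>
  define J where "J = (LEAST J. (2/5::real) ^ J < 1 / real N ^ 4)"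
  have J1: "(2/5) ^ J < 1 / real N ^ 4" unfolding J_def using ex by (rule LeastI_ex)
  have J0: "J > 0"
  proof (rule ccontr)
    assume "\<not> J > 0"
    then have "1 < 1 / real N ^ 4" using J1 by simp
    moreover have "1 / real N ^ 4 \<le> 1" using N1 by (simp add: divide_le_eq)
    ultimately show False by simp
  qed
  have "\<not> (2/5::real) ^ (J - 1) < 1 / real N ^ 4"
    using not_less_Least[of "J - 1" "\<lambda>J. (2/5::real) ^ J < 1 / real N ^ 4"] J0 by (simp add: J_def)
  moreover have "(2/5::real) ^ J = 2/5 * (2/5) ^ (J - 1)" using J0 by (cases J) auto
  ultimately have J2: "2/5 / real N ^ 4 \<le> (2/5) ^ J" by simp
  have N4: "0 < real N ^ 4" using N by simp
  have "(2/5::real) ^ J \<le> (256/625) ^ J" by (rule power_mono) auto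
  also have "(256/625::real) ^ J = ((4/5) ^ J) ^ 4"
    by (simp only: power_mult[symmetric] mult.commute[of J 4]) (simp add: power_mult power_divide)
  finally have J3: "2/5 / real N ^ 4 \<le> ((4/5) ^ J) ^ 4" using J2 by linarith
  have p45: "(2::real) ^ J * (2/5) ^ J = (4/5) ^ J" unfolding power_mult_distrib[symmetric] by simp
  have eq: "len J * real (N * 2 ^ J) = real N * (4/5) ^ J / 2"
    using p45 by (simp add: len_def mult_ac)
  have "2/5 \<le> real N ^ 4 * ((4/5) ^ J) ^ 4" using J3 N4 by (simp add: field_simps)
  moreover have "(len J * real (N * 2 ^ J)) ^ 4 = real N ^ 4 * ((4/5) ^ J) ^ 4 / 16"
    unfolding eq power_divide[of "real N * (4/5) ^ J"] power_mult_distrib[of "real N"] by simp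
  \<comment> \<open>The constant is 2/5 divided by 2^4, the latter from the factor 1/2 in
    \<open>len\<close>.\<close>
  ultimately have l0: "1/40 \<le> (len J * real (N * 2 ^ J)) ^ 4" by linarith
  then have "0 < (len J * real (N * 2 ^ J)) ^ 4" by linarith
  then have l1: "1 / (len J * real (N * 2 ^ J)) ^ 4 \<le> 40"
    by (subst pos_divide_le_eq) (use l0 in linarith)+
  have "((5/4::real) ^ J) ^ 4 * ((4/5) ^ J) ^ 4 = 1" 
    unfolding power_mult_distrib[symmetric] by simp
  then have "((5/4::real) ^ J) ^ 4 * (2/5 / real N ^ 4) \<le> 1"
    using mult_left_mono[OF J3, of "((5/4::real) ^ J) ^ 4"] by simp
  then have "((5/4::real) ^ J) ^ 4 \<le> 5/2 * real N ^ 4" using N4 by (simp add: field_simps)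
  also have "\<dots> \<le> (2 * real N) ^ 4" by (simp add: power_mult_distrib)
  finally have "((5/4::real) ^ J) ^ 4 \<le> (2 * real N) ^ 4" .
  then have "(5/4::real) ^ J \<le> 2 * real N" by (subst (asm) power_mono_iff) auto
  \<comment> \<open>Bernoulli trades the exponential bound (5/4)^J <= 2 N for a linear one, which is
    enough for the vertical interfaces.\<close>
  moreover have "1 + real J * (1/4) \<le> (1 + 1/4) ^ J" by (rule Bernoulli_inequality) simp
  ultimately have l2: "real J \<le> 8 * real N" by simp
  show ?thesis
    by (rule that[OF J0 _ l1 l2]) (use J1 in \<open>simp add: len_def\<close>)
qed

text \<open>The ratio is (2/5)/(4/5)^4 = 125/128: each level has 2/5 of the area of the previous one
  but a bending density larger by (5/4)^4, and the product stays just below 1.\<close>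

lemma level_energy:
  assumes N: "N > (0::nat)"
  shows "1 / (len j * real (N * 2 ^ j)) ^ 4 * (2 * len j) = 16 / real N ^ 4 * (125/128) ^ j"
proof -
  have p45: "(2::real) ^ j * (2/5) ^ j = (4/5) ^ j" unfolding power_mult_distrib[symmetric] by simp
  have eq: "len j * real (N * 2 ^ j) = real N * (4/5) ^ j / 2"
    using p45 by (simp add: len_def mult_ac)
  have "((4/5::real) ^ j) ^ 4 * (125/128) ^ j = (2/5) ^ j"
  proof -
    have "((4/5::real) ^ j) ^ 4 = (256/625) ^ j"
      by (simp only: power_mult[symmetric] mult.commute[of j 4]) (simp add: power_mult power_divide)
    then show ?thesis unfolding power_mult_distrib[symmetric] by (simp add: power_mult_distrib[symmetric])
  qed
  then have "(2/5) ^ j / ((4/5::real) ^ j) ^ 4 = (125/128) ^ j" by (simp add: field_simps)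
  moreover have "(len j * real (N * 2 ^ j)) ^ 4 = real N ^ 4 * ((4/5) ^ j) ^ 4 / 16"
    unfolding eq power_divide[of "real N * (4/5) ^ j"] power_mult_distrib[of "real N"] by simp
  then have "1 / (len j * real (N * 2 ^ j)) ^ 4 * (2 * len j) = 16 / real N ^ 4 * ((2/5) ^ j / ((4/5) ^ j) ^ 4)"
    by (simp only: len_def) simp
  ultimately show ?thesis by simp
qed

theorem energy_upper_bound:
  assumes \<alpha>: "0 < \<alpha>" "\<alpha> < 1"
  shows "\<exists>C>0. \<forall>\<epsilon>. 0 < \<epsilon> \<and> \<epsilon> < 1 \<longrightarrow> (\<exists>u\<in>BV_phase. \<exists>v w. has_sym_grad v w \<and> w \<in> D_curl_curl (mat 1) \<and>
     energy \<alpha> \<epsilon> w u \<le> ennreal (C * \<epsilon> powr (4/5)))"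
proof -
  obtain M0 where M0: "M0 > 0" "\<forall>s. \<bar>sstep' s\<bar> \<le> M0" "\<forall>s. \<bar>sstep'' s\<bar> \<le> M0" using sstep_deriv_bound by blast
  define M where "M = max 1 M0"
  have M: "1 \<le> M" "\<And>s. \<bar>sstep' s\<bar> \<le> M" "\<And>s. \<bar>sstep'' s\<bar> \<le> M"
    using M0 by (auto simp: M_def le_max_iff_disj)
  \<comment> \<open>128/3 bounds the geometric series with ratio 125/128, and 8000 = 200 * 40 comes
    from the bound 40 for the last level.\<close>
  define C1 where "C1 = 128 * M ^ 4 * 16 * (128/3) + (8000 * M\<^sup>2 + 1)"
  have C1: "0 < C1" unfolding C1_def using M(1) by (intro add_nonneg_pos) auto
  have "\<exists>u\<in>BV_phase. \<exists>v w. has_sym_grad v w \<and> w \<in> D_curl_curl (mat 1) \<and>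
     energy \<alpha> \<epsilon> w u \<le> ennreal ((C1 + 168) * \<epsilon> powr (4/5))" if \<epsilon>: "0 < \<epsilon>" "\<epsilon> < 1" for \<epsilon>
  proof -
    define h where "h = \<epsilon> powr (1/5)"
    have h: "0 < h" "h < 1" using \<epsilon> powr_less_mono2[of "1/5" \<epsilon> 1] by (auto simp: h_def)
    have h5: "h ^ 5 = \<epsilon>" using \<epsilon> by (simp add: h_def powr_power)
    have h4: "h ^ 4 = \<epsilon> powr (4/5)" using \<epsilon> by (simp add: h_def powr_power)
    \<comment> \<open>Rounding 1/h up at most doubles it because h < 1. With J <= 8 N this produces
      the interface constant 168 = (20 + 8 * 8) * 2.\<close>
    define N where "N = nat \<lceil>1 / h\<rceil>"
    have Nh: "1 / h \<le> real N" "real N \<le> 1 / h + 1" unfolding N_def using h by (auto simp: real_nat_ceiling_ge)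
    have "1 < 1 / h" using h by simp
    then have N: "N > 0" "real N \<le> 2 / h" using Nh by auto
    have N4: "1 / real N ^ 4 \<le> h ^ 4"
    proof -
      have "1 / real N \<le> h" using Nh h N by (simp add: field_simps)
      then have "(1 / real N) ^ 4 \<le> h ^ 4" by (rule power_mono) simp
      then show ?thesis by (simp add: power_divide)
    qed
    obtain J where J: "J > 0" "2 * len J \<le> 1 / real N ^ 4" "1 / (len J * real (N * 2 ^ J)) ^ 4 \<le> 40" "real J \<le> 8 * real N"
      using number_of_levels[OF N(1)] by blast
    let ?q = "\<lambda>j. 1 / (len j * real (N * 2 ^ j)) ^ 4"
    have "(\<Sum>j<J. 128 * M ^ 4 / (len j * real (N * 2 ^ j)) ^ 4 * (2 * len j)) = (\<Sum>j<J. 128 * M ^ 4 * (16 / real N ^ 4) * (125/128) ^ j)"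
    proof (rule sum.cong[OF refl])
      fix j
      have "128 * M ^ 4 / (len j * real (N * 2 ^ j)) ^ 4 * (2 * len j) = 128 * M ^ 4 * (?q j * (2 * len j))" by simp
      also have "\<dots> = 128 * M ^ 4 * (16 / real N ^ 4) * (125/128) ^ j" unfolding level_energy[OF N(1)] by simp
      finally show "128 * M ^ 4 / (len j * real (N * 2 ^ j)) ^ 4 * (2 * len j) = 128 * M ^ 4 * (16 / real N ^ 4) * (125/128) ^ j" .
    qed
    also have "\<dots> = 128 * M ^ 4 * (16 / real N ^ 4) * (\<Sum>j<J. (125/128) ^ j)" by (rule sum_distrib_left[symmetric])
    also have "(\<Sum>j<J. (125/128::real) ^ j) = (128/3) * (1 - (125/128) ^ J)" by (subst sum_gp_strict) simp
    also have "128 * M ^ 4 * (16 / real N ^ 4) * ((128/3) * (1 - (125/128) ^ J)) \<le> 128 * M ^ 4 * (16 / real N ^ 4) * ((128/3) * 1)"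
      by (intro mult_left_mono) auto
    also have "\<dots> = 128 * M ^ 4 * 16 * (128/3) * (1 / real N ^ 4)" by simp
    finally have b1: "(\<Sum>j<J. 128 * M ^ 4 / (len j * real (N * 2 ^ j)) ^ 4 * (2 * len j)) \<le> 128 * M ^ 4 * 16 * (128/3) * (1 / real N ^ 4)" .
    have "200 * M\<^sup>2 / (len J * real (N * 2 ^ J)) ^ 4 + 1 = 200 * M\<^sup>2 * ?q J + 1" by simp
    also have "\<dots> \<le> 200 * M\<^sup>2 * 40 + 1" using J(3) by (intro add_right_mono mult_left_mono) auto
    finally have "(200 * M\<^sup>2 / (len J * real (N * 2 ^ J)) ^ 4 + 1) * (2 * len J) \<le> (8000 * M\<^sup>2 + 1) * (1 / real N ^ 4)"
      using J(2) len_pos[of J] by (intro mult_mono) auto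
    with b1 have "(\<Sum>j<J. 128 * M ^ 4 / (len j * real (N * 2 ^ j)) ^ 4 * (2 * len j)) + (200 * M\<^sup>2 / (len J * real (N * 2 ^ J)) ^ 4 + 1) * (2 * len J) 
       \<le> C1 * (1 / real N ^ 4)" unfolding C1_def by (simp only: distrib_right)
    also have "\<dots> \<le> C1 * h ^ 4" using C1 N4 by (intro mult_left_mono) auto
    finally have el: "(\<integral>\<^sup>+x\<in>unit_square. ennreal ((norm (strain \<alpha> N J x -
         vector [vector [1, 0], vector [0, 1 + \<alpha> * (1 - 2 * phase N J x)]]))\<^sup>2) \<partial>lebesgue) \<le> ennreal (C1 * h ^ 4)"
      using elastic_energy_bound[OF \<alpha> M N(1) J(1)] ennreal_leI order_trans by blast
    have "ennreal \<epsilon> * total_variation (interior unit_square) (phase N J) \<le> ennreal \<epsilon> * ennreal (20 * real N + 8 * real J)"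
      by (intro mult_left_mono phase_total_variation N J) auto
    also have "\<dots> = ennreal (\<epsilon> * (20 * real N + 8 * real J))" using \<epsilon> by (intro ennreal_mult[symmetric]) auto
    also have "\<dots> \<le> ennreal (168 * h ^ 4)"
    proof (rule ennreal_leI)
      have "20 * real N + 8 * real J \<le> 84 * real N" using J(4) by simp
      also have "\<dots> \<le> 84 * (2 / h)" using N(2) by (intro mult_left_mono) auto
      finally have "\<epsilon> * (20 * real N + 8 * real J) \<le> \<epsilon> * (84 * (2 / h))" using \<epsilon> by (intro mult_left_mono) auto
      also have "\<dots> = 168 * h ^ 4" unfolding h5[symmetric] using h by (simp add: eval_nat_numeral)
      finally show "\<epsilon> * (20 * real N + 8 * real J) \<le> 168 * h ^ 4" .
    qed
    finally have "energy \<alpha> \<epsilon> (strain \<alpha> N J) (phase N J) \<le> ennreal (C1 * h ^ 4) + ennreal (168 * h ^ 4)"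
      unfolding energy_def using el by (intro add_mono)
    also have "\<dots> = ennreal ((C1 + 168) * \<epsilon> powr (4/5))"
      using C1 h by (subst ennreal_plus[symmetric]) (auto simp: h4 distrib_right)
    finally show ?thesis
      using phase_BV[OF N(1) J(1)] strain_admissible[OF N(1) J(1)] by blast
  qed
  moreover have "C1 + 168 > 0" using C1 by simp
  ultimately show ?thesis by blast
qed

text \<open>The constants multiply the infimum, hence they are the reciprocals of those in the two
  energy bounds. The lower bound holds for every compatible \<open>w\<close>; the construction
  supplies the displacement \<open>v\<close> together with its strain.\<close>

theorem proposition3p10:
  fixes \<alpha> :: real and F :: "real^2^2"
  assumes "0 < \<alpha>" and "\<alpha> < 1" and "F = mat 1"
  shows "\<exists>\<epsilon>\<^sub>0>0. \<exists>c>0. \<exists>C>0. \<forall>\<epsilon>::real. 0 < \<epsilon> \<and> \<epsilon> < \<epsilon>\<^sub>0 \<longrightarrow>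
    (let I = (INF u\<in>BV_phase. INF (v, w)\<in>{(v, w). has_sym_grad v w \<and> w \<in> D_curl_curl F}.
                energy \<alpha> \<epsilon> w u)
     in ennreal c * I \<le> ennreal (\<epsilon> powr (4/5)) \<and>
        ennreal (\<epsilon> powr (4/5)) \<le> ennreal C * I)"
proof -
  obtain e0 c where e0: "e0 > 0" and c: "c > 0" and low: "\<forall>\<epsilon>. 0 < \<epsilon> \<and> \<epsilon> < e0 \<longrightarrow> (\<forall>u\<in>BV_phase. \<forall>w\<in>D_curl_curl (mat 1).
     ennreal (c * \<epsilon> powr (4/5)) \<le> energy \<alpha> \<epsilon> w u)"
    using energy_lower_bound[OF assms(1,2)] by blast
  obtain C where C: "C > 0" and up: "\<forall>\<epsilon>. 0 < \<epsilon> \<and> \<epsilon> < 1 \<longrightarrow> (\<exists>u\<in>BV_phase. \<exists>v w. has_sym_grad v w \<and> w \<in> D_curl_curl (mat 1) \<and>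
     energy \<alpha> \<epsilon> w u \<le> ennreal (C * \<epsilon> powr (4/5)))"
    using energy_upper_bound[OF assms(1,2)] by blast
  have main: "ennreal (1 / C) * (INF u\<in>BV_phase. INF (v, w)\<in>{(v, w). has_sym_grad v w \<and> w \<in> D_curl_curl F}. energy \<alpha> \<epsilon> w u) \<le> ennreal (\<epsilon> powr (4/5)) \<and>
      ennreal (\<epsilon> powr (4/5)) \<le> ennreal (1 / c) * (INF u\<in>BV_phase. INF (v, w)\<in>{(v, w). has_sym_grad v w \<and> w \<in> D_curl_curl F}. energy \<alpha> \<epsilon> w u)"
    (is "ennreal (1 / C) * ?I \<le> _ \<and> _ \<le> _ * ?I") if \<epsilon>: "0 < \<epsilon>" "\<epsilon> < min e0 1" for \<epsilon>
  proof
    obtain u v w where uvw: "u \<in> BV_phase" "has_sym_grad v w" "w \<in> D_curl_curl F" "energy \<alpha> \<epsilon> w u \<le> ennreal (C * \<epsilon> powr (4/5))"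
      using up \<epsilon> assms(3) by (metis min_less_iff_conj)
    have "?I \<le> (INF (v, w)\<in>{(v, w). has_sym_grad v w \<and> w \<in> D_curl_curl F}. energy \<alpha> \<epsilon> w u)"
      by (rule INF_lower[OF uvw(1)])
    also have "\<dots> \<le> energy \<alpha> \<epsilon> w u" using uvw by (intro INF_lower2[of "(v, w)"]) auto
    also have "\<dots> \<le> ennreal (C * \<epsilon> powr (4/5))" by (rule uvw(4))
    finally have "ennreal (1 / C) * ?I \<le> ennreal (1 / C) * ennreal (C * \<epsilon> powr (4/5))" by (rule mult_left_mono) simp
    also have "\<dots> = ennreal (\<epsilon> powr (4/5))" using C by (simp add: ennreal_mult[symmetric])
    finally show "ennreal (1 / C) * ?I \<le> ennreal (\<epsilon> powr (4/5))" .
    have "ennreal (c * \<epsilon> powr (4/5)) \<le> ?I"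
      using low \<epsilon> unfolding assms(3) by (intro INF_greatest) (auto split: prod.splits)
    then have "ennreal (1 / c) * ennreal (c * \<epsilon> powr (4/5)) \<le> ennreal (1 / c) * ?I" by (rule mult_left_mono) simp
    moreover have "ennreal (1 / c) * ennreal (c * \<epsilon> powr (4/5)) = ennreal (\<epsilon> powr (4/5))"
      using c by (simp add: ennreal_mult[symmetric])
    ultimately show "ennreal (\<epsilon> powr (4/5)) \<le> ennreal (1 / c) * ?I" by simp
  qed
  show ?thesis unfolding Let_def
    by (rule exI[of _ "min e0 1"], rule conjI[OF _ exI[of _ "1 / C"]], use e0 in simp, rule conjI[OF _ exI[of _ "1 / c"]], use C in simp)
       (use c main in auto)
qed

end
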